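(* Let $d\ge 1$ be an integer. Then $\mathcal{E}\mathfrak{S}_{2d}\subsetneq\mathcal{E}\mathfrak{P}_{2d}$ if and only if $2d\ge 10$. (One always has $\mathcal{E}\mathfrak{S}_{2d}\subseteq\mathcal{E}\mathfrak{P}_{2d}$, so the statement says that the two cones are equal for $2d\in\{2,4,6,8\}$ and that the inclusion is strict for all $2d\ge 10$.)
   Context: For $n,r\ge 1$ let $p_r^{(n)}=\frac{1}{n}(x_1^r+\dots+x_n^r)\in\mathbb{R}[x_1,\dots,x_n]$, and for a partition $\lambda=(\lambda_1,\dots,\lambda_k)$ let $p_\lambda^{(n)}=\prod_{i}p_{\lambda_i}^{(n)}$ (power means). A partition is called even if all its parts are even; there are $\pi(d)$ even partitions of $2d$ (where $\pi(d)$ is the number of partitions of $d$), and they index the coordinates of $\mathbb{R}^{\pi(d)}$. A form is nonnegative if it takes nonnegative values on all of $\mathbb{R}^n$; it is a sum of squares if it is a finite sum of squares of real polynomials. $\mathcal{E}\mathfrak{S}_{2d}$ is the set of $c\in\mathbb{R}^{\pi(d)}$ such that $\sum_{\lambda}c_\lambda p_\lambda^{(n)}$ (sum over even partitions $\lambda$ of $2d$) is a sum of squares for every $n\ge 2d$. $\mathcal{E}\mathfrak{P}_{2d}$ is the set of $c\in\mathbb{R}^{\pi(d)}$ such that $\sum_{\lambda}c_\lambda p_\lambda^{(n)}$ is nonnegative for every $n\ge 2d$. (These cones coincide with the closures of the unions over $n\ge 2d$ of the analogous cones defined for each $n$ with $p_\lambda^{(n)}$ replaced by the monomial mean $m_\lambda^{(n)}$,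 the arithmetic mean of all monomials obtained by permuting the variables in $x_1^{\lambda_1}\cdots x_k^{\lambda_k}$.) *)

theory Defs
  imports Complex_Main "HOL-Library.Poly_Mapping" "HOL-Library.Multiset" "HOL-Library.FuncSet"
begin

section \<open>Real polynomials in \<open>x\<^sub>1, \<dots>, x\<^sub>n\<close>\<close>

text \<open>
  A monomial is a finitely supported exponent vector \<open>nat \<Rightarrow>\<^sub>0 nat\<close>, a polynomial a finitely
  supported map from monomials to coefficients; the ring structure (convolution product) is that
  of \<^theory>\<open>HOL-Library.Poly_Mapping\<close>.
\<close>

type_synonym mpoly_real = "(nat \<Rightarrow>\<^sub>0 nat) \<Rightarrow>\<^sub>0 real"

definition mpoly_const :: "real \<Rightarrow> mpoly_real" where
  "mpoly_const a = Poly_Mapping.single 0 a"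

definition mpoly_var :: "nat \<Rightarrow> mpoly_real" where
  "mpoly_var i = Poly_Mapping.single (Poly_Mapping.single i 1) 1"

definition mpolys :: "nat \<Rightarrow> mpoly_real set" where
  "mpolys n = {f. \<forall>m \<in> Poly_Mapping.keys f. Poly_Mapping.keys m \<subseteq> {1..n}}"

definition mpoly_eval :: "(nat \<Rightarrow> real) \<Rightarrow> mpoly_real \<Rightarrow> real" where
  "mpoly_eval x f =
     (\<Sum>m \<in> Poly_Mapping.keys f. Poly_Mapping.lookup f m *
        (\<Prod>i \<in> Poly_Mapping.keys m. x i ^ Poly_Mapping.lookup m i))"

definition sum_of_squares :: "nat \<Rightarrow> mpoly_real \<Rightarrow> bool" where
  "sum_of_squares n f \<longleftrightarrow> (\<exists>gs. set gs \<subseteq> mpolys n \<and> f = (\<Sum>g\<leftarrow>gs. g ^ 2))"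

text \<open>Points of \<open>\<real>\<^sup>n\<close> are extensional functions on the index set \<open>{1..n}\<close>.\<close>

definition nonnegative :: "nat \<Rightarrow> mpoly_real \<Rightarrow> bool" where
  "nonnegative n f \<longleftrightarrow> (\<forall>x \<in> {1..n} \<rightarrow>\<^sub>E (UNIV :: real set). 0 \<le> mpoly_eval x f)"

section \<open>Even partitions and power means\<close>

definition even_partitions :: "nat \<Rightarrow> nat multiset set" where
  "even_partitions k = {\<mu>. (\<forall>r \<in># \<mu>. 0 < r \<and> even r) \<and> \<Sum>\<^sub># \<mu> = k}"

lemma finite_even_partitions: "finite (even_partitions k)"
proof (rule finite_subset)
  show "finite (mset ` {xs. set xs \<subseteq> {..k} \<and> length xs \<le> k})"
    by (intro finite_imageI finite_lists_length_le) simp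
next
  show "even_partitions k \<subseteq> mset ` {xs. set xs \<subseteq> {..k} \<and> length xs \<le> k}"
  proof
    fix p assume p: "p \<in> even_partitions k"
    obtain xs where xs: "mset xs = p" by (metis ex_mset)
    have pos: "\<forall>r \<in> set xs. 0 < r" and sum: "sum_list xs = k"
      using p xs by (auto simp: even_partitions_def sum_mset_sum_list)
    have "length xs \<le> sum_list xs"
      using pos by (induction xs) auto
    moreover have "set xs \<subseteq> {..k}"
      using sum member_le_sum_list by blast
    ultimately show "p \<in> mset ` {xs. set xs \<subseteq> {..k} \<and> length xs \<le> k}"
      using sum xs by auto
  qed
qed

definition power_mean :: "nat \<Rightarrow> nat \<Rightarrow> mpoly_real" where
  "power_mean n r = mpoly_const (1 / real n) * (\<Sum>i = 1..n. mpoly_var i ^ r)"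

definition power_mean_partition :: "nat \<Rightarrow> nat multiset \<Rightarrow> mpoly_real" where
  "power_mean_partition n \<mu> = (\<Prod>r \<in># \<mu>. power_mean n r)"

definition power_mean_form :: "nat \<Rightarrow> nat \<Rightarrow> (nat multiset \<Rightarrow> real) \<Rightarrow> mpoly_real" where
  "power_mean_form k n c =
     (\<Sum>\<mu> \<in> even_partitions k. mpoly_const (c \<mu>) * power_mean_partition n \<mu>)"

section \<open>The limit cones\<close>

text \<open>
  The argument \<open>k\<close> is the degree \<open>2d\<close>. A coefficient vector in \<open>\<real>\<^bsup>\<pi>(d)\<^esup>\<close> is an extensional
  function on the even partitions of \<open>k\<close>, so that vectors are equal iff their coordinates are.
\<close>

definition even_SOS_cone :: "nat \<Rightarrow> (nat multiset \<Rightarrow> real) set" where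
  "even_SOS_cone k =
     {c \<in> even_partitions k \<rightarrow>\<^sub>E UNIV. \<forall>n \<ge> k. sum_of_squares n (power_mean_form k n c)}"

definition even_PSD_cone :: "nat \<Rightarrow> (nat multiset \<Rightarrow> real) set" where
  "even_PSD_cone k =
     {c \<in> even_partitions k \<rightarrow>\<^sub>E UNIV. \<forall>n \<ge> k. nonnegative n (power_mean_form k n c)}"

end

(* Substituting y_i = x_i^2, an even form becomes a weighted homogeneous polynomial in the moments
   m_r of a measure on the half line, normalised by m_1 = 1.

   For 2d <= 8 nonnegativity on measures with at most two atoms already yields a representation by
   variances, means of squares and products of these; in degree 8 this amounts to choosing one
   parameter at a minimum point of a function of m_2.

   For 2d >= 14 take F = E[s^e G(s/sigma; m)] with e = d - 3, where G is a nonnegative cubic that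
   becomes Robinson's form on one large variable X and two equal blocks of variables. If sigma tends
   to infinity and the number of variables lies between sigma^3 and sigma^e, the restriction of F to
   these blocks, rescaled, tends to X^(2e) times Robinson's form, and since a limit of sums of squares
   would have a factor X^e in each square, Robinson's form would be a sum of squares.

   There is no such room for degrees 10 and 12. There an explicit form in m_1, ..., m_4 is restricted to
   three blocks of 3, 6 and 6 variables, and an explicit functional, found by semidefinite programming
   and rounded, is nonnegative on squares but negative on the restriction. *)

theory Submission
  imports Defs "HOL-Analysis.L2_Norm" "HOL-Computational_Algebra.Polynomial" "HOL-Real_Asymp.Real_Asymp"
begin

section \<open>Evaluation of polynomials\<close>

text \<open>With m_1 = 1 put u = m_2 - 1, v = m_3 - m_2 and c = m_4 - m_2^2. Cauchy-Schwarz gives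
  v^2 \<le> u * c, which is used through its tangents 2 * \<theta> * v - \<theta>^2 * u \<le> c:
  they are linear in m_3 and m_4, and for constant \<theta> they are means of squares. Up to degree
  8 the coefficients of m_3 and m_4 are constants, and one constant \<theta> serves all u. From
  degree 10 on the coefficient of m_3 may vary with m_2; the best slope then moves with u, and its
  formula changes where the bound v \<ge> u * (1 + u) takes over. \<open>decic\<close> and
  \<open>dodecic\<close> exploit this. The double zero 3/8 in \<open>decic\<close> is attained by
  weights 2/5 and 3/5 on the atoms 7/4 and 1/2, which blocks of 6 and 3 + 6 equal variables realise.
  In the limit argument nothing controls the number of squares, so no limit of single squares is
  taken; l2 norms over the whole family of squares are estimated instead. That Robinson's form is
  not a sum of squares enters through a linear relation between the values of a cubic at nine
  points.\<close>

definition mon_eval :: "(nat \<Rightarrow> real) \<Rightarrow> (nat \<Rightarrow>\<^sub>0 nat) \<Rightarrow> real" where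
  "mon_eval x m = (\<Prod>i \<in> Poly_Mapping.keys m. x i ^ Poly_Mapping.lookup m i)"

definition mon_degree :: "(nat \<Rightarrow>\<^sub>0 nat) \<Rightarrow> nat" where
  "mon_degree m = (\<Sum>i \<in> Poly_Mapping.keys m. Poly_Mapping.lookup m i)"

lemma mpoly_eval_altdef:
  "mpoly_eval x f = (\<Sum>m \<in> Poly_Mapping.keys f. Poly_Mapping.lookup f m * mon_eval x m)"
  by (simp add: mpoly_eval_def mon_eval_def)

lemma mon_eval_superset:
  assumes "finite S" "Poly_Mapping.keys m \<subseteq> S"
  shows "mon_eval x m = (\<Prod>i \<in> S. x i ^ Poly_Mapping.lookup m i)"
  unfolding mon_eval_def
  by (rule prod.mono_neutral_left) (use assms in \<open>auto simp: in_keys_iff\<close>)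

lemma mon_eval_0 [simp]: "mon_eval x 0 = 1"
  by (simp add: mon_eval_def)

lemma mon_eval_add: "mon_eval x (m + m') = mon_eval x m * mon_eval x m'"
proof -
  let ?S = "Poly_Mapping.keys m \<union> Poly_Mapping.keys m'"
  have "mon_eval x (m + m') = (\<Prod>i \<in> ?S. x i ^ Poly_Mapping.lookup (m + m') i)"
    by (rule mon_eval_superset) (use keys_add[of m m'] in auto)
  also have "\<dots> = (\<Prod>i \<in> ?S. x i ^ Poly_Mapping.lookup m i) * (\<Prod>i \<in> ?S. x i ^ Poly_Mapping.lookup m' i)"
    by (simp add: lookup_add power_add prod.distrib)
  also have "(\<Prod>i \<in> ?S. x i ^ Poly_Mapping.lookup m i) = mon_eval x m"
    by (rule mon_eval_superset[symmetric]) auto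
  also have "(\<Prod>i \<in> ?S. x i ^ Poly_Mapping.lookup m' i) = mon_eval x m'"
    by (rule mon_eval_superset[symmetric]) auto
  finally show ?thesis .
qed

lemma mon_eval_scale: "mon_eval (\<lambda>i. t * x i) m = t ^ mon_degree m * mon_eval x m"
  by (simp add: mon_eval_def mon_degree_def power_mult_distrib prod.distrib power_sum)

lemma mpoly_eval_superset:
  assumes "finite S" "Poly_Mapping.keys f \<subseteq> S"
  shows "mpoly_eval x f = (\<Sum>m \<in> S. Poly_Mapping.lookup f m * mon_eval x m)"
  unfolding mpoly_eval_altdef
  by (rule sum.mono_neutral_left) (use assms in \<open>auto simp: in_keys_iff\<close>)

lemma mpoly_eval_0 [simp]: "mpoly_eval x 0 = 0"
  by (simp add: mpoly_eval_def)

lemma mpoly_eval_single [simp]: "mpoly_eval x (Poly_Mapping.single m a) = a * mon_eval x m"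
  by (simp add: mpoly_eval_altdef)

lemma mpoly_eval_1 [simp]: "mpoly_eval x 1 = 1"
  using mpoly_eval_single[of x 0 1] by simp

lemma mpoly_eval_add [simp]: "mpoly_eval x (f + g) = mpoly_eval x f + mpoly_eval x g"
proof -
  let ?S = "Poly_Mapping.keys f \<union> Poly_Mapping.keys g"
  have "mpoly_eval x (f + g) = (\<Sum>m \<in> ?S. Poly_Mapping.lookup (f + g) m * mon_eval x m)"
    by (rule mpoly_eval_superset) (use keys_add[of f g] in auto)
  also have "\<dots> = (\<Sum>m \<in> ?S. Poly_Mapping.lookup f m * mon_eval x m)
      + (\<Sum>m \<in> ?S. Poly_Mapping.lookup g m * mon_eval x m)"
    by (simp add: lookup_add algebra_simps sum.distrib)
  also have "(\<Sum>m \<in> ?S. Poly_Mapping.lookup f m * mon_eval x m) = mpoly_eval x f"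
    by (rule mpoly_eval_superset[symmetric]) auto
  also have "(\<Sum>m \<in> ?S. Poly_Mapping.lookup g m * mon_eval x m) = mpoly_eval x g"
    by (rule mpoly_eval_superset[symmetric]) auto
  finally show ?thesis .
qed

lemma mpoly_eval_sum [simp]: "mpoly_eval x (\<Sum>i\<in>A. f i) = (\<Sum>i\<in>A. mpoly_eval x (f i))"
  by (induction A rule: infinite_finite_induct) auto

lemma poly_mapping_eq_sum_single:
  "f = (\<Sum>m \<in> Poly_Mapping.keys f. Poly_Mapping.single m (Poly_Mapping.lookup f m))"
proof (rule poly_mapping_eqI)
  fix m
  have "(\<Sum>k \<in> Poly_Mapping.keys f. Poly_Mapping.lookup f k when k = m) = Poly_Mapping.lookup f m"
    by (simp add: when_def sum.delta in_keys_iff)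
  then show "Poly_Mapping.lookup f m = Poly_Mapping.lookup
      (\<Sum>k \<in> Poly_Mapping.keys f. Poly_Mapping.single k (Poly_Mapping.lookup f k)) m"
    by (simp add: lookup_sum lookup_single)
qed

lemma mpoly_eval_mult [simp]: "mpoly_eval x (f * g) = mpoly_eval x f * mpoly_eval x g"
proof -
  have "f * g = (\<Sum>m \<in> Poly_Mapping.keys f. \<Sum>k \<in> Poly_Mapping.keys g.
      Poly_Mapping.single (m + k) (Poly_Mapping.lookup f m * Poly_Mapping.lookup g k))"
    by (subst poly_mapping_eq_sum_single[of f], subst poly_mapping_eq_sum_single[of g])
       (simp add: sum_product mult_single)
  then show ?thesis
    by (simp add: mpoly_eval_altdef[of x f] mpoly_eval_altdef[of x g] sum_product mon_eval_add mult_ac)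
qed

lemma mpoly_eval_power [simp]: "mpoly_eval x (f ^ k) = mpoly_eval x f ^ k"
  by (induction k) auto

lemma mpoly_eval_sum_list [simp]: "mpoly_eval x (sum_list fs) = (\<Sum>f\<leftarrow>fs. mpoly_eval x f)"
  by (induction fs) auto

lemma mpoly_eval_prod_mset [simp]:
  "mpoly_eval x (\<Prod>r \<in># \<mu>. f r) = (\<Prod>r \<in># \<mu>. mpoly_eval x (f r))"
  by (induction \<mu>) auto

lemma mpoly_eval_const [simp]: "mpoly_eval x (mpoly_const a) = a"
  by (simp add: mpoly_const_def)

lemma mpoly_eval_var [simp]: "mpoly_eval x (mpoly_var i) = x i"
  by (simp add: mpoly_var_def mon_eval_def)

section \<open>Values of power mean forms\<close>

definition moment :: "nat \<Rightarrow> (nat \<Rightarrow> real) \<Rightarrow> nat \<Rightarrow> real" where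
  "moment n y r = (\<Sum>i = 1..n. y i ^ r) / real n"

lemma mpoly_eval_power_mean [simp]: "mpoly_eval x (power_mean n r) = moment n x r"
  by (simp add: power_mean_def moment_def)

lemma mpoly_eval_power_mean_form:
  "mpoly_eval x (power_mean_form k n c) = (\<Sum>\<mu> \<in> even_partitions k. c \<mu> * (\<Prod>r \<in># \<mu>. moment n x r))"
  by (simp add: power_mean_form_def power_mean_partition_def)

lemma moment_scale: "moment n (\<lambda>i. t * x i) r = t ^ r * moment n x r"
  by (simp add: moment_def power_mult_distrib sum_distrib_left)

lemma moment_square: "moment n x (2 * r) = moment n (\<lambda>i. (x i)\<^sup>2) r"
  by (simp add: moment_def power_mult)

text \<open>Homogeneity in the form that \<open>sos_blocks\<close> asks for; no degree of a
  polynomial has to be introduced.\<close>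

lemma power_mean_form_scale:
  "mpoly_eval (\<lambda>i. t * x i) (power_mean_form k n c) = t ^ k * mpoly_eval x (power_mean_form k n c)"
proof -
  have "(\<Prod>r \<in># \<mu>. t ^ r * moment n x r) = t ^ \<Sum>\<^sub># \<mu> * (\<Prod>r \<in># \<mu>. moment n x r)" for \<mu>
    by (induction \<mu>) (auto simp: power_add mult_ac)
  then show ?thesis
    by (simp add: mpoly_eval_power_mean_form moment_scale even_partitions_def sum_distrib_left mult_ac)
qed

lemma sum_of_squares_imp_nonnegative: "sum_of_squares n f \<Longrightarrow> nonnegative n f"
  by (auto simp: sum_of_squares_def nonnegative_def intro!: sum_list_nonneg)

lemma even_SOS_cone_subset: "even_SOS_cone k \<subseteq> even_PSD_cone k"
  by (auto simp: even_SOS_cone_def even_PSD_cone_def sum_of_squares_imp_nonnegative)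

text \<open>A form is given by a list of pairs of a coefficient and a partition of \<open>d\<close>, which stands for
  the even partition of \<open>2 * d\<close> with doubled parts.\<close>

definition doubled :: "nat list \<Rightarrow> nat multiset" where
  "doubled l = mset (map ((*) 2) l)"

definition coeff_vector :: "nat \<Rightarrow> (real \<times> nat list) list \<Rightarrow> nat multiset \<Rightarrow> real" where
  "coeff_vector d ps = (\<lambda>\<mu> \<in> even_partitions (2 * d). \<Sum>(a, l)\<leftarrow>ps. if \<mu> = doubled l then a else 0)"

definition form_value :: "(real \<times> nat list) list \<Rightarrow> (nat \<Rightarrow> real) \<Rightarrow> real" where
  "form_value ps q = (\<Sum>(a, l)\<leftarrow>ps. a * prod_list (map q l))"

lemma coeff_vector_extensional: "coeff_vector d ps \<in> even_partitions (2 * d) \<rightarrow>\<^sub>E UNIV"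
  by (simp add: coeff_vector_def)

lemma doubled_in_even_partitions:
  assumes "sum_list l = d" "\<forall>r \<in> set l. 0 < r"
  shows "doubled l \<in> even_partitions (2 * d)"
proof -
  have "sum_list (map ((*) 2) l) = 2 * sum_list l"
    by (simp add: sum_list_const_mult)
  with assms show ?thesis
    by (auto simp: doubled_def even_partitions_def simp flip: sum_mset_sum_list mset_map)
qed

text \<open>The hypothesis puts every \<open>doubled l\<close> into the index set; a pair outside it
  would contribute to the right-hand side only. Coinciding partitions add up their
  coefficients.\<close>

lemma eval_coeff_vector:
  assumes "\<And>a l. (a, l) \<in> set ps \<Longrightarrow> sum_list l = d \<and> (\<forall>r \<in> set l. 0 < r)"
  shows "mpoly_eval x (power_mean_form (2 * d) n (coeff_vector d ps)) = form_value ps (\<lambda>r. moment n x (2 * r))"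
proof -
  have "(\<Sum>\<mu> \<in> even_partitions (2 * d). (\<Sum>(a, l)\<leftarrow>ps. if \<mu> = doubled l then a else 0) * g \<mu>)
      = (\<Sum>(a, l)\<leftarrow>ps. a * g (doubled l))" for g :: "nat multiset \<Rightarrow> real"
    using assms
  proof (induction ps)
    case (Cons p ps)
    obtain a l where p: "p = (a, l)" by force
    have "doubled l \<in> even_partitions (2 * d)"
      using Cons.prems[of a l] p by (intro doubled_in_even_partitions) auto
    then have "(\<Sum>\<mu> \<in> even_partitions (2 * d). (if \<mu> = doubled l then a else 0) * g \<mu>) = a * g (doubled l)"
      by (simp add: if_distrib[of "\<lambda>z. z * _"] sum.delta finite_even_partitions cong: if_cong)
    moreover have "(\<Sum>\<mu> \<in> even_partitions (2 * d). (\<Sum>(a, l)\<leftarrow>ps. if \<mu> = doubled l then a else 0) * g \<mu>)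
      = (\<Sum>(a, l)\<leftarrow>ps. a * g (doubled l))"
      by (rule Cons.IH) (metis Cons.prems list.set_intros(2))
    ultimately show ?case
      by (simp add: p distrib_right sum.distrib)
  qed simp
  moreover have "(\<Prod>r \<in># doubled l. moment n x r) = prod_list (map (\<lambda>r. moment n x (2 * r)) l)" for l
    unfolding doubled_def mset_map[symmetric] prod_mset_prod_list by (simp add: o_def)
  ultimately show ?thesis
    by (simp add: mpoly_eval_power_mean_form coeff_vector_def form_value_def)
qed

section \<open>Restriction to three blocks of equal variables\<close>

text \<open>In the convolution for index \<open>2 * k\<close> every pair other than
  \<open>(k, k)\<close> has an index below \<open>k\<close>.\<close>

lemma coeff_square_lowest:
  fixes p :: "real poly"
  assumes "\<And>i. i < k \<Longrightarrow> coeff p i = 0"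
  shows "coeff (p\<^sup>2) (2 * k) = (coeff p k)\<^sup>2"
proof -
  have "coeff (p\<^sup>2) (2 * k) = (\<Sum>i\<le>2 * k. coeff p i * coeff p (2 * k - i))"
    by (simp add: power2_eq_square coeff_mult)
  also have "\<dots> = (\<Sum>i\<in>{k}. coeff p i * coeff p (2 * k - i))"
  proof (rule sum.mono_neutral_right)
    show "\<forall>i\<in>{..2 * k} - {k}. coeff p i * coeff p (2 * k - i) = 0"
    proof
      fix i assume i: "i \<in> {..2 * k} - {k}"
      have "i < k \<or> 2 * k - i < k"
        using i by auto
      then show "coeff p i * coeff p (2 * k - i) = 0"
        using assms by auto
    qed
  qed auto
  finally show ?thesis
    by (simp add: power2_eq_square)
qed

text \<open>Lowest coefficients of squares cannot cancel, so by induction every \<open>p j\<close>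
  has order at least \<open>D\<close>; the coefficient at \<open>2 * D\<close> then sees only the
  coefficients at \<open>D\<close>.\<close>

lemma sum_squares_eq_monom:
  fixes p :: "nat \<Rightarrow> real poly"
  assumes eq: "(\<Sum>j<N. (p j)\<^sup>2) = monom c (2 * D)"
  shows "(\<Sum>j<N. (coeff (p j) D)\<^sup>2) = c"
proof -
  have low: "\<forall>j<N. coeff (p j) k = 0" if "k < D" for k
    using that
  proof (induction k rule: less_induct)
    case (less k)
    have "(\<Sum>j<N. (coeff (p j) k)\<^sup>2) = (\<Sum>j<N. coeff ((p j)\<^sup>2) (2 * k))"
      using less by (intro sum.cong refl coeff_square_lowest[symmetric]) auto
    also have "\<dots> = coeff (\<Sum>j<N. (p j)\<^sup>2) (2 * k)"
      by (simp add: coeff_sum)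
    also have "\<dots> = 0"
      using less.prems by (simp add: eq)
    finally show ?case
      by (simp add: sum_nonneg_eq_0_iff)
  qed
  have "(\<Sum>j<N. (coeff (p j) D)\<^sup>2) = (\<Sum>j<N. coeff ((p j)\<^sup>2) (2 * D))"
    using low by (intro sum.cong refl coeff_square_lowest[symmetric]) auto
  also have "\<dots> = coeff (\<Sum>j<N. (p j)\<^sup>2) (2 * D)"
    by (simp add: coeff_sum)
  finally show ?thesis
    by (simp add: eq)
qed

text \<open>A pair \<open>(b, c)\<close> of exponents of \<open>y\<close> and \<open>z\<close>
  stands for the ternary monomial of degree \<open>D\<close> whose exponent of \<open>x\<close> is
  \<open>D - b - c\<close>. One coefficient function thus describes a form and its dehomogenisation
  at \<open>x = 1\<close>.\<close>

definition deg_pairs :: "nat \<Rightarrow> (nat \<times> nat) set" where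
  "deg_pairs D = {(b, c). b + c \<le> D}"

lemma finite_deg_pairs [simp]: "finite (deg_pairs D)"
proof -
  have "deg_pairs D \<subseteq> {..D} \<times> {..D}"
    by (auto simp: deg_pairs_def)
  then show ?thesis
    by (rule finite_subset) simp
qed

definition ternary :: "nat \<Rightarrow> (nat \<times> nat \<Rightarrow> real) \<Rightarrow> real \<Rightarrow> real \<Rightarrow> real \<Rightarrow> real" where
  "ternary D C x y z = (\<Sum>p\<in>deg_pairs D. C p * (x ^ (D - fst p - snd p) * y ^ fst p * z ^ snd p))"

definition blocks :: "nat \<Rightarrow> nat \<Rightarrow> real \<Rightarrow> real \<Rightarrow> real \<Rightarrow> nat \<Rightarrow> real" where
  "blocks k l x y z i = (if i \<le> k then x else if i \<le> k + l then y else z)"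

text \<open>Along the ray through a block point each squared polynomial becomes a polynomial in
  \<open>t\<close>, and homogeneity of \<open>f\<close> leaves only its coefficient at
  \<open>t ^ D\<close>, the part of degree \<open>D\<close>. Grouping the monomials of that part by
  their degrees in the blocks gives \<open>C\<close>. It is read off the coefficients of
  \<open>g j\<close>, hence is the same for all \<open>x\<close>, \<open>y\<close>,
  \<open>z\<close>.\<close>

lemma sos_blocks:
  assumes sos: "sum_of_squares n f"
    and hom: "\<And>t x. mpoly_eval (\<lambda>i. t * x i) f = t ^ (2 * D) * mpoly_eval x f"
  shows "\<exists>(N::nat) C. \<forall>x y z. (\<Sum>j<N. (ternary D (C j) x y z)\<^sup>2) = mpoly_eval (blocks k l x y z) f"
proof -
  obtain gs where gs: "f = (\<Sum>g\<leftarrow>gs. g\<^sup>2)"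
    using sos by (auto simp: sum_of_squares_def)
  define d0 where "d0 m = (\<Sum>i | i \<in> Poly_Mapping.keys m \<and> i \<le> k. Poly_Mapping.lookup m i)" for m :: "nat \<Rightarrow>\<^sub>0 nat"
  define d1 where "d1 m = (\<Sum>i | i \<in> Poly_Mapping.keys m \<and> \<not> i \<le> k \<and> i \<le> k + l. Poly_Mapping.lookup m i)"
    for m :: "nat \<Rightarrow>\<^sub>0 nat"
  define d2 where "d2 m = (\<Sum>i | i \<in> Poly_Mapping.keys m \<and> \<not> i \<le> k \<and> \<not> i \<le> k + l. Poly_Mapping.lookup m i)"
    for m :: "nat \<Rightarrow>\<^sub>0 nat"
  have split: "Poly_Mapping.keys m = {i. i \<in> Poly_Mapping.keys m \<and> i \<le> k} \<union>
      ({i. i \<in> Poly_Mapping.keys m \<and> \<not> i \<le> k \<and> i \<le> k + l} \<union>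
       {i. i \<in> Poly_Mapping.keys m \<and> \<not> i \<le> k \<and> \<not> i \<le> k + l})" for m :: "nat \<Rightarrow>\<^sub>0 nat"
    by auto
  have deg: "mon_degree m = d0 m + d1 m + d2 m" for m
    unfolding mon_degree_def d0_def d1_def d2_def
    by (subst split, subst sum.union_disjoint, simp, simp, force, subst sum.union_disjoint) auto
  have mon: "mon_eval (blocks k l x y z) m = x ^ d0 m * y ^ d1 m * z ^ d2 m" for x y z m
    unfolding mon_eval_def d0_def d1_def d2_def
    by (subst split, subst prod.union_disjoint, simp, simp, force, subst prod.union_disjoint)
       (auto simp: blocks_def power_sum)
  define g where "g j = gs ! j" for j
  define K where "K j = {m \<in> Poly_Mapping.keys (g j). mon_degree m = D}" for j
  define C where "C j p = (\<Sum>m | m \<in> K j \<and> (d1 m, d2 m) = p. Poly_Mapping.lookup (g j) m)" for j p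
  have C: "ternary D (C j) x y z = (\<Sum>m\<in>K j. Poly_Mapping.lookup (g j) m * mon_eval (blocks k l x y z) m)"
    for j x y z
  proof -
    have "(\<Sum>m\<in>K j. Poly_Mapping.lookup (g j) m * mon_eval (blocks k l x y z) m)
        = (\<Sum>p\<in>deg_pairs D. \<Sum>m | m \<in> K j \<and> (d1 m, d2 m) = p.
            Poly_Mapping.lookup (g j) m * mon_eval (blocks k l x y z) m)"
      by (rule sum.group[symmetric]) (simp_all add: K_def, auto simp: deg_pairs_def deg)
    also have "\<dots> = (\<Sum>p\<in>deg_pairs D. \<Sum>m | m \<in> K j \<and> (d1 m, d2 m) = p.
            Poly_Mapping.lookup (g j) m * (x ^ (D - fst p - snd p) * y ^ fst p * z ^ snd p))"
      by (intro sum.cong refl) (auto simp: mon K_def deg)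
    finally show ?thesis
      by (simp add: ternary_def C_def sum_distrib_right)
  qed
  have main: "(\<Sum>j<length gs. (ternary D (C j) x y z)\<^sup>2) = mpoly_eval (blocks k l x y z) f" for x y z
  proof -
    let ?w = "blocks k l x y z"
    define p where "p j = (\<Sum>m\<in>Poly_Mapping.keys (g j).
      monom (Poly_Mapping.lookup (g j) m * mon_eval ?w m) (mon_degree m))" for j
    have p: "poly (p j) t = mpoly_eval (\<lambda>i. t * ?w i) (g j)" for j t
      by (simp add: p_def poly_sum poly_monom mpoly_eval_altdef mon_eval_scale mult_ac)
    have "poly (\<Sum>j<length gs. (p j)\<^sup>2) t = poly (monom (mpoly_eval ?w f) (2 * D)) t" for t
    proof -
      have "poly (\<Sum>j<length gs. (p j)\<^sup>2) t = mpoly_eval (\<lambda>i. t * ?w i) f"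
        by (simp add: gs poly_sum poly_power p g_def sum_list_sum_nth atLeast0LessThan)
      then show ?thesis
        by (simp add: hom poly_monom mult_ac)
    qed
    then have "(\<Sum>j<length gs. (coeff (p j) D)\<^sup>2) = mpoly_eval ?w f"
      by (intro sum_squares_eq_monom) (auto simp: poly_eq_poly_eq_iff[symmetric])
    moreover have "coeff (p j) D = ternary D (C j) x y z" for j
      unfolding C p_def K_def coeff_sum
      by (subst sum.inter_filter) (auto intro!: sum.cong simp: coeff_monom)
    ultimately show ?thesis by simp
  qed
  show ?thesis
    by (rule exI[of _ "length gs"], rule exI[of _ C]) (simp add: main)
qed

lemma sum_blocks:
  "(\<Sum>i = 1..k + l + m. f (blocks k l x y z i)) = real k * f x + real l * f y + real m * f z"
  for f :: "real \<Rightarrow> real"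
proof -
  have "(\<Sum>i = 1..k + l + m. f (blocks k l x y z i))
      = (\<Sum>i = 1..k + l. f (blocks k l x y z i)) + (\<Sum>i = k + l + 1..k + l + m. f (blocks k l x y z i))"
    by (rule sum.ub_add_nat) simp
  also have "(\<Sum>i = 1..k + l. f (blocks k l x y z i))
      = (\<Sum>i = 1..k. f (blocks k l x y z i)) + (\<Sum>i = k + 1..k + l. f (blocks k l x y z i))"
    by (rule sum.ub_add_nat) simp
  also have "(\<Sum>i = 1..k. f (blocks k l x y z i)) = (\<Sum>i = 1..k. f x)"
    by (rule sum.cong) (auto simp: blocks_def)
  also have "(\<Sum>i = k + 1..k + l. f (blocks k l x y z i)) = (\<Sum>i = k + 1..k + l. f y)"
    by (rule sum.cong) (auto simp: blocks_def)
  also have "(\<Sum>i = k + l + 1..k + l + m. f (blocks k l x y z i)) = (\<Sum>i = k + l + 1..k + l + m. f z)"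
    by (rule sum.cong) (auto simp: blocks_def)
  finally show ?thesis by simp
qed

lemma moment_blocks:
  "moment (k + l + m) (blocks k l x y z) r
    = (real k * x ^ r + real l * y ^ r + real m * z ^ r) / real (k + l + m)"
  by (simp only: moment_def sum_blocks[of "\<lambda>v. v ^ r"])

text \<open>All proofs of non-membership go through this consequence, which concerns one number of
  variables and points with at most three distinct values.\<close>

lemma even_SOS_cone_blocks:
  assumes ps: "\<And>a l. (a, l) \<in> set ps \<Longrightarrow> sum_list l = d \<and> (\<forall>r \<in> set l. 0 < r)"
    and sos: "coeff_vector d ps \<in> even_SOS_cone (2 * d)" and n: "2 * d \<le> k + l + m"
  shows "\<exists>(N::nat) C. \<forall>x y z. (\<Sum>j<N. (ternary d (C j) x y z)\<^sup>2)
    = form_value ps (\<lambda>r. (real k * x ^ (2 * r) + real l * y ^ (2 * r) + real m * z ^ (2 * r)) / real (k + l + m))"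
proof -
  have "sum_of_squares (k + l + m) (power_mean_form (2 * d) (k + l + m) (coeff_vector d ps))"
    using sos n by (auto simp: even_SOS_cone_def)
  from sos_blocks[OF this power_mean_form_scale, of k l] show ?thesis
    by (simp add: eval_coeff_vector[OF ps] moment_blocks)
qed

section \<open>Moment inequalities\<close>

lemma moment_0_eq_0:
  assumes "n > 0" "\<And>i. 0 \<le> y i" "moment n y 1 = 0" "1 \<le> i" "i \<le> n"
  shows "y i = 0"
  using assms by (auto simp: moment_def sum_nonneg_eq_0_iff)

lemma moment2_ge:
  assumes "n > 0" "moment n y 1 = 1"
  shows "1 \<le> moment n y 2"
proof -
  have "0 \<le> (\<Sum>i = 1..n. (y i - 1)\<^sup>2) / real n"
    by (simp add: sum_nonneg)
  also have "\<dots> = (\<Sum>i = 1..n. y i ^ 2 - 2 * y i ^ 1 + 1) / real n"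
    by (intro arg_cong2[where f = divide] sum.cong refl) algebra
  also have "\<dots> = moment n y 2 - 2 * moment n y 1 + 1"
    using assms(1) unfolding moment_def
    by (simp add: sum.distrib sum_subtractf sum_distrib_left[symmetric] add_divide_distrib diff_divide_distrib
        del: power_one_right)
  finally show ?thesis using assms by simp
qed

text \<open>The inequality that distinguishes the half line from the real line: it is the mean of
  \<open>y i * (y i - m_2)^2\<close>.\<close>

lemma moment3_ge:
  assumes "n > 0" "\<And>i. 0 \<le> y i" "moment n y 1 = 1"
  shows "(moment n y 2)\<^sup>2 \<le> moment n y 3"
proof -
  let ?m = "moment n y 2"
  have "0 \<le> (\<Sum>i = 1..n. y i * (y i - ?m)\<^sup>2) / real n"
    using assms by (simp add: sum_nonneg)
  also have "\<dots> = (\<Sum>i = 1..n. y i ^ 3 - 2 * ?m * y i ^ 2 + ?m\<^sup>2 * y i ^ 1) / real n"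
    by (intro arg_cong2[where f = divide] sum.cong refl) (simp add: power2_eq_square power3_eq_cube algebra_simps)
  also have "\<dots> = moment n y 3 - 2 * ?m * moment n y 2 + ?m\<^sup>2 * moment n y 1"
    unfolding moment_def
    by (simp only: sum.distrib sum_subtractf sum_distrib_left[symmetric] add_divide_distrib diff_divide_distrib
        times_divide_eq_right)
  finally show ?thesis using assms by (simp add: power2_eq_square)
qed

text \<open>The mean of the square of \<open>y i ^ 2 - m_2 - \<theta> * (y i - 1)\<close>. For m_2 >
  1 the best slope is (m_3 - m_2) / (m_2 - 1); leaving \<theta> free avoids the division and lets it
  be a polynomial in m_2.\<close>

lemma moment4_ge:
  fixes \<theta> :: real
  assumes "n > 0" "moment n y 1 = 1"
  shows "2 * \<theta> * (moment n y 3 - moment n y 2) - \<theta>\<^sup>2 * (moment n y 2 - 1) \<le> moment n y 4 - (moment n y 2)\<^sup>2"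
proof -
  let ?m = "moment n y 2"
  have "0 \<le> (\<Sum>i = 1..n. (y i ^ 2 - ?m - \<theta> * (y i - 1))\<^sup>2) / real n"
    by (simp add: sum_nonneg)
  also have "\<dots> = (\<Sum>i = 1..n. y i ^ 4 - 2 * \<theta> * y i ^ 3 + (\<theta>\<^sup>2 + 2 * (\<theta> - ?m)) * y i ^ 2
      - 2 * \<theta> * (\<theta> - ?m) * y i ^ 1 + (\<theta> - ?m)\<^sup>2) / real n"
    by (intro arg_cong2[where f = divide] sum.cong refl) algebra
  also have "\<dots> = moment n y 4 - 2 * \<theta> * moment n y 3 + (\<theta>\<^sup>2 + 2 * (\<theta> - ?m)) * moment n y 2
      - 2 * \<theta> * (\<theta> - ?m) * moment n y 1 + (\<theta> - ?m)\<^sup>2"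
    using assms(1) unfolding moment_def
    by (simp add: sum.distrib sum_subtractf sum_distrib_left[symmetric] add_divide_distrib diff_divide_distrib
        del: power_one_right)
  finally show ?thesis using assms(2) by (simp add: algebra_simps power2_eq_square)
qed

lemma form_value_scale:
  assumes "\<And>a l. (a, l) \<in> set ps \<Longrightarrow> sum_list l = d"
  shows "form_value ps (\<lambda>r. t ^ r * q r) = t ^ d * form_value ps q"
proof -
  have "prod_list (map (\<lambda>r. t ^ r * q r) l) = t ^ sum_list l * prod_list (map q l)" for l
    by (induction l) (auto simp: power_add mult_ac)
  moreover have "form_value ps (\<lambda>r. t ^ r * q r) = (\<Sum>(a, l)\<leftarrow>ps. a * prod_list (map (\<lambda>r. t ^ r * q r) l))"
    by (simp add: form_value_def)
  ultimately have "form_value ps (\<lambda>r. t ^ r * q r) = (\<Sum>(a, l)\<leftarrow>ps. t ^ d * (a * prod_list (map q l)))"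
    using assms by (auto intro!: arg_cong[where f = sum_list] simp: mult_ac)
  then show ?thesis
    by (simp add: form_value_def sum_list_const_mult[symmetric] case_prod_unfold)
qed

text \<open>By homogeneity it suffices to consider points whose squares have mean one.\<close>

lemma coeff_vector_in_PSD:
  assumes ps: "\<And>a l. (a, l) \<in> set ps \<Longrightarrow> sum_list l = d \<and> (\<forall>r \<in> set l. 0 < r)"
    and "0 < d"
    and *: "\<And>n y. 0 < n \<Longrightarrow> (\<And>i. 0 \<le> y i) \<Longrightarrow> moment n y 1 = 1 \<Longrightarrow> 0 \<le> form_value ps (moment n y)"
  shows "coeff_vector d ps \<in> even_PSD_cone (2 * d)"
proof -
  have "0 \<le> mpoly_eval x (power_mean_form (2 * d) n (coeff_vector d ps))" if "2 * d \<le> n" for n x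
  proof -
    define y where "y i = (x i)\<^sup>2" for i
    have n: "n > 0" using that \<open>0 < d\<close> by simp
    have y: "0 \<le> y i" for i by (simp add: y_def)
    have 1: "0 \<le> moment n y 1" by (simp add: moment_def y sum_nonneg)
    have "0 \<le> form_value ps (moment n y)"
    proof (cases "moment n y 1 = 0")
      \<comment> \<open>All \<open>y i\<close> vanish; since \<open>0 < d\<close>, every partition
        is nonempty and every term has a zero factor.\<close>
      case True
      then have "moment n y r = 0" if "0 < r" for r
        using moment_0_eq_0[OF n y] that by (auto simp: moment_def intro!: sum.neutral)
      then have "prod_list (map (moment n y) l) = 0" if "(a, l) \<in> set ps" for a l
        using ps[OF that] \<open>0 < d\<close> by (cases l) auto
      then have "form_value ps (moment n y) = (\<Sum>(a, l)\<leftarrow>ps. 0)"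
        unfolding form_value_def by (intro arg_cong[where f = sum_list]) (auto simp del: prod_list_zero_iff)
      then show ?thesis by (simp add: case_prod_unfold)
    next
      case False
      define s where "s = moment n y 1"
      have s: "s > 0" using False 1 by (simp add: s_def)
      let ?y = "\<lambda>i. inverse s * y i"
      have "moment n ?y 1 = inverse s ^ 1 * moment n y 1" by (rule moment_scale)
      then have "0 \<le> form_value ps (moment n ?y)"
        using s y n by (intro *) (auto simp: s_def)
      also have "moment n ?y = (\<lambda>r. inverse s ^ r * moment n y r)"
        by (rule ext) (rule moment_scale)
      also have "form_value ps \<dots> = inverse s ^ d * form_value ps (moment n y)"
        by (rule form_value_scale) (use ps in blast)
      finally have "0 \<le> inverse s ^ d * form_value ps (moment n y)" .
      moreover have "0 < inverse s ^ d" using s by simp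
      ultimately show ?thesis by (metis zero_le_mult_iff linorder_not_le)
    qed
    then show ?thesis
      by (simp add: eval_coeff_vector[OF ps] moment_square y_def[abs_def])
  qed
  then show ?thesis
    by (auto simp: even_PSD_cone_def nonnegative_def coeff_vector_extensional)
qed

section \<open>Degrees ten and twelve\<close>

text \<open>With \<open>m\<^sub>1 = 1\<close>, \<open>u = m\<^sub>2 - 1\<close> and \<open>v = m\<^sub>3 - m\<^sub>2\<close> the forms below are
  \<open>m\<^sub>4 - m\<^sub>2\<^sup>2 - 2 * l u * v + (l u)\<^sup>2 * u + R u\<close> for \<open>l u = 6 - 10 * u\<close>, \<open>R u = 100 * (u - 3/8)\<^sup>2 * (11/24 - u)\<close>
  and for \<open>l u = 13/5 - 3 * u\<close>, \<open>R u = 16 * (u - 1/5)\<^sup>2 * (9/20 - u)\<close>. If \<open>R u \<ge> 0\<close>, they are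
  nonnegative because of the fourth moment inequality at \<open>\<theta> = l u\<close>, otherwise because of the one at \<open>\<theta> = 1 + u\<close>.\<close>

definition decic :: "(real \<times> nat list) list" where
  "decic = [(1, [4, 1]), (20, [3, 2]), (-32, [3, 1, 1]), (-121/6, [2, 2, 1]), (859/48, [2, 1, 1, 1]),
    (7571/384, [1, 1, 1, 1, 1])]"

definition dodecic :: "(real \<times> nat list) list" where
  "dodecic = [(1, [4, 1, 1]), (6, [3, 2, 1]), (-56/5, [3, 1, 1, 1]), (-7, [2, 2, 2]), (12, [2, 2, 1, 1]),
    (-64/25, [2, 1, 1, 1, 1]), (256/125, [1, 1, 1, 1, 1, 1])]"

lemma decic_in_PSD: "coeff_vector 5 decic \<in> even_PSD_cone (2 * 5)"
proof (rule coeff_vector_in_PSD)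
  fix n and y :: "nat \<Rightarrow> real"
  assume n: "0 < n" and y: "\<And>i. 0 \<le> y i" and m1: "moment n y 1 = 1"
  define u where "u = moment n y 2 - 1"
  define v where "v = moment n y 3 - moment n y 2"
  define c where "c = moment n y 4 - (moment n y 2)\<^sup>2"
  define R where "R = 100 * (u - 3/8)\<^sup>2 * (11/24 - u)"
  have u: "0 \<le> u" using moment2_ge[OF n m1] by (simp add: u_def)
  have v: "u * (1 + u) \<le> v"
    using moment3_ge[OF n y m1] by (simp add: u_def v_def power2_eq_square algebra_simps)
  have c: "2 * \<theta> * v - \<theta>\<^sup>2 * u \<le> c" for \<theta>
    using moment4_ge[OF n m1, of \<theta>] by (simp add: u_def v_def c_def)
  have m: "moment n y 2 = 1 + u" "moment n y 3 = 1 + u + v" "moment n y 4 = (1 + u)\<^sup>2 + c"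
    by (simp_all add: u_def v_def c_def)
  have F: "form_value decic (moment n y) = c - 2 * (6 - 10 * u) * v + (6 - 10 * u)\<^sup>2 * u + R"
    unfolding form_value_def decic_def R_def
    by (simp add: m m1[simplified]) (simp add: power2_eq_square field_simps)
  show "0 \<le> form_value decic (moment n y)"
  proof (cases "u \<le> 11/24")
    case True
    then have "0 \<le> R" by (simp add: R_def)
    then show ?thesis using c[of "6 - 10 * u"] by (simp add: F)
  next
    case False
    \<comment> \<open>\<open>11 * u - 5\<close> is the difference of the slopes \<open>1 + u\<close>
      and \<open>6 - 10 * u\<close>. It is positive here, so \<open>v\<close> may be replaced by its
      lower bound.\<close>
    have "0 \<le> (11 * u - 5) * (v - u * (1 + u))"
      using False v by (intro mult_nonneg_nonneg) auto
    moreover have "0 \<le> u * (11 * u - 5)\<^sup>2 + R"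
    proof -
      \<comment> \<open>The linear remainder is the tangent at 231/500, a rational point close to
        the minimum of the cubic; it is positive for \<open>u > 11/24\<close>.\<close>
      have "u * (11 * u - 5)\<^sup>2 + R = (21 * u + 11339/375) * (u - 231/500)\<^sup>2
          + (1217/62500 * u - 2166219/250000000)"
        by (simp add: R_def power2_eq_square field_simps)
      moreover have "0 \<le> (21 * u + 11339/375) * (u - 231/500)\<^sup>2"
        using u by simp
      ultimately show ?thesis using False by linarith
    qed
    moreover have "form_value decic (moment n y) = (c - (2 * (1 + u) * v - (1 + u)\<^sup>2 * u))
        + 2 * ((11 * u - 5) * (v - u * (1 + u))) + (u * (11 * u - 5)\<^sup>2 + R)"
      by (simp add: F power2_eq_square field_simps)
    ultimately show ?thesis
      using c[of "1 + u"] by linarith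
  qed
qed (auto simp: decic_def)

lemma dodecic_in_PSD: "coeff_vector 6 dodecic \<in> even_PSD_cone (2 * 6)"
proof (rule coeff_vector_in_PSD)
  fix n and y :: "nat \<Rightarrow> real"
  assume n: "0 < n" and y: "\<And>i. 0 \<le> y i" and m1: "moment n y 1 = 1"
  define u where "u = moment n y 2 - 1"
  define v where "v = moment n y 3 - moment n y 2"
  define c where "c = moment n y 4 - (moment n y 2)\<^sup>2"
  define R where "R = 16 * (u - 1/5)\<^sup>2 * (9/20 - u)"
  have u: "0 \<le> u" using moment2_ge[OF n m1] by (simp add: u_def)
  have v: "u * (1 + u) \<le> v"
    using moment3_ge[OF n y m1] by (simp add: u_def v_def power2_eq_square algebra_simps)
  have c: "2 * \<theta> * v - \<theta>\<^sup>2 * u \<le> c" for \<theta>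
    using moment4_ge[OF n m1, of \<theta>] by (simp add: u_def v_def c_def)
  have m: "moment n y 2 = 1 + u" "moment n y 3 = 1 + u + v" "moment n y 4 = (1 + u)\<^sup>2 + c"
    by (simp_all add: u_def v_def c_def)
  have F: "form_value dodecic (moment n y) = c - 2 * (13/5 - 3 * u) * v + (13/5 - 3 * u)\<^sup>2 * u + R"
    unfolding form_value_def dodecic_def R_def
    by (simp add: m m1[simplified]) (simp add: power2_eq_square field_simps)
  show "0 \<le> form_value dodecic (moment n y)"
  proof (cases "u \<le> 9/20")
    case True
    then have "0 \<le> R" by (simp add: R_def)
    then show ?thesis using c[of "13/5 - 3 * u"] by (simp add: F)
  next
    case False
    have "0 \<le> (4 * u - 8/5) * (v - u * (1 + u))"
      using False v by (intro mult_nonneg_nonneg) auto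
    moreover have "0 \<le> u * (4 * u - 8/5)\<^sup>2 + R"
    proof -
      \<comment> \<open>The cubic terms cancel and a perfect square remains. Its zero 3/5 is a
        second zero of the form, at the measure with weights 5/8 and 3/8 on the atoms 8/5 and
        0.\<close>
      have "u * (4 * u - 8/5)\<^sup>2 + R = 4/5 * (u - 3/5)\<^sup>2"
        by (simp add: R_def power2_eq_square field_simps)
      also have "\<dots> \<ge> 0" by simp
      finally show ?thesis .
    qed
    moreover have "form_value dodecic (moment n y) = (c - (2 * (1 + u) * v - (1 + u)\<^sup>2 * u))
        + 2 * ((4 * u - 8/5) * (v - u * (1 + u))) + (u * (4 * u - 8/5)\<^sup>2 + R)"
      by (simp add: F power2_eq_square field_simps)
    ultimately show ?thesis
      using c[of "1 + u"] by linarith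
  qed
qed (auto simp: dodecic_def)

section \<open>Linear functionals on ternary forms and their values on squares\<close>

lemma sum_deg_pairs: "(\<Sum>p\<in>deg_pairs D. f p) = (\<Sum>b\<le>D. \<Sum>c\<le>D - b. f (b, c))"
  unfolding deg_pairs_def
  by (subst sum.Sigma) (auto intro!: sum.cong)

text \<open>A functional given by arbitrary values \<open>L\<close> on monomials is well defined on
  polynomial functions: vanishing at all real points forces the collected coefficient of each
  monomial to be zero, first as a polynomial in \<open>y\<close>, then in \<open>z\<close>.\<close>

lemma monomial_functional:
  fixes a :: "'i \<Rightarrow> real"
  assumes "finite A"
    and zero: "\<And>y z. (\<Sum>i\<in>A. a i * (y ^ fst (e i) * z ^ snd (e i))) = 0"
  shows "(\<Sum>i\<in>A. a i * L (e i)) = 0"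
proof -
  obtain n where n: "\<And>i. i \<in> A \<Longrightarrow> fst (e i) \<le> n \<and> snd (e i) \<le> n"
  proof
    fix i assume "i \<in> A"
    then have "fst (e i) \<le> (\<Sum>i\<in>A. fst (e i))" "snd (e i) \<le> (\<Sum>i\<in>A. snd (e i))"
      using \<open>finite A\<close> by (auto intro: member_le_sum)
    then show "fst (e i) \<le> (\<Sum>i\<in>A. fst (e i)) + (\<Sum>i\<in>A. snd (e i)) \<and>
        snd (e i) \<le> (\<Sum>i\<in>A. fst (e i)) + (\<Sum>i\<in>A. snd (e i))"
      by simp
  qed
  define c where "c p = (\<Sum>i | i \<in> A \<and> e i = p. a i)" for p
  have group: "(\<Sum>i\<in>A. a i * h (e i)) = (\<Sum>b\<le>n. \<Sum>k\<le>n. c (b, k) * h (b, k))" for h :: "nat \<times> nat \<Rightarrow> real"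
  proof -
    have "(\<Sum>i\<in>A. a i * h (e i)) = (\<Sum>p\<in>{..n} \<times> {..n}. \<Sum>i | i \<in> A \<and> e i = p. a i * h (e i))"
      by (rule sum.group[symmetric], simp add: \<open>finite A\<close>, simp, rule image_subsetI)
        (simp add: mem_Times_iff n)
    also have "\<dots> = (\<Sum>p\<in>{..n} \<times> {..n}. c p * h p)"
      by (intro sum.cong refl) (auto simp: c_def sum_distrib_right)
    finally show ?thesis by (simp add: sum.cartesian_product)
  qed
  have "(\<Sum>b\<le>n. (\<Sum>k\<le>n. c (b, k) * z ^ k) * y ^ b) = 0" for y z
    using zero[of y z] group[of "\<lambda>p. y ^ fst p * z ^ snd p"]
    by (simp add: sum_distrib_right sum_distrib_left mult_ac)
  then have "\<forall>b\<le>n. (\<Sum>k\<le>n. c (b, k) * z ^ k) = 0" for z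
    using polyfun_eq_0[of "\<lambda>b. \<Sum>k\<le>n. c (b, k) * z ^ k" n] by blast
  then have "\<forall>k\<le>n. c (b, k) = 0" if "b \<le> n" for b
    using polyfun_eq_0[of "\<lambda>k. c (b, k)" n] that by blast
  then show ?thesis
    by (simp add: group)
qed

text \<open>A list rather than a set, so that the monomials of a class can be enumerated and the
  quadratic forms below become explicit.\<close>

definition parity_pairs :: "nat \<Rightarrow> nat \<Rightarrow> nat \<Rightarrow> (nat \<times> nat) list" where
  "parity_pairs d s t = [p \<leftarrow> List.product [0..<Suc d] [0..<Suc d].
    fst p + snd p \<le> d \<and> fst p mod 2 = s \<and> snd p mod 2 = t]"

text \<open>The entry \<open>M ! b ! c\<close> is the value at the monomial \<open>y ^ (2 * b) * z ^ (2 * c)\<close>; all other monomials are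
  mapped to zero, so squares split into four parity classes. The tables used later are triangular, and only
  entries with \<open>b + c\<close> at most their degree are ever accessed.\<close>

definition pair_functional :: "real list list \<Rightarrow> nat \<times> nat \<Rightarrow> real" where
  "pair_functional M p = (if even (fst p) \<and> even (snd p) then M ! (fst p div 2) ! (snd p div 2) else 0)"

lemma set_parity_pairs: "set (parity_pairs d s t) = {p \<in> deg_pairs d. fst p mod 2 = s \<and> snd p mod 2 = t}"
  by (auto simp: parity_pairs_def deg_pairs_def)

lemma distinct_parity_pairs: "distinct (parity_pairs d s t)"
  by (simp add: parity_pairs_def distinct_product)

lemma even_add_iff_mod_2: "even (a + b) \<longleftrightarrow> a mod 2 = b mod 2" for a b :: nat
  by presburger

lemma pair_functional_split:
  "(\<Sum>p\<in>deg_pairs d. \<Sum>q\<in>deg_pairs d. pair_functional M (fst p + fst q, snd p + snd q) * (C p * C q))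
    = (\<Sum>s<2. \<Sum>t<2. \<Sum>p\<leftarrow>parity_pairs d s t. \<Sum>q\<leftarrow>parity_pairs d s t.
        M ! ((fst p + fst q) div 2) ! ((snd p + snd q) div 2) * (C p * C q))"
proof -
  define g where "g p q = pair_functional M (fst p + fst q, snd p + snd q) * (C p * C q)" for p q
  define cls where "cls p = (fst p mod 2, snd p mod 2)" for p :: "nat \<times> nat"
  have "(\<Sum>p\<in>deg_pairs d. \<Sum>q\<in>deg_pairs d. g p q)
      = (\<Sum>c\<in>{..<2} \<times> {..<2}. \<Sum>p | p \<in> deg_pairs d \<and> cls p = c. \<Sum>q\<in>deg_pairs d. g p q)"
    by (rule sum.group[symmetric], simp, simp, rule image_subsetI) (simp add: cls_def)
  also have "\<dots> = (\<Sum>c\<in>{..<2} \<times> {..<2}. \<Sum>p | p \<in> deg_pairs d \<and> cls p = c. \<Sum>q | q \<in> deg_pairs d \<and> cls q = c. g p q)"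
  proof (rule sum.cong[OF refl], rule sum.cong[OF refl])
    fix c p assume p: "p \<in> {p. p \<in> deg_pairs d \<and> cls p = c}"
    have "g p q = 0" if "cls q \<noteq> c" for q
    proof -
      have "fst p mod 2 \<noteq> fst q mod 2 \<or> snd p mod 2 \<noteq> snd q mod 2"
        using p that by (auto simp: cls_def)
      then have "\<not> (even (fst p + fst q) \<and> even (snd p + snd q))"
        unfolding even_add_iff_mod_2 by blast
      then show ?thesis by (auto simp: g_def pair_functional_def)
    qed
    then show "(\<Sum>q\<in>deg_pairs d. g p q) = (\<Sum>q | q \<in> deg_pairs d \<and> cls q = c. g p q)"
      by (intro sum.mono_neutral_right) auto
  qed
  also have "\<dots> = (\<Sum>c\<in>{..<2} \<times> {..<2}. \<Sum>p\<leftarrow>parity_pairs d (fst c) (snd c). \<Sum>q\<leftarrow>parity_pairs d (fst c) (snd c).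
        M ! ((fst p + fst q) div 2) ! ((snd p + snd q) div 2) * (C p * C q))"
  proof (rule sum.cong[OF refl])
    fix c
    have set: "{p. p \<in> deg_pairs d \<and> cls p = c} = set (parity_pairs d (fst c) (snd c))"
      by (auto simp: set_parity_pairs cls_def)
    have "g p q = M ! ((fst p + fst q) div 2) ! ((snd p + snd q) div 2) * (C p * C q)"
      if "cls p = c" "cls q = c" for p q
    proof -
      have "fst p mod 2 = fst q mod 2" "snd p mod 2 = snd q mod 2"
        using that by (auto simp: cls_def)
      then have "even (fst p + fst q)" "even (snd p + snd q)"
        unfolding even_add_iff_mod_2 .
      then show ?thesis by (simp add: g_def pair_functional_def)
    qed
    then show "(\<Sum>p | p \<in> deg_pairs d \<and> cls p = c. \<Sum>q | q \<in> deg_pairs d \<and> cls q = c. g p q)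
      = (\<Sum>p\<leftarrow>parity_pairs d (fst c) (snd c). \<Sum>q\<leftarrow>parity_pairs d (fst c) (snd c).
        M ! ((fst p + fst q) div 2) ! ((snd p + snd q) div 2) * (C p * C q))"
      unfolding set[symmetric] sum_list_distinct_conv_sum_set[OF distinct_parity_pairs]
      by (auto simp: set[symmetric] intro!: sum.cong)
  qed
  finally show ?thesis
    by (simp add: g_def sum.cartesian_product case_prod_unfold)
qed

text \<open>Duality: a functional that is nonnegative on squares is nonnegative on sums of squares.
  Since the identity is given pointwise, both sides are merged into one signed family of monomials,
  indexed by a disjoint sum, that vanishes everywhere.\<close>

lemma functional_sos:
  fixes L :: "nat \<times> nat \<Rightarrow> real" and C :: "nat \<Rightarrow> nat \<times> nat \<Rightarrow> real"
  assumes sos: "\<And>y z. (\<Sum>j<N. (ternary d (C j) 1 y z)\<^sup>2) = (\<Sum>(p, a)\<leftarrow>cs. a * (y ^ fst p * z ^ snd p))"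
    and pos: "\<And>C. 0 \<le> (\<Sum>p\<in>deg_pairs d. \<Sum>q\<in>deg_pairs d. L (fst p + fst q, snd p + snd q) * (C p * C q))"
  shows "0 \<le> (\<Sum>(p, a)\<leftarrow>cs. a * L p)"
proof -
  let ?I = "{..<N} \<times> deg_pairs d \<times> deg_pairs d"
  let ?A = "?I <+> {..<length cs}"
  define a where "a = case_sum (\<lambda>(j, p, q). C j p * C j q) (\<lambda>i. - snd (cs ! i))"
  define e :: "nat \<times> (nat \<times> nat) \<times> nat \<times> nat + nat \<Rightarrow> nat \<times> nat" where "e = case_sum (\<lambda>(j, p, q). (fst p + fst q, snd p + snd q)) (\<lambda>i. fst (cs ! i))"
  have split: "(\<Sum>i\<in>?A. a i * h (e i))
      = (\<Sum>j<N. \<Sum>p\<in>deg_pairs d. \<Sum>q\<in>deg_pairs d. h (fst p + fst q, snd p + snd q) * (C j p * C j q))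
        - (\<Sum>(p, a)\<leftarrow>cs. a * h p)" for h :: "nat \<times> nat \<Rightarrow> real"
  proof -
    have "(\<Sum>i\<in>?I. a (Inl i) * h (e (Inl i)))
        = (\<Sum>(j, p, q)\<in>?I. h (fst p + fst q, snd p + snd q) * (C j p * C j q))"
      by (intro sum.cong refl) (auto simp: a_def e_def)
    also have "\<dots> = (\<Sum>j<N. \<Sum>p\<in>deg_pairs d. \<Sum>q\<in>deg_pairs d. h (fst p + fst q, snd p + snd q) * (C j p * C j q))"
      by (simp add: sum.cartesian_product)
    moreover have "(\<Sum>i<length cs. a (Inr i) * h (e (Inr i))) = - (\<Sum>(p, a)\<leftarrow>cs. a * h p)"
      by (simp add: a_def e_def sum_list_sum_nth atLeast0LessThan sum_negf case_prod_unfold)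
    ultimately show ?thesis
      by (simp add: sum.Plus)
  qed
  have zero: "(\<Sum>i\<in>?A. a i * (y ^ fst (e i) * z ^ snd (e i))) = 0" for y z
  proof -
    have "(ternary d (C j) 1 y z)\<^sup>2 = (\<Sum>p\<in>deg_pairs d. \<Sum>q\<in>deg_pairs d.
        (y ^ (fst p + fst q) * z ^ (snd p + snd q)) * (C j p * C j q))" for j
      by (simp add: ternary_def power2_eq_square sum_product power_add mult_ac)
    then show ?thesis
      using sos[of y z] split[of "\<lambda>p. y ^ fst p * z ^ snd p"] by simp
  qed
  have "finite ?A" by simp
  then have "(\<Sum>i\<in>?A. a i * L (e i)) = 0"
    using zero by (rule monomial_functional)
  with split[of L] have "(\<Sum>(p, a)\<leftarrow>cs. a * L p)
      = (\<Sum>j<N. \<Sum>p\<in>deg_pairs d. \<Sum>q\<in>deg_pairs d. L (fst p + fst q, snd p + snd q) * (C j p * C j q))"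
    by simp
  also have "\<dots> \<ge> 0"
    by (intro sum_nonneg pos)
  finally show ?thesis .
qed

text \<open>Symmetric under exchanging \<open>y\<close> and \<open>z\<close>, as the two blocks of 6
  variables permit. Hence the mixed parity classes share one decomposition, and the other two split
  into sums and differences.\<close>

definition decic_moments :: "real list list" where
  "decic_moments = [[3579, 1529, 979, 831, 860, 1398], [1529, 424, 188, 157, 353], [979, 188, 82, 138], [831, 157, 138],
      [860, 353], [1398]]"

text \<open>Gaussian elimination of the Gram matrix (an LDL^T decomposition) in coordinates
  symmetric or antisymmetric under exchanging \<open>y\<close> and \<open>z\<close>; the factors in
  front of the squares are the pivots.\<close>

lemma decic_moments_psd_00:
  "0 \<le> (\<Sum>p\<leftarrow>parity_pairs 5 0 0. \<Sum>q\<leftarrow>parity_pairs 5 0 0.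
      decic_moments ! ((fst p + fst q) div 2) ! ((snd p + snd q) div 2) * (C p * C q))"
    (is "0 \<le> ?S")
proof -
  have pairs: "parity_pairs 5 0 0 =
      [(0, 0), (0, 2), (0, 4), (2, 0), (2, 2), (4, 0)]"
    by code_simp
  have "?S = 3579 * (C (0, 0) + 1529/3579 * (C (2, 0) + C (0, 2)) + 424/3579 * C (2, 2) + 979/3579 * (C (4, 0) +
      C (0, 4)))\<^sup>2 + 345655/7158 * (C (2, 0) + C (0, 2) + 49112/345655 * C (2, 2) + 653219/345655 *
      (C (4, 0) + C (0, 4)))\<^sup>2 + 10644222/345655 * (C (2, 2) + 9696599/10644222 * (C (4, 0) + C (0,
      4)))\<^sup>2 + 27627007/5322111 * (C (4, 0) + C (0, 4))\<^sup>2 + 555/2 * (C (2, 0) - C (0, 2) +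
      643/555 * (C (4, 0) - C (0, 4)))\<^sup>2 + 18341/1110 * (C (4, 0) - C (0, 4))\<^sup>2"
    unfolding pairs decic_moments_def by (simp, algebra)
  also have "\<dots> \<ge> 0" by simp
  finally show ?thesis .
qed

lemma decic_moments_psd_01:
  "0 \<le> (\<Sum>p\<leftarrow>parity_pairs 5 0 1. \<Sum>q\<leftarrow>parity_pairs 5 0 1.
      decic_moments ! ((fst p + fst q) div 2) ! ((snd p + snd q) div 2) * (C p * C q))"
    (is "0 \<le> ?S")
proof -
  have pairs: "parity_pairs 5 0 1 =
      [(0, 1), (0, 3), (0, 5), (2, 1), (2, 3), (4, 1)]"
    by code_simp
  have "?S = 1529 * (C (0, 1) + 89/139 * C (0, 3) + 424/1529 * C (2, 1) + 831/1529 * C (0, 5) + 188/1529 * C (4,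
      1) + 188/1529 * C (2, 3))\<^sup>2 + 28378/139 * (C (0, 3) + -5802/14189 * C (2, 1) + 45581/28378 * C
      (0, 5) + -381/2027 * C (4, 1) + 5091/28378 * C (2, 3))\<^sup>2 + 5663484/156079 * (C (2, 1) +
      9465997/5663484 * C (0, 5) + 4639453/1887828 * C (4, 1) + 194419/157319 * C (2, 3))\<^sup>2 +
      1802570483/5663484 * (C (0, 5) + -292166625/1802570483 * C (4, 1) + 662872410/1802570483 * C (2,
      3))\<^sup>2 + 343052865273/3605140966 * (C (4, 1) + 110080608283/343052865273 * C (2, 3))\<^sup>2 +
      19195335320/343052865273 * (C (2, 3))\<^sup>2"
    unfolding pairs decic_moments_def by (simp, algebra)
  also have "\<dots> \<ge> 0" by simp
  finally show ?thesis .
qed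

lemma decic_moments_psd_10:
  "0 \<le> (\<Sum>p\<leftarrow>parity_pairs 5 1 0. \<Sum>q\<leftarrow>parity_pairs 5 1 0.
      decic_moments ! ((fst p + fst q) div 2) ! ((snd p + snd q) div 2) * (C p * C q))"
    (is "0 \<le> ?S")
proof -
  have pairs: "parity_pairs 5 1 0 =
      [(1, 0), (1, 2), (1, 4), (3, 0), (3, 2), (5, 0)]"
    by code_simp
  have "?S = 1529 * (C (1, 0) + 89/139 * C (3, 0) + 424/1529 * C (1, 2) + 831/1529 * C (5, 0) + 188/1529 * C (1,
      4) + 188/1529 * C (3, 2))\<^sup>2 + 28378/139 * (C (3, 0) + -5802/14189 * C (1, 2) + 45581/28378 * C
      (5, 0) + -381/2027 * C (1, 4) + 5091/28378 * C (3, 2))\<^sup>2 + 5663484/156079 * (C (1, 2) +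
      9465997/5663484 * C (5, 0) + 4639453/1887828 * C (1, 4) + 194419/157319 * C (3, 2))\<^sup>2 +
      1802570483/5663484 * (C (5, 0) + -292166625/1802570483 * C (1, 4) + 662872410/1802570483 * C (3,
      2))\<^sup>2 + 343052865273/3605140966 * (C (1, 4) + 110080608283/343052865273 * C (3, 2))\<^sup>2 +
      19195335320/343052865273 * (C (3, 2))\<^sup>2"
    unfolding pairs decic_moments_def by (simp, algebra)
  also have "\<dots> \<ge> 0" by simp
  finally show ?thesis .
qed

lemma decic_moments_psd_11:
  "0 \<le> (\<Sum>p\<leftarrow>parity_pairs 5 1 1. \<Sum>q\<leftarrow>parity_pairs 5 1 1.
      decic_moments ! ((fst p + fst q) div 2) ! ((snd p + snd q) div 2) * (C p * C q))"
    (is "0 \<le> ?S")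
proof -
  have pairs: "parity_pairs 5 1 1 =
      [(1, 1), (1, 3), (3, 1)]"
    by code_simp
  have "?S = 424 * (C (1, 1) + 47/106 * (C (3, 1) + C (1, 3)))\<^sup>2 + 3831/106 * (C (3, 1) + C (1, 3))\<^sup>2
      + 75/2 * (C (3, 1) - C (1, 3))\<^sup>2"
    unfolding pairs decic_moments_def by (simp, algebra)
  also have "\<dots> \<ge> 0" by simp
  finally show ?thesis .
qed

text \<open>The coefficients of \<open>decic\<close> restricted to blocks of weights 1/5, 2/5, 2/5,
  with the first variable set to one.\<close>

definition decic_monomials :: "((nat \<times> nat) \<times> real) list" where
  "decic_monomials = [((0, 0), 549131/1200000), ((0, 2), -41271/40000), ((0, 4), 5839/10000), ((0, 6), 13121/15000), ((0,
      8), -7107/5000), ((0, 10), 8517/12500), ((2, 0), -41271/40000), ((2, 2), -12841/15000), ((2, 4),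
      3763/3000), ((2, 6), 1009/750), ((2, 8), -7107/2500), ((4, 0), 5839/10000), ((4, 2), 3763/3000),
      ((4, 4), 23341/7500), ((4, 6), 9083/3750), ((6, 0), 13121/15000), ((6, 2), 1009/750), ((6, 4),
      9083/3750), ((8, 0), -7107/5000), ((8, 2), -7107/2500), ((10, 0), 8517/12500)]"

lemma decic_not_SOS: "coeff_vector 5 decic \<notin> even_SOS_cone (2 * 5)"
proof
  assume sos: "coeff_vector 5 decic \<in> even_SOS_cone (2 * 5)"
  have "\<exists>(N::nat) C. \<forall>x y z. (\<Sum>j<N. (ternary 5 (C j) x y z)\<^sup>2)
      = form_value decic (\<lambda>r. (real 3 * x ^ (2 * r) + real 6 * y ^ (2 * r) + real 6 * z ^ (2 * r)) / real (3 + 6 + 6))"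
    by (rule even_SOS_cone_blocks[OF _ sos]) (auto simp: decic_def)
  then obtain N C where "\<And>x y z. (\<Sum>j<(N::nat). (ternary 5 (C j) x y z)\<^sup>2)
      = form_value decic (\<lambda>r. (real 3 * x ^ (2 * r) + real 6 * y ^ (2 * r) + real 6 * z ^ (2 * r)) / real (3 + 6 + 6))"
    by blast
  moreover have "form_value decic (\<lambda>r. (real 3 * 1 ^ (2 * r) + real 6 * y ^ (2 * r) + real 6 * z ^ (2 * r)) / real (3 + 6 + 6))
      = (\<Sum>(p, a)\<leftarrow>decic_monomials. a * (y ^ fst p * z ^ snd p))" for y z
    by (simp add: form_value_def decic_def decic_monomials_def, algebra)
  ultimately have "(\<Sum>j<N. (ternary 5 (C j) 1 y z)\<^sup>2)
      = (\<Sum>(p, a)\<leftarrow>decic_monomials. a * (y ^ fst p * z ^ snd p))" for y z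
    by simp
  moreover have "0 \<le> (\<Sum>p\<in>deg_pairs 5. \<Sum>q\<in>deg_pairs 5.
      pair_functional decic_moments (fst p + fst q, snd p + snd q) * (C p * C q))" for C
    using decic_moments_psd_00[of C] decic_moments_psd_01[of C] decic_moments_psd_10[of C] decic_moments_psd_11[of C]
    by (simp add: pair_functional_split numeral_2_eq_2)
  ultimately have "0 \<le> (\<Sum>(p, a)\<leftarrow>decic_monomials. a * pair_functional decic_moments p)"
    by (rule functional_sos)
  then show False
    by (simp add: decic_monomials_def pair_functional_def decic_moments_def)
qed

definition dodecic_moments :: "real list list" where
  "dodecic_moments = [[4165, 1939, 1543, 1395, 1388, 1529, 2361], [1939, 574, 338, 281, 347, 668], [1543, 338, 183, 180,
      330], [1395, 281, 180, 242], [1388, 347, 330], [1529, 668], [2361]]"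

text \<open>The class of even exponents in scalar unknowns: \<open>a\<close>, \<open>b\<close>,
  \<open>c\<close>, \<open>e\<close> belong to (0,0), (0,2), (0,4), (0,6), then \<open>f\<close>,
  \<open>g\<close>, \<open>h\<close> to (2,0), (2,2), (2,4), \<open>i\<close>, \<open>j\<close> to
  (4,0), (4,2), and \<open>k\<close> to (6,0). Exchanging \<open>y\<close> and \<open>z\<close>
  swaps \<open>b\<close> with \<open>f\<close>, \<open>c\<close> with \<open>i\<close>,
  \<open>h\<close> with \<open>j\<close> and \<open>e\<close> with \<open>k\<close>.\<close>

lemma dodecic_moments_quadratic:
  fixes a b c e f g h i j k :: real
  shows "0 \<le> 4165 * (a * a) + 3878 * (a * b) + 3086 * (a * c) + 2790 * (a * e) + 3878 * (a * f) + 1148 * (a * g)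
      + 676 * (a * h) + 3086 * (a * i) + 676 * (a * j) + 2790 * (a * k) + 1543 * (b * b) + 2790 * (b * c)
      + 2776 * (b * e) + 1148 * (b * f) + 676 * (b * g) + 562 * (b * h) + 676 * (b * i) + 366 * (b * j) +
      562 * (b * k) + 1388 * (c * c) + 3058 * (c * e) + 676 * (c * f) + 562 * (c * g) + 694 * (c * h) +
      366 * (c * i) + 360 * (c * j) + 360 * (c * k) + 2361 * (e * e) + 562 * (e * f) + 694 * (e * g) +
      1336 * (e * h) + 360 * (e * i) + 660 * (e * j) + 484 * (e * k) + 1543 * (f * f) + 676 * (f * g) +
      366 * (f * h) + 2790 * (f * i) + 562 * (f * j) + 2776 * (f * k) + 183 * (g * g) + 360 * (g * h) +
      562 * (g * i) + 360 * (g * j) + 694 * (g * k) + 330 * (h * h) + 360 * (h * i) + 484 * (h * j) + 660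
      * (h * k) + 1388 * (i * i) + 694 * (i * j) + 3058 * (i * k) + 330 * (j * j) + 1336 * (j * k) + 2361
      * (k * k)"
    (is "0 \<le> ?q")
proof -
  have "?q = 4165 * (a + 277/595 * (f + b) + 82/595 * g + 1543/4165 * (i + c) + 338/4165 * (j + h) + 279/833 * (k
      + e))\<^sup>2 + 26487/170 * (f + b + 12032/26487 * g + 58771/61803 * (i + c) + 88828/185409 * (j +
      h) + 220225/185409 * (k + e))\<^sup>2 + 1900261/26487 * (g + 194127/13301827 * (i + c) +
      18450056/13301827 * (j + h) + 1191355/1209257 * (k + e))\<^sup>2 + 6793399812/93112789 * (i + c +
      4087413049/4528933208 * (j + h) + 14961489587/6793399812 * (k + e))\<^sup>2 +
      229689189913/9057866416 * (j + h + 489817395506/229689189913 * (k + e))\<^sup>2 +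
      52108256517356/689067569739 * (k + e)\<^sup>2 + 969/2 * (f - b + 1057/969 * (i - c) + 98/969 * (j -
      h) + 369/323 * (k - e))\<^sup>2 + 25198/969 * (i - c + 58237/50396 * (j - h) + 68541/25198 * (k -
      e))\<^sup>2 + 435311/100792 * (j - h + 3153038/435311 * (k - e))\<^sup>2 + 3562989/435311 * (k -
      e)\<^sup>2"
    by algebra
  also have "\<dots> \<ge> 0" by simp
  finally show ?thesis .
qed

lemma dodecic_moments_psd_00:
  "0 \<le> (\<Sum>p\<leftarrow>parity_pairs 6 0 0. \<Sum>q\<leftarrow>parity_pairs 6 0 0.
      dodecic_moments ! ((fst p + fst q) div 2) ! ((snd p + snd q) div 2) * (C p * C q))"
    (is "0 \<le> ?S")
proof -
  have pairs: "parity_pairs 6 0 0 =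
      [(0, 0), (0, 2), (0, 4), (0, 6), (2, 0), (2, 2), (2, 4), (4, 0), (4, 2), (6, 0)]"
    by code_simp
  have "?S = 4165 * (C (0, 0) * C (0, 0)) + 3878 * (C (0, 0) * C (0, 2)) + 3086 * (C (0, 0) * C (0, 4)) + 2790 *
      (C (0, 0) * C (0, 6)) + 3878 * (C (0, 0) * C (2, 0)) + 1148 * (C (0, 0) * C (2, 2)) + 676 * (C (0,
      0) * C (2, 4)) + 3086 * (C (0, 0) * C (4, 0)) + 676 * (C (0, 0) * C (4, 2)) + 2790 * (C (0, 0) * C
      (6, 0)) + 1543 * (C (0, 2) * C (0, 2)) + 2790 * (C (0, 2) * C (0, 4)) + 2776 * (C (0, 2) * C (0, 6))
      + 1148 * (C (0, 2) * C (2, 0)) + 676 * (C (0, 2) * C (2, 2)) + 562 * (C (0, 2) * C (2, 4)) + 676 *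
      (C (0, 2) * C (4, 0)) + 366 * (C (0, 2) * C (4, 2)) + 562 * (C (0, 2) * C (6, 0)) + 1388 * (C (0, 4)
      * C (0, 4)) + 3058 * (C (0, 4) * C (0, 6)) + 676 * (C (0, 4) * C (2, 0)) + 562 * (C (0, 4) * C (2,
      2)) + 694 * (C (0, 4) * C (2, 4)) + 366 * (C (0, 4) * C (4, 0)) + 360 * (C (0, 4) * C (4, 2)) + 360
      * (C (0, 4) * C (6, 0)) + 2361 * (C (0, 6) * C (0, 6)) + 562 * (C (0, 6) * C (2, 0)) + 694 * (C (0,
      6) * C (2, 2)) + 1336 * (C (0, 6) * C (2, 4)) + 360 * (C (0, 6) * C (4, 0)) + 660 * (C (0, 6) * C
      (4, 2)) + 484 * (C (0, 6) * C (6, 0)) + 1543 * (C (2, 0) * C (2, 0)) + 676 * (C (2, 0) * C (2, 2)) +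
      366 * (C (2, 0) * C (2, 4)) + 2790 * (C (2, 0) * C (4, 0)) + 562 * (C (2, 0) * C (4, 2)) + 2776 * (C
      (2, 0) * C (6, 0)) + 183 * (C (2, 2) * C (2, 2)) + 360 * (C (2, 2) * C (2, 4)) + 562 * (C (2, 2) * C
      (4, 0)) + 360 * (C (2, 2) * C (4, 2)) + 694 * (C (2, 2) * C (6, 0)) + 330 * (C (2, 4) * C (2, 4)) +
      360 * (C (2, 4) * C (4, 0)) + 484 * (C (2, 4) * C (4, 2)) + 660 * (C (2, 4) * C (6, 0)) + 1388 * (C
      (4, 0) * C (4, 0)) + 694 * (C (4, 0) * C (4, 2)) + 3058 * (C (4, 0) * C (6, 0)) + 330 * (C (4, 2) *
      C (4, 2)) + 1336 * (C (4, 2) * C (6, 0)) + 2361 * (C (6, 0) * C (6, 0))"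
    unfolding pairs dodecic_moments_def by (simp add: algebra_simps)
  also have "\<dots> \<ge> 0"
    by (rule dodecic_moments_quadratic)
  finally show ?thesis .
qed

lemma dodecic_moments_psd_01:
  "0 \<le> (\<Sum>p\<leftarrow>parity_pairs 6 0 1. \<Sum>q\<leftarrow>parity_pairs 6 0 1.
      dodecic_moments ! ((fst p + fst q) div 2) ! ((snd p + snd q) div 2) * (C p * C q))"
    (is "0 \<le> ?S")
proof -
  have pairs: "parity_pairs 6 0 1 =
      [(0, 1), (0, 3), (0, 5), (2, 1), (2, 3), (4, 1)]"
    by code_simp
  have "?S = 1939 * (C (0, 1) + 1543/1939 * C (0, 3) + 82/277 * C (2, 1) + 1395/1939 * C (0, 5) + 338/1939 * C
      (4, 1) + 338/1939 * C (2, 3))\<^sup>2 + 324056/1939 * (C (0, 3) + -57575/81014 * C (2, 1) +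
      538847/324056 * C (0, 5) + -166697/324056 * C (4, 1) + 23325/324056 * C (2, 3))\<^sup>2 +
      3389228/40507 * (C (2, 1) + 5309429/6778456 * C (0, 5) + 9709097/6778456 * C (4, 1) +
      7412075/6778456 * C (2, 3))\<^sup>2 + 161952623/13556912 * (C (0, 5) + -191016717/161952623 * C (4,
      1) + 164882409/161952623 * C (2, 3))\<^sup>2 + 9001217205/161952623 * (C (4, 1) +
      570432517/3000405735 * C (2, 3))\<^sup>2 + 5781249067/1000135245 * (C (2, 3))\<^sup>2"
    unfolding pairs dodecic_moments_def by (simp, algebra)
  also have "\<dots> \<ge> 0" by simp
  finally show ?thesis .
qed

lemma dodecic_moments_psd_10:
  "0 \<le> (\<Sum>p\<leftarrow>parity_pairs 6 1 0. \<Sum>q\<leftarrow>parity_pairs 6 1 0.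
      dodecic_moments ! ((fst p + fst q) div 2) ! ((snd p + snd q) div 2) * (C p * C q))"
    (is "0 \<le> ?S")
proof -
  have pairs: "parity_pairs 6 1 0 =
      [(1, 0), (1, 2), (1, 4), (3, 0), (3, 2), (5, 0)]"
    by code_simp
  have "?S = 1939 * (C (1, 0) + 1543/1939 * C (3, 0) + 82/277 * C (1, 2) + 1395/1939 * C (5, 0) + 338/1939 * C
      (1, 4) + 338/1939 * C (3, 2))\<^sup>2 + 324056/1939 * (C (3, 0) + -57575/81014 * C (1, 2) +
      538847/324056 * C (5, 0) + -166697/324056 * C (1, 4) + 23325/324056 * C (3, 2))\<^sup>2 +
      3389228/40507 * (C (1, 2) + 5309429/6778456 * C (5, 0) + 9709097/6778456 * C (1, 4) +
      7412075/6778456 * C (3, 2))\<^sup>2 + 161952623/13556912 * (C (5, 0) + -191016717/161952623 * C (1,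
      4) + 164882409/161952623 * C (3, 2))\<^sup>2 + 9001217205/161952623 * (C (1, 4) +
      570432517/3000405735 * C (3, 2))\<^sup>2 + 5781249067/1000135245 * (C (3, 2))\<^sup>2"
    unfolding pairs dodecic_moments_def by (simp, algebra)
  also have "\<dots> \<ge> 0" by simp
  finally show ?thesis .
qed

lemma dodecic_moments_psd_11:
  "0 \<le> (\<Sum>p\<leftarrow>parity_pairs 6 1 1. \<Sum>q\<leftarrow>parity_pairs 6 1 1.
      dodecic_moments ! ((fst p + fst q) div 2) ! ((snd p + snd q) div 2) * (C p * C q))"
    (is "0 \<le> ?S")
proof -
  have pairs: "parity_pairs 6 1 1 =
      [(1, 1), (1, 3), (1, 5), (3, 1), (3, 3), (5, 1)]"
    by code_simp
  have "?S = 574 * (C (1, 1) + 169/287 * (C (3, 1) + C (1, 3)) + 183/574 * C (3, 3) + 281/574 * (C (5, 1) + C (1,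
      5)))\<^sup>2 + 9462/287 * (C (3, 1) + C (1, 3) + 6911/3154 * C (3, 3) + 18757/6308 * (C (5, 1) + C
      (1, 5)))\<^sup>2 + 40000/1577 * (C (3, 3) + 161511/160000 * (C (5, 1) + C (1, 5)))\<^sup>2 +
      55927/640000 * (C (5, 1) + C (1, 5))\<^sup>2 + 49 * (C (3, 1) - C (1, 3) + 167/98 * (C (5, 1) - C
      (1, 5)))\<^sup>2 + 13859/196 * (C (5, 1) - C (1, 5))\<^sup>2"
    unfolding pairs dodecic_moments_def by (simp, algebra)
  also have "\<dots> \<ge> 0" by simp
  finally show ?thesis .
qed

definition dodecic_monomials :: "((nat \<times> nat) \<times> real) list" where
  "dodecic_monomials = [((0, 0), 1156/1953125), ((0, 2), 180272/1953125), ((0, 4), -110498/390625), ((0, 6), 155332/390625),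
      ((0, 8), -123442/390625), ((0, 10), 206752/1953125), ((0, 12), 5184/1953125), ((2, 0),
      180272/1953125), ((2, 2), -92216/390625), ((2, 4), 15736/390625), ((2, 6), 228952/390625), ((2, 8),
      -203288/390625), ((2, 10), 413504/1953125), ((4, 0), -110498/390625), ((4, 2), 15736/390625), ((4,
      4), -212712/390625), ((4, 6), 163384/390625), ((4, 8), -348528/390625), ((6, 0), 155332/390625),
      ((6, 2), 228952/390625), ((6, 4), 163384/390625), ((6, 6), 539616/390625), ((8, 0), -123442/390625),
      ((8, 2), -203288/390625), ((8, 4), -348528/390625), ((10, 0), 206752/1953125), ((10, 2),
      413504/1953125), ((12, 0), 5184/1953125)]"

lemma dodecic_not_SOS: "coeff_vector 6 dodecic \<notin> even_SOS_cone (2 * 6)"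
proof
  assume sos: "coeff_vector 6 dodecic \<in> even_SOS_cone (2 * 6)"
  have "\<exists>(N::nat) C. \<forall>x y z. (\<Sum>j<N. (ternary 6 (C j) x y z)\<^sup>2)
      = form_value dodecic (\<lambda>r. (real 3 * x ^ (2 * r) + real 6 * y ^ (2 * r) + real 6 * z ^ (2 * r)) / real (3 + 6 + 6))"
    by (rule even_SOS_cone_blocks[OF _ sos]) (auto simp: dodecic_def)
  then obtain N C where "\<And>x y z. (\<Sum>j<(N::nat). (ternary 6 (C j) x y z)\<^sup>2)
      = form_value dodecic (\<lambda>r. (real 3 * x ^ (2 * r) + real 6 * y ^ (2 * r) + real 6 * z ^ (2 * r)) / real (3 + 6 + 6))"
    by blast
  moreover have "form_value dodecic (\<lambda>r. (real 3 * 1 ^ (2 * r) + real 6 * y ^ (2 * r) + real 6 * z ^ (2 * r)) / real (3 + 6 + 6))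
      = (\<Sum>(p, a)\<leftarrow>dodecic_monomials. a * (y ^ fst p * z ^ snd p))" for y z
    by (simp add: form_value_def dodecic_def dodecic_monomials_def, algebra)
  ultimately have "(\<Sum>j<N. (ternary 6 (C j) 1 y z)\<^sup>2)
      = (\<Sum>(p, a)\<leftarrow>dodecic_monomials. a * (y ^ fst p * z ^ snd p))" for y z
    by simp
  moreover have "0 \<le> (\<Sum>p\<in>deg_pairs 6. \<Sum>q\<in>deg_pairs 6.
      pair_functional dodecic_moments (fst p + fst q, snd p + snd q) * (C p * C q))" for C
    using dodecic_moments_psd_00[of C] dodecic_moments_psd_01[of C] dodecic_moments_psd_10[of C] dodecic_moments_psd_11[of C]
    by (simp add: pair_functional_split numeral_2_eq_2)
  ultimately have "0 \<le> (\<Sum>(p, a)\<leftarrow>dodecic_monomials. a * pair_functional dodecic_moments p)"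
    by (rule functional_sos)
  then show False
    by (simp add: dodecic_monomials_def pair_functional_def dodecic_moments_def)
qed

section \<open>Degree fourteen and higher\<close>

lemma L2_set_scale: "L2_set (\<lambda>j. c * f j) A = \<bar>c\<bar> * L2_set f A"
  using L2_set_right_distrib[of "\<bar>c\<bar>" f A]
  by (simp add: L2_set_def power_mult_distrib)

text \<open>Minkowski's inequality. It is applied with \<open>A\<close> indexing the squares, so
  that the bounds do not depend on their number.\<close>

lemma L2_set_sum_le: "L2_set (\<lambda>j. \<Sum>i\<in>I. f i j) A \<le> (\<Sum>i\<in>I. L2_set (f i) A)"
proof (induction I rule: infinite_finite_induct)
  case (insert i I)
  have "L2_set (\<lambda>j. \<Sum>i\<in>insert i I. f i j) A = L2_set (\<lambda>j. f i j + (\<Sum>i\<in>I. f i j)) A"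
    using insert by simp
  also have "\<dots> \<le> L2_set (f i) A + L2_set (\<lambda>j. \<Sum>i\<in>I. f i j) A"
    by (rule L2_set_triangle_ineq)
  finally show ?case using insert by simp
qed (simp_all add: L2_set_def)

text \<open>Lagrange interpolation at the nodes 0, ..., \<open>d\<close>. The weights
  \<open>l\<close> are fixed before the polynomial \<open>h\<close>, so the same ones serve every
  square and every member of the sequence.\<close>

lemma interpolation_coefficients:
  "\<exists>l :: nat \<Rightarrow> nat \<Rightarrow> real. \<forall>h. \<forall>a\<le>d. h a = (\<Sum>i\<le>d. l a i * (\<Sum>b\<le>d. h b * real i ^ b))"
proof -
  define B where "B i = smult (inverse (\<Prod>j\<in>{..d} - {i}. real i - real j)) (\<Prod>j\<in>{..d} - {i}. [:- real j, 1:])" for i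
  have B: "poly (B i) (real m) = (if i = m then 1 else 0)" if "i \<le> d" "m \<le> d" for i m
  proof (cases "i = m")
    case True
    have "(\<Prod>j\<in>{..d} - {i}. real i - real j) \<noteq> 0"
      by (auto simp: prod_zero_iff)
    then show ?thesis using True by (simp add: B_def poly_prod)
  next
    case False
    then have "(\<Prod>j\<in>{..d} - {i}. real m - real j) = 0"
      using that by (auto simp: prod_zero_iff)
    then show ?thesis using False by (simp add: B_def poly_prod)
  qed
  have deg: "degree (B i) \<le> d" if "i \<le> d" for i
  proof -
    have "degree (\<Prod>j\<in>{..d} - {i}. [:- real j, 1:]) \<le> (\<Sum>j\<in>{..d} - {i}. 1)"
      by (rule order_trans[OF degree_prod_sum_le]) auto
    also have "\<dots> = d" using that by simp
    finally show ?thesis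
      unfolding B_def using degree_smult_le order_trans by blast
  qed
  have "h a = (\<Sum>i\<le>d. coeff (B i) a * (\<Sum>b\<le>d. h b * real i ^ b))" if "a \<le> d" for h a
  proof -
    define p where "p = (\<Sum>b\<le>d. monom (h b) b)"
    define q where "q = (\<Sum>i\<le>d. smult (poly p (real i)) (B i))"
    have "degree p \<le> d" unfolding p_def
      by (rule degree_sum_le) (auto intro: order_trans[OF degree_monom_le])
    moreover have "degree q \<le> d" unfolding q_def
      by (rule degree_sum_le) (auto intro: order_trans[OF degree_smult_le] deg)
    moreover have "poly p x = poly q x" if x: "x \<in> real ` {..d}" for x
    proof -
      obtain m where m: "m \<le> d" "x = real m" using x by auto
      have "poly q x = (\<Sum>i\<le>d. if i = m then poly p (real i) else 0)"
        unfolding q_def poly_sum using m by (intro sum.cong) (auto simp: B)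
      then show ?thesis using m by simp
    qed
    moreover have "card (real ` {..d}) = Suc d"
      by (simp add: card_image)
    ultimately have "p = q"
      by (intro poly_eqI_degree[of "real ` {..d}"]) auto
    moreover have "coeff p a = h a"
      using that by (simp add: p_def coeff_sum)
    moreover have "coeff q a = (\<Sum>i\<le>d. poly p (real i) * coeff (B i) a)"
      by (simp add: q_def coeff_sum)
    ultimately have "h a = (\<Sum>i\<le>d. poly p (real i) * coeff (B i) a)"
      by simp
    then show ?thesis
      by (simp add: p_def poly_sum poly_monom mult_ac)
  qed
  then show ?thesis by (intro exI[of _ "\<lambda>a i. coeff (B i) a"]) blast
qed

definition ternary_part :: "nat \<Rightarrow> nat \<Rightarrow> (nat \<times> nat \<Rightarrow> real) \<Rightarrow> real \<Rightarrow> real \<Rightarrow> real" where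
  "ternary_part d a C y z = (\<Sum>p | p \<in> deg_pairs d \<and> d - fst p - snd p = a. C p * (y ^ fst p * z ^ snd p))"

lemma ternary_eq_parts: "ternary d C x y z = (\<Sum>a\<le>d. ternary_part d a C y z * x ^ a)"
proof -
  have "ternary d C x y z = (\<Sum>a\<in>{..d}. \<Sum>p | p \<in> deg_pairs d \<and> d - fst p - snd p = a.
      C p * (x ^ (d - fst p - snd p) * y ^ fst p * z ^ snd p))"
    unfolding ternary_def by (rule sum.group[symmetric]) auto
  also have "\<dots> = (\<Sum>a\<in>{..d}. \<Sum>p | p \<in> deg_pairs d \<and> d - fst p - snd p = a.
      C p * (y ^ fst p * z ^ snd p) * x ^ a)"
    by (intro sum.cong refl) (auto simp: mult_ac)
  finally show ?thesis
    by (simp add: ternary_part_def sum_distrib_right)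
qed

text \<open>The monomials whose exponent of \<open>x\<close> is at least \<open>e\<close> are those
  indexed by \<open>deg_pairs m\<close>; so the same \<open>C\<close>, read in degree
  \<open>m\<close>, is the cofactor of \<open>x ^ e\<close>.\<close>

lemma ternary_one_eq:
  "ternary (e + m) C 1 y z = ternary m C 1 y z + (\<Sum>a<e. ternary_part (e + m) a C y z)"
proof -
  have "(\<Sum>a<e. ternary_part (e + m) a C y z)
      = (\<Sum>a<e. \<Sum>p | p \<in> deg_pairs (e + m) - deg_pairs m \<and> e + m - fst p - snd p = a. C p * (y ^ fst p * z ^ snd p))"
    unfolding ternary_part_def by (intro sum.cong refl) (auto simp: deg_pairs_def)
  also have "\<dots> = (\<Sum>p\<in>deg_pairs (e + m) - deg_pairs m. C p * (y ^ fst p * z ^ snd p))"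
    by (rule sum.group) (simp_all, auto simp: deg_pairs_def)
  also have "\<dots> + ternary m C 1 y z = ternary (e + m) C 1 y z"
    unfolding ternary_def power_one mult_1
    by (rule sum.subset_diff[symmetric]) (auto simp: deg_pairs_def intro: finite_deg_pairs[unfolded deg_pairs_def])
  finally show ?thesis by simp
qed

text \<open>The product of second differences in \<open>y\<close> and in \<open>z\<close>
  annihilates cubics, as no monomial of degree three is divisible by y^2 z^2; this is that relation
  solved for the value at the centre.\<close>

lemma cubic_nine_points:
  "ternary 3 C 1 0 0
    = 1/2 * (ternary 3 C 1 1 0 + ternary 3 C 1 (-1) 0 + ternary 3 C 1 0 1 + ternary 3 C 1 0 (-1))
      - 1/4 * (ternary 3 C 1 1 1 + ternary 3 C 1 1 (-1) + ternary 3 C 1 (-1) 1 + ternary 3 C 1 (-1) (-1))"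
  by (simp add: ternary_def sum_deg_pairs atMost_nat_numeral algebra_simps)

text \<open>The value does not depend on \<open>d\<close>, so the cubic cofactor and the whole form
  of degree \<open>e + 3\<close> agree at this point.\<close>

lemma ternary_at_unit: "ternary d C 1 0 0 = C (0, 0)"
proof -
  have "ternary d C 1 0 0 = (\<Sum>p\<in>{(0, 0)}. C p * (1 ^ (d - fst p - snd p) * 0 ^ fst p * 0 ^ snd p))"
    unfolding ternary_def
    by (rule sum.mono_neutral_right) (simp, simp add: deg_pairs_def, auto)
  then show ?thesis by simp
qed


text \<open>If the total mass of a family of ternary forms tends to \<open>X ^ (2 * e) * R\<close>, then the
  parts of degree less than \<open>e\<close> in \<open>X\<close> disappear in the limit: they are recovered from the values at
  the points \<open>X = \<delta> * i\<close>, where the limit is of order \<open>\<delta> ^ (2 * e)\<close>.\<close>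

lemma low_parts_tendsto_0:
  fixes N :: "nat \<Rightarrow> nat" and D :: "nat \<Rightarrow> nat \<Rightarrow> nat \<times> nat \<Rightarrow> real"
  assumes lim: "\<And>X. (\<lambda>k. \<Sum>j<N k. (ternary d (D k j) X y z)\<^sup>2) \<longlonglongrightarrow> X ^ (2 * e) * R X"
    and R: "\<And>X. \<bar>X\<bar> \<le> real d \<Longrightarrow> R X \<le> B" and a: "a < e" "a \<le> d"
  shows "(\<lambda>k. L2_set (\<lambda>j. ternary_part d a (D k j) y z) {..<N k}) \<longlonglongrightarrow> 0"
proof -
  obtain l :: "nat \<Rightarrow> nat \<Rightarrow> real" where l: "\<And>h a. a \<le> d \<Longrightarrow> h a = (\<Sum>i\<le>d. l a i * (\<Sum>b\<le>d. h b * real i ^ b))"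
    using interpolation_coefficients[of d] by blast
  define H where "H k = L2_set (\<lambda>j. ternary_part d a (D k j) y z) {..<N k}" for k
  define V where "V X k = L2_set (\<lambda>j. ternary d (D k j) X y z) {..<N k}" for X k
  have V: "V X \<longlonglongrightarrow> sqrt (X ^ (2 * e) * R X)" for X
    unfolding V_def L2_set_def by (intro tendsto_real_sqrt lim)
  \<comment> \<open>Interpolation at the nodes \<open>\<delta> * i\<close> instead of
    \<open>i\<close>, which multiplies the part of degree \<open>b\<close> by
    \<open>\<delta> ^ b\<close>.\<close>
  have H: "\<delta> ^ a * H k \<le> (\<Sum>i\<le>d. \<bar>l a i\<bar> * V (\<delta> * real i) k)" if "0 < \<delta>" for \<delta> k
  proof -
    have "\<delta> ^ a * ternary_part d a (D k j) y z = (\<Sum>i\<le>d. l a i * ternary d (D k j) (\<delta> * real i) y z)" for j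
      using l[OF a(2), of "\<lambda>b. \<delta> ^ b * ternary_part d b (D k j) y z"]
      by (simp add: ternary_eq_parts power_mult_distrib mult_ac)
    then have "\<delta> ^ a * H k = L2_set (\<lambda>j. \<Sum>i\<le>d. l a i * ternary d (D k j) (\<delta> * real i) y z) {..<N k}"
      using that by (simp add: H_def L2_set_right_distrib)
    also have "\<dots> \<le> (\<Sum>i\<le>d. L2_set (\<lambda>j. l a i * ternary d (D k j) (\<delta> * real i) y z) {..<N k})"
      by (rule L2_set_sum_le)
    finally show ?thesis by (simp add: L2_set_scale V_def)
  qed
  define B' where "B' = sqrt (max B 0)"
  define K where "K = (\<Sum>i\<le>d. \<bar>l a i\<bar> * (real i ^ e * B'))"
  have "0 \<le> K" by (simp add: K_def B'_def sum_nonneg)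
  have "\<forall>\<^sub>F k in sequentially. H k < \<epsilon>" if "\<epsilon> > 0" for \<epsilon>
  proof -
    define \<delta> where "\<delta> = min 1 (\<epsilon> / (2 * (K + 1)))"
    have \<delta>: "0 < \<delta>" "\<delta> \<le> 1" "\<delta> * (K + 1) < \<epsilon>"
    proof -
      have "\<delta> * (K + 1) \<le> \<epsilon> / (2 * (K + 1)) * (K + 1)"
        using \<open>0 \<le> K\<close> by (intro mult_right_mono) (auto simp: \<delta>_def)
      also have "\<dots> = \<epsilon> / 2" using \<open>0 \<le> K\<close> by (simp add: divide_simps add_nonneg_eq_0_iff)
      also have "\<dots> < \<epsilon>" using that by simp
      finally show "\<delta> * (K + 1) < \<epsilon>" .
    qed (use that \<open>0 \<le> K\<close> in \<open>auto simp: \<delta>_def\<close>)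
    have lim': "(\<lambda>k. \<Sum>i\<le>d. \<bar>l a i\<bar> * V (\<delta> * real i) k)
        \<longlonglongrightarrow> (\<Sum>i\<le>d. \<bar>l a i\<bar> * sqrt ((\<delta> * real i) ^ (2 * e) * R (\<delta> * real i)))"
      by (intro tendsto_intros V)
    have "(\<Sum>i\<le>d. \<bar>l a i\<bar> * sqrt ((\<delta> * real i) ^ (2 * e) * R (\<delta> * real i))) \<le> \<delta> ^ e * K"
    proof -
      have "sqrt ((\<delta> * real i) ^ (2 * e) * R (\<delta> * real i)) \<le> \<delta> ^ e * (real i ^ e * B')" if "i \<le> d" for i
      proof -
        have "\<delta> * real i \<le> 1 * real d"
          using \<delta> that by (intro mult_mono) auto
        then have "R (\<delta> * real i) \<le> max B 0"
          using R[of "\<delta> * real i"] \<delta> by auto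
        then have "sqrt ((\<delta> * real i) ^ (2 * e) * R (\<delta> * real i)) \<le> sqrt ((\<delta> * real i) ^ (2 * e) * max B 0)"
          by (intro real_sqrt_le_mono mult_left_mono) (auto simp: power_mult)
        also have "\<dots> = \<delta> ^ e * (real i ^ e * B')"
        proof -
          have "(\<delta> * real i) ^ (2 * e) = ((\<delta> * real i) ^ e)\<^sup>2"
            by (simp only: power_mult[symmetric] mult.commute)
          then have "sqrt ((\<delta> * real i) ^ (2 * e) * max B 0) = \<bar>(\<delta> * real i) ^ e\<bar> * B'"
            unfolding B'_def by (simp only: real_sqrt_mult real_sqrt_abs)
          then show ?thesis using \<delta> by (simp add: power_mult_distrib)
        qed
        finally show ?thesis .
      qed
      then have "(\<Sum>i\<le>d. \<bar>l a i\<bar> * sqrt ((\<delta> * real i) ^ (2 * e) * R (\<delta> * real i)))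
          \<le> (\<Sum>i\<le>d. \<bar>l a i\<bar> * (\<delta> ^ e * (real i ^ e * B')))"
        by (intro sum_mono mult_left_mono) auto
      then show ?thesis by (simp add: K_def sum_distrib_left mult_ac)
    qed
    \<comment> \<open>As \<open>a < e\<close>, dividing by \<open>\<delta> ^ a\<close> leaves at
      least one factor \<delta>, and \<delta> was chosen to make its product with \<open>K\<close>
      less than \<epsilon>.\<close>
    moreover have "\<delta> ^ e * K < \<delta> ^ a * \<epsilon>"
    proof -
      have "\<delta> ^ e * K \<le> \<delta> ^ Suc a * K"
        using \<delta> a \<open>0 \<le> K\<close> by (intro mult_right_mono power_decreasing) auto
      also have "\<dots> = \<delta> ^ a * (\<delta> * K)" by (simp add: mult_ac)
      also have "\<delta> * K < \<epsilon>" using \<delta> by (simp add: algebra_simps)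
      finally show ?thesis using \<delta> by simp
    qed
    ultimately have "\<forall>\<^sub>F k in sequentially. (\<Sum>i\<le>d. \<bar>l a i\<bar> * V (\<delta> * real i) k) < \<delta> ^ a * \<epsilon>"
      by (intro order_tendstoD(2)[OF lim']) linarith
    then show ?thesis
    proof eventually_elim
      case (elim k)
      then have "\<delta> ^ a * H k < \<delta> ^ a * \<epsilon>" using H[OF \<delta>(1), of k] by linarith
      then show ?case using \<delta> by simp
    qed
  qed
  moreover have "\<forall>\<^sub>F k in sequentially. b < H k" if "b < 0" for b
    using that by (intro always_eventually allI, rule less_le_trans[of _ 0]) (simp_all add: H_def)
  ultimately have "H \<longlonglongrightarrow> 0"
    by (intro order_tendstoI) auto
  then show ?thesis by (simp add: H_def[abs_def])
qed

text \<open>At \<open>x = 1\<close> the cofactor of \<open>x ^ e\<close> is the whole form minus the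
  low parts. The norm of the former tends to the square root of \<open>R 1\<close>, that of the
  latter to zero.\<close>

lemma cubic_part_tendsto_0:
  fixes N :: "nat \<Rightarrow> nat" and D :: "nat \<Rightarrow> nat \<Rightarrow> nat \<times> nat \<Rightarrow> real"
  assumes lim: "\<And>X. (\<lambda>k. \<Sum>j<N k. (ternary (e + m) (D k j) X y z)\<^sup>2) \<longlonglongrightarrow> X ^ (2 * e) * R X"
    and R: "\<And>X. \<bar>X\<bar> \<le> real (e + m) \<Longrightarrow> R X \<le> B" and "R 1 = 0"
  shows "(\<lambda>k. L2_set (\<lambda>j. ternary m (D k j) 1 y z) {..<N k}) \<longlonglongrightarrow> 0"
proof (rule tendsto_sandwich[where f = "\<lambda>_. 0"])
  let ?u = "\<lambda>k. L2_set (\<lambda>j. ternary (e + m) (D k j) 1 y z) {..<N k}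
    + (\<Sum>a<e. L2_set (\<lambda>j. ternary_part (e + m) a (D k j) y z) {..<N k})"
  have "L2_set (\<lambda>j. ternary m (D k j) 1 y z) {..<N k} \<le> ?u k" for k
  proof -
    have "ternary m (D k j) 1 y z = ternary (e + m) (D k j) 1 y z + (\<Sum>a<e. - 1 * ternary_part (e + m) a (D k j) y z)" for j
      by (simp add: ternary_one_eq sum_negf)
    then have "L2_set (\<lambda>j. ternary m (D k j) 1 y z) {..<N k}
      \<le> L2_set (\<lambda>j. ternary (e + m) (D k j) 1 y z) {..<N k}
        + L2_set (\<lambda>j. \<Sum>a<e. - 1 * ternary_part (e + m) a (D k j) y z) {..<N k}"
      by (simp only: L2_set_triangle_ineq)
    also have "L2_set (\<lambda>j. \<Sum>a<e. - 1 * ternary_part (e + m) a (D k j) y z) {..<N k}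
      \<le> (\<Sum>a<e. L2_set (\<lambda>j. - 1 * ternary_part (e + m) a (D k j) y z) {..<N k})"
      by (rule L2_set_sum_le)
    finally show ?thesis by (simp only: L2_set_scale) simp
  qed
  then show "\<forall>\<^sub>F k in sequentially. L2_set (\<lambda>j. ternary m (D k j) 1 y z) {..<N k} \<le> ?u k"
    by simp
  have "(\<lambda>k. L2_set (\<lambda>j. ternary (e + m) (D k j) 1 y z) {..<N k}) \<longlonglongrightarrow> sqrt (1 ^ (2 * e) * R 1)"
    unfolding L2_set_def by (intro tendsto_real_sqrt lim)
  moreover have "(\<lambda>k. L2_set (\<lambda>j. ternary_part (e + m) a (D k j) y z) {..<N k}) \<longlonglongrightarrow> 0" if "a < e" for a
    by (rule low_parts_tendsto_0[OF lim R that]) (use that in auto)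
  ultimately have "?u \<longlonglongrightarrow> sqrt (1 ^ (2 * e) * R 1) + (\<Sum>a<e. 0)"
    by (intro tendsto_add tendsto_sum) auto
  then show "?u \<longlonglongrightarrow> 0" by (simp add: \<open>R 1 = 0\<close>)
qed auto

text \<open>The value of a cubic at the centre of the grid \<open>{-1, 0, 1} \<times> {-1, 0, 1}\<close> is determined by the
  other eight values, at which \<open>R 1\<close> vanishes, as for Robinson's form.\<close>

lemma no_limit_of_squares:
  fixes N :: "nat \<Rightarrow> nat" and D :: "nat \<Rightarrow> nat \<Rightarrow> nat \<times> nat \<Rightarrow> real"
  assumes lim: "\<And>X y z. (\<lambda>k. \<Sum>j<N k. (ternary (e + 3) (D k j) X y z)\<^sup>2) \<longlonglongrightarrow> X ^ (2 * e) * R y z X"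
    and R: "\<And>y z X. \<bar>X\<bar> \<le> real (e + 3) \<Longrightarrow> R y z X \<le> B y z"
    and zero: "\<And>y z. y \<in> {-1, 0, 1} \<Longrightarrow> z \<in> {-1, 0, 1} \<Longrightarrow> (y, z) \<noteq> (0, 0) \<Longrightarrow> R y z 1 = 0"
    and nonzero: "R 0 0 1 \<noteq> 0"
  shows False
proof -
  define W where "W k y z = L2_set (\<lambda>j. ternary 3 (D k j) 1 y z) {..<N k}" for k y z
  have W: "(\<lambda>k. W k y z) \<longlonglongrightarrow> 0" if "y \<in> {-1, 0, 1}" "z \<in> {-1, 0, 1}" "(y, z) \<noteq> (0, 0)" for y z
    unfolding W_def by (rule cubic_part_tendsto_0[OF lim R zero[OF that]]) auto
  let ?u = "\<lambda>k. 1/2 * (W k 1 0 + W k (-1) 0 + W k 0 1 + W k 0 (-1))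
      + 1/4 * (W k 1 1 + W k 1 (-1) + W k (-1) 1 + W k (-1) (-1))"
  have upper: "W k 0 0 \<le> ?u k" for k
  proof -
    define T where "T f = L2_set f {..<N k}" for f :: "nat \<Rightarrow> real"
    have T_add: "T (\<lambda>j. f j + g j) \<le> T f + T g" for f g
      unfolding T_def by (rule L2_set_triangle_ineq)
    have T_scale: "T (\<lambda>j. c * f j) = \<bar>c\<bar> * T f" for c f
      unfolding T_def by (rule L2_set_scale)
    let ?t = "\<lambda>y z j. ternary 3 (D k j) 1 y z"
    have T4: "T (\<lambda>j. f j + g j + h j + i j) \<le> T f + T g + T h + T i" for f g h i
      using T_add[of "\<lambda>j. f j + g j + h j" i] T_add[of "\<lambda>j. f j + g j" h] T_add[of f g] by linarith
    define f where "f j = ?t 1 0 j + ?t (-1) 0 j + ?t 0 1 j + ?t 0 (-1) j" for j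
    define g where "g j = ?t 1 1 j + ?t 1 (-1) j + ?t (-1) 1 j + ?t (-1) (-1) j" for j
    have "W k 0 0 = T (\<lambda>j. 1/2 * f j + (-1/4) * g j)"
      unfolding W_def T_def by (rule L2_set_cong) (simp_all add: cubic_nine_points f_def g_def)
    also have "\<dots> \<le> T (\<lambda>j. 1/2 * f j) + T (\<lambda>j. (-1/4) * g j)"
      by (rule T_add)
    also have "\<dots> = 1/2 * T f + 1/4 * T g"
      unfolding T_scale by simp
    finally have "W k 0 0 \<le> 1/2 * T f + 1/4 * T g" .
    moreover have "T f \<le> W k 1 0 + W k (-1) 0 + W k 0 1 + W k 0 (-1)"
      using T4[of "?t 1 0" "?t (-1) 0" "?t 0 1" "?t 0 (-1)"] by (simp add: f_def[abs_def] W_def T_def)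
    moreover have "T g \<le> W k 1 1 + W k 1 (-1) + W k (-1) 1 + W k (-1) (-1)"
      using T4[of "?t 1 1" "?t 1 (-1)" "?t (-1) 1" "?t (-1) (-1)"] by (simp add: g_def[abs_def] W_def T_def)
    ultimately show ?thesis by argo
  qed
  have "?u \<longlonglongrightarrow> 1/2 * (0 + 0 + 0 + 0) + 1/4 * (0 + 0 + 0 + 0)"
    by (intro tendsto_add tendsto_mult tendsto_const W) simp_all
  then have "?u \<longlonglongrightarrow> 0"
    by simp
  then have "(\<lambda>k. W k 0 0) \<longlonglongrightarrow> 0"
    by (rule tendsto_sandwich[OF _ _ tendsto_const, rotated 2])
      (intro always_eventually allI, simp add: W_def, intro always_eventually allI upper)
  then have "(\<lambda>k. (W k 0 0)\<^sup>2) \<longlonglongrightarrow> 0\<^sup>2"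
    by (intro tendsto_intros)
  moreover have "(W k 0 0)\<^sup>2 = (\<Sum>j<N k. (ternary (e + 3) (D k j) 1 0 0)\<^sup>2)" for k
    by (simp add: W_def L2_set_def sum_nonneg ternary_at_unit)
  ultimately show False
    using LIMSEQ_unique[OF lim[of 1 0 0]] nonzero by simp
qed

text \<open>Expanded: X^6 + y^6 + z^6 - X^4 y^2 - X^2 y^4 - X^4 z^2 - X^2 z^4 - y^4 z^2 - y^2 z^4 +
  3 X^2 y^2 z^2. Writing it in the power means of y^2 and z^2 allows its extension to many
  variables.\<close>

definition robinson :: "real \<Rightarrow> real \<Rightarrow> real \<Rightarrow> real" where
  "robinson y z X = (let m = (\<lambda>r. (y ^ (2 * r) + z ^ (2 * r)) / 2) in
    2 * m 3 - 4 * m 1 ^ 3 + 2 * m 1 * m 2 - 5 * X ^ 2 * m 2 + 6 * X ^ 2 * m 1 ^ 2 - 2 * X ^ 4 * m 1 + X ^ 6)"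

text \<open>\<open>X ^ (2 * e)\<close> times Robinson's form, with \<open>X ^ (2 * (e + j))\<close>
  replaced by the moment of order \<open>e + j\<close> divided by
  \<open>\<sigma> ^ j\<close>.\<close>

definition robinson_ps :: "nat \<Rightarrow> real \<Rightarrow> (real \<times> nat list) list" where
  "robinson_ps e \<sigma> = [(2, [e, 3]), (-4, [e, 1, 1, 1]), (2, [e, 2, 1]), (-5 / \<sigma>, [e + 1, 2]),
    (6 / \<sigma>, [e + 1, 1, 1]), (-2 / \<sigma> ^ 2, [e + 2, 1]), (1 / \<sigma> ^ 3, [e + 3])]"

lemma robinson_ps_partitions:
  "0 < e \<Longrightarrow> (a, l) \<in> set (robinson_ps e \<sigma>) \<Longrightarrow> sum_list l = e + 3 \<and> (\<forall>r \<in> set l. 0 < r)"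
  by (auto simp: robinson_ps_def)

text \<open>The form is the mean of \<open>y i ^ e * G (y i / \<sigma>)\<close>, where \<open>G\<close> is a cubic whose coefficients are
  polynomials in the moments; \<open>G\<close> restricts to Robinson's form on measures with two equal atoms.\<close>

lemma robinson_ps_in_PSD:
  assumes e: "0 < e" and \<sigma>: "0 < \<sigma>"
  shows "coeff_vector (e + 3) (robinson_ps e \<sigma>) \<in> even_PSD_cone (2 * (e + 3))"
proof (rule coeff_vector_in_PSD)
  fix n and y :: "nat \<Rightarrow> real"
  assume n: "0 < n" and y: "\<And>i. 0 \<le> y i" and m1: "moment n y 1 = 1"
  define u where "u = moment n y 2 - 1"
  have u: "0 \<le> u" using moment2_ge[OF n m1] by (simp add: u_def)
  have m2: "moment n y 2 = 1 + u" by (simp add: u_def)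
  have m3: "(1 + u)\<^sup>2 \<le> moment n y 3"
    using moment3_ge[OF n y m1] by (simp add: m2)
  define c where "c = 2 * moment n y 3 - 4 + 2 * (1 + u)"
  define G where "G s = c + (1 - 5 * u) * s - 2 * s ^ 2 + s ^ 3" for s
  have G: "0 \<le> G s" if "0 \<le> s" for s
  proof -
    \<comment> \<open>This is \<open>G s\<close> with m_3 replaced by its lower bound m_2^2. As a
      quadratic in \<open>u\<close> it has discriminant -(s - 2)^2 (8 s - 9); for
      \<open>s \<le> 6/5\<close> all its coefficients are nonnegative.\<close>
    have "0 \<le> 2 * u\<^sup>2 + (6 - 5 * s) * u + s * (s - 1)\<^sup>2"
    proof (cases "s \<le> 6/5")
      case True
      then show ?thesis using u that by simp
    next
      case False
      have "2 * u\<^sup>2 + (6 - 5 * s) * u + s * (s - 1)\<^sup>2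
          = ((4 * u + 6 - 5 * s)\<^sup>2 + (s - 2)\<^sup>2 * (8 * s - 9)) / 8"
        by (simp add: power2_eq_square field_simps)
      also have "\<dots> \<ge> 0" using False by simp
      finally show ?thesis .
    qed
    also have "\<dots> \<le> G s"
      using m3 by (simp add: G_def c_def power2_eq_square power3_eq_cube algebra_simps)
    finally show ?thesis .
  qed
  have "0 \<le> (\<Sum>i = 1..n. y i ^ e * G (y i / \<sigma>)) / real n"
    using y \<sigma> by (intro divide_nonneg_nonneg sum_nonneg mult_nonneg_nonneg G) auto
  also have "\<dots> = (\<Sum>i = 1..n. c * y i ^ e + (1 - 5 * u) / \<sigma> * y i ^ (e + 1) - 2 / \<sigma> ^ 2 * y i ^ (e + 2)
      + 1 / \<sigma> ^ 3 * y i ^ (e + 3)) / real n"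
    by (intro arg_cong2[where f = divide] sum.cong refl)
       (use \<sigma> in \<open>simp add: G_def power_add power2_eq_square power3_eq_cube field_simps\<close>)
  also have "\<dots> = c * moment n y e + (1 - 5 * u) / \<sigma> * moment n y (e + 1) - 2 / \<sigma> ^ 2 * moment n y (e + 2)
      + 1 / \<sigma> ^ 3 * moment n y (e + 3)"
    unfolding moment_def
    by (simp only: sum.distrib sum_subtractf sum_distrib_left[symmetric] add_divide_distrib diff_divide_distrib
        times_divide_eq_right)
  also have "\<dots> = form_value (robinson_ps e \<sigma>) (moment n y)"
    unfolding form_value_def robinson_ps_def
    by (simp add: m1[simplified] m2 c_def algebra_simps add_divide_distrib diff_divide_distrib)
  finally show "0 \<le> form_value (robinson_ps e \<sigma>) (moment n y)" .
qed (use robinson_ps_partitions[OF e] in auto)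

text \<open>The large variable is \<open>k * X\<close>, so \<open>\<sigma> = k ^ 2\<close>, and the blocks have \<open>k ^ 7\<close> elements: the large variable
  does not contribute to the moments of order at most three since \<open>\<sigma> ^ 3 / k ^ 7\<close> tends to zero, nor do the
  blocks contribute to those of order at least \<open>e\<close> since \<open>k ^ 7 / \<sigma> ^ e\<close> does.\<close>

lemma robinson_limit:
  assumes e: "4 \<le> e"
  defines "M \<equiv> \<lambda>k X y z r. (real 1 * (real k * X) ^ (2 * r) + real (k ^ 7) * y ^ (2 * r) + real (k ^ 7) * z ^ (2 * r))
      / real (1 + k ^ 7 + k ^ 7)"
  shows "(\<lambda>k. real (1 + k ^ 7 + k ^ 7) / real k ^ (2 * e) * form_value (robinson_ps e (real k ^ 2)) (M k X y z))
    \<longlonglongrightarrow> X ^ (2 * e) * robinson y z X"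
proof -
  \<comment> \<open>The moment of order \<open>e + j\<close>, times the number of variables, divided
    by \<open>k ^ (2 * e)\<close> and by \<open>\<sigma> ^ j\<close>; see \<open>MA\<close>. The
    exponent \<open>2 * (e + j) - 7\<close> is positive because \<open>e\<close> is at least
    4.\<close>
  define A where "A j k = X ^ (2 * (e + j)) + (1 / real k) ^ (2 * (e + j) - 7) * (y ^ (2 * (e + j)) + z ^ (2 * (e + j)))" for j k
  have A: "A j \<longlonglongrightarrow> X ^ (2 * (e + j))" for j
  proof -
    have "A j \<longlonglongrightarrow> X ^ (2 * (e + j)) + 0 ^ (2 * (e + j) - 7) * (y ^ (2 * (e + j)) + z ^ (2 * (e + j)))"
      unfolding A_def by (intro tendsto_intros lim_1_over_n)
    then show ?thesis using e by (simp add: power_0_left)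
  qed
  have M: "(\<lambda>k. M k X y z r) \<longlonglongrightarrow> (y ^ (2 * r) + z ^ (2 * r)) / 2" if "r \<in> {1, 2, 3}" for r
  proof -
    have "(\<lambda>k. real k ^ (2 * r) / (1 + 2 * real k ^ 7)) \<longlonglongrightarrow> 0"
      using that by (elim insertE emptyE; simp only:; real_asymp)
    moreover have "(\<lambda>k. real k ^ 7 / (1 + 2 * real k ^ 7)) \<longlonglongrightarrow> 1 / 2"
      by real_asymp
    ultimately have "(\<lambda>k. real k ^ (2 * r) / (1 + 2 * real k ^ 7) * X ^ (2 * r)
        + real k ^ 7 / (1 + 2 * real k ^ 7) * (y ^ (2 * r) + z ^ (2 * r)))
        \<longlonglongrightarrow> 0 * X ^ (2 * r) + 1 / 2 * (y ^ (2 * r) + z ^ (2 * r))"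
      by (intro tendsto_add tendsto_mult tendsto_const)
    moreover have "M k X y z r = real k ^ (2 * r) / (1 + 2 * real k ^ 7) * X ^ (2 * r)
        + real k ^ 7 / (1 + 2 * real k ^ 7) * (y ^ (2 * r) + z ^ (2 * r))" for k
      by (simp add: M_def power_mult_distrib add_divide_distrib[symmetric] algebra_simps)
    ultimately show ?thesis by (simp add: M_def)
  qed
  have MA: "real (1 + k ^ 7 + k ^ 7) / real k ^ (2 * e) * (M k X y z (e + j) / (real k ^ 2) ^ j) = A j k"
    if k: "0 < k" for j k
  proof -
    define S where "S = real (1 + k ^ 7 + k ^ 7)"
    have "S \<noteq> 0" unfolding S_def by linarith
    then have "S * M k X y z (e + j)
        = (real k * X) ^ (2 * (e + j)) + real k ^ 7 * (y ^ (2 * (e + j)) + z ^ (2 * (e + j)))"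
      unfolding M_def S_def[symmetric] by (simp, simp add: distrib_left)
    then have "real (1 + k ^ 7 + k ^ 7) * M k X y z (e + j)
        = (real k * X) ^ (2 * (e + j)) + real k ^ 7 * (y ^ (2 * (e + j)) + z ^ (2 * (e + j)))"
      by (simp only: S_def)
    then have "real (1 + k ^ 7 + k ^ 7) / real k ^ (2 * e) * (M k X y z (e + j) / (real k ^ 2) ^ j)
        = ((real k * X) ^ (2 * (e + j)) + real k ^ 7 * (y ^ (2 * (e + j)) + z ^ (2 * (e + j)))) / real k ^ (2 * (e + j))"
      by (simp add: power_add power_mult[symmetric] distrib_left)
    also have "\<dots> = X ^ (2 * (e + j)) + real k ^ 7 / real k ^ (2 * (e + j)) * (y ^ (2 * (e + j)) + z ^ (2 * (e + j)))"
      using k by (simp add: add_divide_distrib power_mult_distrib)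
    also have "real k ^ 7 / real k ^ (2 * (e + j)) = (1 / real k) ^ (2 * (e + j) - 7)"
      using e k by (simp add: power_diff power_one_over field_simps)
    finally show ?thesis by (simp add: A_def)
  qed
  let ?m = "\<lambda>k r. M k X y z r"
  have "(\<lambda>k. 2 * A 0 k * ?m k 3 - 4 * A 0 k * ?m k 1 ^ 3 + 2 * A 0 k * ?m k 1 * ?m k 2
      - 5 * A 1 k * ?m k 2 + 6 * A 1 k * ?m k 1 ^ 2 - 2 * A 2 k * ?m k 1 + A 3 k)
    \<longlonglongrightarrow> (let m = (\<lambda>r. (y ^ (2 * r) + z ^ (2 * r)) / 2) in
      2 * X ^ (2 * (e + 0)) * m 3 - 4 * X ^ (2 * (e + 0)) * m 1 ^ 3 + 2 * X ^ (2 * (e + 0)) * m 1 * m 2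
      - 5 * X ^ (2 * (e + 1)) * m 2 + 6 * X ^ (2 * (e + 1)) * m 1 ^ 2 - 2 * X ^ (2 * (e + 2)) * m 1 + X ^ (2 * (e + 3)))"
    unfolding Let_def by (intro tendsto_intros A M) auto
  also have "(let m = (\<lambda>r. (y ^ (2 * r) + z ^ (2 * r)) / 2) in
      2 * X ^ (2 * (e + 0)) * m 3 - 4 * X ^ (2 * (e + 0)) * m 1 ^ 3 + 2 * X ^ (2 * (e + 0)) * m 1 * m 2
      - 5 * X ^ (2 * (e + 1)) * m 2 + 6 * X ^ (2 * (e + 1)) * m 1 ^ 2 - 2 * X ^ (2 * (e + 2)) * m 1 + X ^ (2 * (e + 3)))
      = X ^ (2 * e) * robinson y z X"
  proof -
    have pw: "X ^ (2 * (e + j)) = X ^ (2 * e) * X ^ (2 * j)" for j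
      by (simp add: power_add distrib_left)
    have "2 * X ^ (2 * (e + 0)) * m3 - 4 * X ^ (2 * (e + 0)) * m1 ^ 3 + 2 * X ^ (2 * (e + 0)) * m1 * m2
      - 5 * X ^ (2 * (e + 1)) * m2 + 6 * X ^ (2 * (e + 1)) * m1 ^ 2 - 2 * X ^ (2 * (e + 2)) * m1 + X ^ (2 * (e + 3))
      = X ^ (2 * e) * (2 * m3 - 4 * m1 ^ 3 + 2 * m1 * m2 - 5 * X ^ 2 * m2 + 6 * X ^ 2 * m1 ^ 2 - 2 * X ^ 4 * m1 + X ^ 6)"
      for m1 m2 m3 :: real
      unfolding pw by (simp add: algebra_simps power2_eq_square)
    then show ?thesis
      by (simp only: robinson_def Let_def)
  qed
  finally show ?thesis
  proof (rule Lim_transform_eventually)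
    show "\<forall>\<^sub>F k in sequentially. 2 * A 0 k * ?m k 3 - 4 * A 0 k * ?m k 1 ^ 3 + 2 * A 0 k * ?m k 1 * ?m k 2
      - 5 * A 1 k * ?m k 2 + 6 * A 1 k * ?m k 1 ^ 2 - 2 * A 2 k * ?m k 1 + A 3 k
      = real (1 + k ^ 7 + k ^ 7) / real k ^ (2 * e) * form_value (robinson_ps e (real k ^ 2)) (M k X y z)"
      using eventually_gt_at_top[of 0]
    proof eventually_elim
      case (elim k)
      show ?case
        unfolding MA[OF elim, symmetric] form_value_def robinson_ps_def
        by (simp add: algebra_simps power2_eq_square power3_eq_cube)
    qed
  qed
qed

lemma robinson_zero:
  "y \<in> {-1, 0, 1} \<Longrightarrow> z \<in> {-1, 0, 1} \<Longrightarrow> (y, z) \<noteq> (0, 0) \<Longrightarrow> robinson y z 1 = 0"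
  by (elim insertE emptyE) (simp_all add: robinson_def power_divide)

lemma robinson_bounded: "\<exists>B. \<forall>X. \<bar>X\<bar> \<le> d \<longrightarrow> robinson y z X \<le> B"
proof (cases "0 \<le> d")
  case True
  have "continuous_on {-d..d} (robinson y z)"
    unfolding robinson_def Let_def by (intro continuous_intros)
  then obtain X where "\<forall>X' \<in> {-d..d}. robinson y z X' \<le> robinson y z X"
    using continuous_attains_sup[of "{-d..d}"] True by (auto simp: compact_Icc)
  then show ?thesis by (intro exI[of _ "robinson y z X"]) (auto simp: abs_le_iff)
qed auto

lemma robinson_ps_not_SOS:
  assumes e: "4 \<le> e"
  shows "\<exists>\<sigma>>0. coeff_vector (e + 3) (robinson_ps e \<sigma>) \<notin> even_SOS_cone (2 * (e + 3))"
proof (rule ccontr)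
  assume "\<not> ?thesis"
  then have sos: "coeff_vector (e + 3) (robinson_ps e \<sigma>) \<in> even_SOS_cone (2 * (e + 3))" if "\<sigma> > 0" for \<sigma>
    using that by blast
  let ?M = "\<lambda>k X y z r. (real 1 * (real k * X) ^ (2 * r) + real (k ^ 7) * y ^ (2 * r) + real (k ^ 7) * z ^ (2 * r))
      / real (1 + k ^ 7 + k ^ 7)"
  let ?\<rho> = "\<lambda>k. real (1 + k ^ 7 + k ^ 7) / real k ^ (2 * e)"
  define P where "P k ND \<longleftrightarrow> (\<forall>X y z. (\<Sum>j<fst ND. (ternary (e + 3) (snd ND j) X y z)\<^sup>2)
      = ?\<rho> k * form_value (robinson_ps e (real k ^ 2)) (?M k X y z))"
    for k and ND :: "nat \<times> (nat \<Rightarrow> nat \<times> nat \<Rightarrow> real)"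
  have P: "\<exists>ND. P k ND" if k: "e + 3 \<le> k" for k
  proof -
    have "k ^ 1 \<le> k ^ 7" using k by (intro power_increasing) auto
    then have n: "2 * (e + 3) \<le> 1 + k ^ 7 + k ^ 7" using k by simp
    have pos: "0 < e" "(0::real) < real k ^ 2" using e k by auto
    have "\<exists>(N::nat) C. \<forall>x y z. (\<Sum>j<N. (ternary (e + 3) (C j) x y z)\<^sup>2)
      = form_value (robinson_ps e (real k ^ 2)) (\<lambda>r. (real 1 * x ^ (2 * r) + real (k ^ 7) * y ^ (2 * r)
          + real (k ^ 7) * z ^ (2 * r)) / real (1 + k ^ 7 + k ^ 7))"
      by (rule even_SOS_cone_blocks[OF _ sos[OF pos(2)] n]) (rule robinson_ps_partitions[OF pos(1)])
    then obtain N C where C: "\<And>x y z. (\<Sum>j<(N::nat). (ternary (e + 3) (C j) x y z)\<^sup>2)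
      = form_value (robinson_ps e (real k ^ 2)) (\<lambda>r. (real 1 * x ^ (2 * r) + real (k ^ 7) * y ^ (2 * r)
          + real (k ^ 7) * z ^ (2 * r)) / real (1 + k ^ 7 + k ^ 7))"
      by blast
    \<comment> \<open>The substitution of \<open>k * X\<close> for \<open>x\<close> and the square
      root of the scaling factor are absorbed into the coefficients.\<close>
    define D where "D j p = sqrt (?\<rho> k) * (C j p * real k ^ (e + 3 - fst p - snd p))" for j p
    have "ternary (e + 3) (D j) X y z = sqrt (?\<rho> k) * ternary (e + 3) (C j) (real k * X) y z" for j X y z
      by (simp add: ternary_def D_def sum_distrib_left power_mult_distrib mult_ac)
    then have "(\<Sum>j<N. (ternary (e + 3) (D j) X y z)\<^sup>2)
        = ?\<rho> k * (\<Sum>j<N. (ternary (e + 3) (C j) (real k * X) y z)\<^sup>2)" for X y z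
      by (simp add: power_mult_distrib sum_distrib_left)
    then show ?thesis
      unfolding P_def by (intro exI[of _ "(N, D)"]) (simp add: C)
  qed
  \<comment> \<open>For small \<open>k\<close> the choice is arbitrary, which limits do not
    see.\<close>
  define ND where "ND k = (SOME ND. P k ND)" for k
  define N where "N k = fst (ND k)" for k
  define D where "D k = snd (ND k)" for k
  have ND: "(\<Sum>j<N k. (ternary (e + 3) (D k j) X y z)\<^sup>2)
      = ?\<rho> k * form_value (robinson_ps e (real k ^ 2)) (?M k X y z)" if "e + 3 \<le> k" for k X y z
    using someI_ex[OF P[OF that]] unfolding N_def D_def ND_def P_def by blast
  obtain B where B: "\<And>y z X. \<bar>X\<bar> \<le> real (e + 3) \<Longrightarrow> robinson y z X \<le> B y z"
    using robinson_bounded[of "real (e + 3)"] by metis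
  show False
  proof (rule no_limit_of_squares[where N = N and e = e and D = D and R = robinson and B = B])
    fix X y z
    show "(\<lambda>k. \<Sum>j<N k. (ternary (e + 3) (D k j) X y z)\<^sup>2) \<longlonglongrightarrow> X ^ (2 * e) * robinson y z X"
      by (rule Lim_transform_eventually[OF robinson_limit[OF e]])
         (use ND in \<open>auto intro!: eventually_sequentiallyI[of "e + 3"]\<close>)
  next
    show "robinson 0 0 1 \<noteq> 0" by (simp add: robinson_def)
  qed (fact B, fact robinson_zero)
qed

section \<open>Degrees two to eight\<close>

text \<open>The bound on the parts makes a recursion on the largest part possible, which lists the
  even partitions of 2, 4, 6 and 8.\<close>

definition bounded_partitions :: "nat \<Rightarrow> nat \<Rightarrow> nat multiset set" where
  "bounded_partitions k m = {\<mu>. (\<forall>r \<in># \<mu>. 0 < r \<and> even r \<and> r \<le> m) \<and> \<Sum>\<^sub># \<mu> = k}"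

lemma even_partitions_eq_bounded: "even_partitions k = bounded_partitions k k"
proof -
  have "r \<le> \<Sum>\<^sub># \<mu>" if "r \<in># \<mu>" for r and \<mu> :: "nat multiset"
    using that by (auto dest!: multi_member_split)
  then show ?thesis by (auto simp: even_partitions_def bounded_partitions_def)
qed

lemma bounded_partitions_0: "bounded_partitions k 0 = (if k = 0 then {{#}} else {})"
proof -
  have "\<mu> \<in> bounded_partitions k 0 \<longleftrightarrow> \<mu> = {#} \<and> k = 0" for \<mu>
    by (cases \<mu>) (auto simp: bounded_partitions_def)
  then show ?thesis by auto
qed

lemma bounded_partitions_rec:
  assumes "even m" "m \<noteq> 0"
  shows "bounded_partitions k m = bounded_partitions k (m - 2)
    \<union> (if m \<le> k then add_mset m ` bounded_partitions (k - m) m else {})"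
proof (intro equalityI subsetI)
  fix \<mu> assume \<mu>: "\<mu> \<in> bounded_partitions k m"
  show "\<mu> \<in> bounded_partitions k (m - 2) \<union> (if m \<le> k then add_mset m ` bounded_partitions (k - m) m else {})"
  proof (cases "m \<in># \<mu>")
    case True
    then obtain \<nu> where "\<mu> = add_mset m \<nu>" by (metis multi_member_split)
    with \<mu> show ?thesis by (auto simp: bounded_partitions_def)
  next
    case False
    have "r \<le> m - 2" if "r \<in># \<mu>" for r
    proof -
      have "r \<le> m" "even r" "r \<noteq> m" using \<mu> that False by (auto simp: bounded_partitions_def)
      then show ?thesis using assms by presburger
    qed
    with \<mu> show ?thesis by (auto simp: bounded_partitions_def)
  qed
next
  fix \<mu> assume "\<mu> \<in> bounded_partitions k (m - 2) \<union> (if m \<le> k then add_mset m ` bounded_partitions (k - m) m else {})"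
  then show "\<mu> \<in> bounded_partitions k m"
    using assms by (fastforce simp: bounded_partitions_def split: if_splits)
qed

lemma sum_even_partitions_2: "(\<Sum>\<mu>\<in>even_partitions 2. f \<mu>) = f {#2#}"
  by (simp add: even_partitions_eq_bounded bounded_partitions_rec bounded_partitions_0)

lemma sum_even_partitions_4: "(\<Sum>\<mu>\<in>even_partitions 4. f \<mu>) = f {#4#} + f {#2, 2#}" for f :: "_ \<Rightarrow> 'a :: comm_monoid_add"
  by (simp add: even_partitions_eq_bounded bounded_partitions_rec bounded_partitions_0 add_ac)

lemma sum_even_partitions_6: "(\<Sum>\<mu>\<in>even_partitions 6. f \<mu>) = f {#6#} + f {#4, 2#} + f {#2, 2, 2#}"
  for f :: "_ \<Rightarrow> 'a :: comm_monoid_add"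
  by (simp add: even_partitions_eq_bounded bounded_partitions_rec bounded_partitions_0 add_ac)

lemma sum_even_partitions_8:
  "(\<Sum>\<mu>\<in>even_partitions 8. f \<mu>) = f {#8#} + f {#6, 2#} + f {#4, 4#} + f {#4, 2, 2#} + f {#2, 2, 2, 2#}"
  for f :: "_ \<Rightarrow> 'a :: comm_monoid_add"
proof -
  have "{#6, 2#} \<noteq> {#4, 4 :: nat#}" "{#6, 2#} \<noteq> {#4, 2, 2 :: nat#}" "{#6, 2#} \<noteq> {#2, 2, 2, 2 :: nat#}"
    "{#4, 4#} \<noteq> {#4, 2, 2 :: nat#}" "{#4, 4#} \<noteq> {#2, 2, 2, 2 :: nat#}" "{#4, 2, 2#} \<noteq> {#2, 2, 2, 2 :: nat#}"
    by (auto dest!: arg_cong[where f = "\<lambda>M. (count M 6, count M (4 :: nat))"])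
  then show ?thesis
    by (simp add: even_partitions_eq_bounded bounded_partitions_rec bounded_partitions_0 add_ac)
qed

section \<open>Nonnegativity on measures with two atoms\<close>

lemma tendsto_prod_mset:
  fixes g :: "'i \<Rightarrow> 'b \<Rightarrow> real"
  assumes "\<And>r. ((\<lambda>k. g r k) \<longlongrightarrow> l r) F"
  shows "((\<lambda>k. \<Prod>r\<in>#\<mu>. g r k) \<longlongrightarrow> (\<Prod>r\<in>#\<mu>. l r)) F"
  by (induction \<mu>) (auto intro!: tendsto_mult assms)

lemma tendsto_floor_ratio:
  assumes "0 \<le> p"
  shows "(\<lambda>N. real (nat \<lfloor>p * real N\<rfloor>) / real N) \<longlonglongrightarrow> p"
proof (rule tendsto_sandwich)
  show "(\<lambda>N. p - 1 / real N) \<longlonglongrightarrow> p"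
    using tendsto_diff[OF tendsto_const lim_1_over_n, of p] by simp
  show "\<forall>\<^sub>F N in sequentially. p - 1 / real N \<le> real (nat \<lfloor>p * real N\<rfloor>) / real N"
    using eventually_gt_at_top[of 0]
  proof eventually_elim
    case (elim N)
    have "p * real N - 1 \<le> real (nat \<lfloor>p * real N\<rfloor>)"
      using assms by (simp add: of_nat_nat)
    then have "(p * real N - 1) / real N \<le> real (nat \<lfloor>p * real N\<rfloor>) / real N"
      by (rule divide_right_mono) simp
    then show ?case using elim by (simp add: diff_divide_distrib)
  qed
  show "\<forall>\<^sub>F N in sequentially. real (nat \<lfloor>p * real N\<rfloor>) / real N \<le> p"
    using eventually_gt_at_top[of 0]
  proof eventually_elim
    case (elim N)
    have "real (nat \<lfloor>p * real N\<rfloor>) \<le> p * real N"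
      using assms by (simp add: of_nat_nat)
    then show ?case using elim by (simp add: field_simps)
  qed
qed simp

text \<open>Membership in the cone covers all large numbers \<open>N\<close> of variables, so real
  weights arise as limits of weights \<open>t / N\<close>. The atoms are squares of variables, hence
  the halved exponents.\<close>

lemma PSD_two_atoms:
  assumes c: "c \<in> even_PSD_cone k" and p: "0 \<le> p" "p \<le> 1" and ab: "0 \<le> a" "0 \<le> b"
  shows "0 \<le> (\<Sum>\<mu>\<in>even_partitions k. c \<mu> * (\<Prod>r\<in>#\<mu>. p * a ^ (r div 2) + (1 - p) * b ^ (r div 2)))"
proof (rule tendsto_lowerbound)
  define t where "t N = nat \<lfloor>p * real N\<rfloor>" for N
  define q where "q r N = real (t N) / real N * a ^ (r div 2) + (1 - real (t N) / real N) * b ^ (r div 2)" for r N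
  have "(\<lambda>N. real (t N) / real N) \<longlonglongrightarrow> p"
    unfolding t_def by (rule tendsto_floor_ratio) (fact p)
  then have "(\<lambda>N. q r N) \<longlonglongrightarrow> p * a ^ (r div 2) + (1 - p) * b ^ (r div 2)" for r
    unfolding q_def by (intro tendsto_add tendsto_mult tendsto_diff tendsto_const)
  then show "(\<lambda>N. \<Sum>\<mu>\<in>even_partitions k. c \<mu> * (\<Prod>r\<in>#\<mu>. q r N))
    \<longlonglongrightarrow> (\<Sum>\<mu>\<in>even_partitions k. c \<mu> * (\<Prod>r\<in>#\<mu>. p * a ^ (r div 2) + (1 - p) * b ^ (r div 2)))"
    by (intro tendsto_sum tendsto_mult tendsto_const tendsto_prod_mset)
  \<comment> \<open>The bound \<open>k + 1\<close> keeps \<open>N\<close> positive even for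
    \<open>k = 0\<close>. The third block used below is empty.\<close>
  have "0 \<le> (\<Sum>\<mu>\<in>even_partitions k. c \<mu> * (\<Prod>r\<in>#\<mu>. q r N))" if N: "k + 1 \<le> N" for N
  proof -
    have "real (t N) \<le> p * real N" using p by (simp add: t_def of_nat_nat)
    also have "\<dots> \<le> real N" using p by (simp add: mult_left_le_one_le)
    finally have t: "t N \<le> N" by simp
    define x where "x = blocks (t N) (N - t N) (sqrt a) (sqrt b) 0"
    have moment: "moment N (restrict x {1..N}) r = q r N" if "even r" for r
    proof -
      obtain s where r: "r = 2 * s" using \<open>even r\<close> by (rule evenE)
      have "moment N (restrict x {1..N}) r = moment (t N + (N - t N) + 0) x r"
        using t by (simp add: moment_def)
      also have "\<dots> = q r N"
      proof -
        have "sqrt a ^ (2 * s) = a ^ s" "sqrt b ^ (2 * s) = b ^ s"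
          using ab by (simp_all only: power_mult real_sqrt_pow2)
        then show ?thesis
          unfolding x_def moment_blocks using t N
          by (simp add: r q_def of_nat_diff diff_divide_distrib add_divide_distrib algebra_simps)
      qed
      finally show ?thesis .
    qed
    have "nonnegative N (power_mean_form k N c)"
      using c N by (simp add: even_PSD_cone_def)
    moreover have "restrict x {1..N} \<in> {1..N} \<rightarrow>\<^sub>E UNIV" by simp
    ultimately have "0 \<le> mpoly_eval (restrict x {1..N}) (power_mean_form k N c)"
      unfolding nonnegative_def by blast
    also have "\<dots> = (\<Sum>\<mu>\<in>even_partitions k. c \<mu> * (\<Prod>r\<in>#\<mu>. q r N))"
      unfolding mpoly_eval_power_mean_form
      by (intro sum.cong refl arg_cong2[where f = "(*)"] arg_cong[where f = prod_mset] image_mset_cong)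
         (auto simp: even_partitions_def moment[unfolded One_nat_def])
    finally show ?thesis .
  qed
  then show "\<forall>\<^sub>F N in sequentially. 0 \<le> (\<Sum>\<mu>\<in>even_partitions k. c \<mu> * (\<Prod>r\<in>#\<mu>. q r N))"
    by (rule eventually_sequentiallyI)
qed simp

text \<open>The atoms are the roots of x^2 - w x + (w - 1 - u), so the moments obey the recurrence
  \<open>Mrec\<close>. Thus \<open>w\<close> is the sum of the atoms, and
  \<open>1 + u \<le> w\<close> says that their product is nonnegative.\<close>

lemma two_atoms_with_moments:
  fixes u w :: real
  assumes u: "0 < u" and w: "1 + u \<le> w"
  obtains p a b where "0 \<le> p" "p \<le> 1" "0 \<le> a" "0 \<le> b" "p * a + (1 - p) * b = 1"
    "p * a ^ 2 + (1 - p) * b ^ 2 = 1 + u" "p * a ^ 3 + (1 - p) * b ^ 3 = 1 + u + w * u"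
    "p * a ^ 4 + (1 - p) * b ^ 4 = (1 + u)\<^sup>2 + w\<^sup>2 * u"
proof -
  define s where "s = sqrt ((w - 2)\<^sup>2 + 4 * u)"
  define a where "a = (w + s) / 2"
  define b where "b = (w - s) / 2"
  define p where "p = (1 - b) / s"
  have s2: "s\<^sup>2 = (w - 2)\<^sup>2 + 4 * u" using u by (simp add: s_def)
  have s: "0 < s" using u by (simp add: s_def add_nonneg_pos)
  \<comment> \<open>This places the mean 1 between \<open>b\<close> and \<open>a\<close>, so that
    \<open>p\<close> is a weight.\<close>
  have sw: "\<bar>w - 2\<bar> \<le> s" using u by (simp add: s_def real_le_rsqrt)
  have "s\<^sup>2 \<le> w\<^sup>2" using w unfolding s2 by (simp add: power2_eq_square algebra_simps)
  then have "s \<le> w" using u w by (simp add: power2_le_iff_abs_le)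
  then have b: "0 \<le> b" by (simp add: b_def)
  have a: "0 \<le> a" using s u w by (simp add: a_def)
  have "0 \<le> p" "p \<le> 1" using s sw by (auto simp: p_def b_def field_simps)
  have ps: "p * s = 1 - b" using s by (simp add: p_def)
  have ab: "a = b + s" by (simp add: a_def b_def field_simps)
  have rec: "a ^ 2 = w * a - (w - 1 - u)" "b ^ 2 = w * b - (w - 1 - u)"
    using s2 unfolding a_def b_def by (simp_all add: power2_eq_square field_simps)
  define M where "M r = p * a ^ r + (1 - p) * b ^ r" for r
  have M0: "M 0 = 1" by (simp add: M_def)
  have M1: "M 1 = 1" using ps by (simp add: M_def ab algebra_simps)
  have Mrec: "M (r + 2) = w * M (r + 1) - (w - 1 - u) * M r" for r
    unfolding M_def power_add rec by (simp add: algebra_simps)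
  have M2: "M 2 = 1 + u" using Mrec[of 0] M0 M1 by (simp add: numeral_2_eq_2)
  have M3: "M 3 = 1 + u + w * u" using Mrec[of 1] M1 M2 by (simp add: numeral_2_eq_2 numeral_3_eq_3 algebra_simps)
  have M4: "M 4 = (1 + u)\<^sup>2 + w\<^sup>2 * u"
    using Mrec[of 2] M2 M3 by (simp add: eval_nat_numeral algebra_simps)
  show ?thesis
    by (rule that[of p a b]) (use \<open>0 \<le> p\<close> \<open>p \<le> 1\<close> a b M1 M2 M3 M4 in \<open>simp_all add: M_def\<close>)
qed


section \<open>Certificates for nonnegative functions of the second and third moment\<close>

lemma quadratic_lower_growth:
  fixes A B C L :: real
  assumes "\<And>x. L \<le> x \<Longrightarrow> 0 \<le> A * x\<^sup>2 + B * x + C"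
  shows "0 \<le> A"
proof (rule ccontr)
  assume "\<not> 0 \<le> A"
  then have A: "A < 0" by simp
  define x where "x = max (max 1 L) ((\<bar>B\<bar> + \<bar>C\<bar> + 1) / (- A))"
  have x: "1 \<le> x" "L \<le> x" "(\<bar>B\<bar> + \<bar>C\<bar> + 1) / (- A) \<le> x" by (auto simp: x_def)
  then have "\<bar>B\<bar> + \<bar>C\<bar> + 1 \<le> - A * x" using A by (simp add: field_simps)
  then have "(\<bar>B\<bar> + \<bar>C\<bar> + 1) * x \<le> - A * x * x" using x by (intro mult_right_mono) auto
  moreover have "B * x \<le> \<bar>B\<bar> * x" using x by (intro mult_right_mono) auto
  moreover have "\<bar>C\<bar> * 1 \<le> \<bar>C\<bar> * x" using x by (intro mult_left_mono) auto
  ultimately have "A * x * x + B * x + C \<le> - x"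
    using abs_ge_self[of C] unfolding distrib_right by linarith
  then have "A * x\<^sup>2 + B * x + C \<le> - x"
    by (simp add: power2_eq_square mult.assoc)
  with assms[OF x(2)] x show False by linarith
qed

lemma linear_lower_growth:
  fixes B C L :: real
  assumes "\<And>x. L \<le> x \<Longrightarrow> 0 \<le> B * x + C"
  shows "0 \<le> B"
proof (rule quadratic_lower_growth)
  fix x assume x: "max L 1 \<le> x"
  then have "0 \<le> (B * x + C) * x" using assms[of x] by (intro mult_nonneg_nonneg) auto
  then show "0 \<le> B * x\<^sup>2 + C * x + 0" by (simp add: power2_eq_square algebra_simps)
qed

text \<open>The quadratic is \<epsilon> + \<alpha> u + g (u - t)^2, a shape that survives replacing
  u by a variance. For \<open>0 \<le> q1\<close> take \<open>t = 0\<close>, otherwise complete the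
  square at the minimum.\<close>

lemma quadratic_nonneg_on_half_line:
  fixes q0 q1 q2 :: real
  assumes nonneg: "\<And>u. 0 \<le> u \<Longrightarrow> 0 \<le> q2 * u\<^sup>2 + q1 * u + q0"
  obtains \<epsilon> \<alpha> g t where "0 \<le> \<epsilon>" "0 \<le> \<alpha>" "0 \<le> g" "q2 = g" "q1 = \<alpha> - 2 * g * t" "q0 = \<epsilon> + g * t\<^sup>2"
proof (cases "0 \<le> q1")
  case True
  show ?thesis
    by (rule that[of q0 q1 q2 0]) (use nonneg[of 0] quadratic_lower_growth[of 0, OF nonneg] True in auto)
next
  case False
  have "q2 \<noteq> 0"
  proof
    assume "q2 = 0"
    then have "0 \<le> q1" using nonneg by (intro linear_lower_growth[of 0 q1 q0]) simp
    then show False using False by simp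
  qed
  then have "0 < q2" using quadratic_lower_growth[of 0, OF nonneg] by simp
  then have "0 \<le> q2 * (- q1 / (2 * q2))\<^sup>2 + q1 * (- q1 / (2 * q2)) + q0"
    using False by (intro nonneg) (simp add: divide_nonpos_pos)
  then have "0 \<le> q0 - q2 * (- q1 / (2 * q2))\<^sup>2"
    using \<open>0 < q2\<close> by (simp add: power2_eq_square field_simps)
  then show ?thesis
    by (intro that[of "q0 - q2 * (- q1 / (2 * q2))\<^sup>2" 0 q2 "- q1 / (2 * q2)"]) (use \<open>0 < q2\<close> in \<open>simp_all add: field_simps\<close>)
qed

text \<open>First-order condition at a minimum, without derivatives: for small \<open>h\<close> of
  sign opposite to \<alpha> the linear term dominates.\<close>

lemma linear_term_zero:
  fixes \<alpha> K \<delta> :: real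
  assumes "0 < \<delta>" and nonneg: "\<And>h. \<bar>h\<bar> \<le> \<delta> \<Longrightarrow> 0 \<le> \<alpha> * h + K * h\<^sup>2"
  shows "\<alpha> = 0"
proof (rule ccontr)
  assume \<alpha>: "\<alpha> \<noteq> 0"
  define m where "m = min \<delta> (\<bar>\<alpha>\<bar> / (2 * (\<bar>K\<bar> + 1)))"
  define h where "h = - sgn \<alpha> * m"
  have m: "0 < m" "m \<le> \<delta>" "m \<le> \<bar>\<alpha>\<bar> / (2 * (\<bar>K\<bar> + 1))" using assms(1) \<alpha> by (auto simp: m_def)
  have "\<bar>h\<bar> \<le> \<delta>" using m \<alpha> by (simp add: h_def abs_mult)
  then have "0 \<le> \<alpha> * h + K * h\<^sup>2" by (rule nonneg)
  also have "\<alpha> * h = - \<bar>\<alpha>\<bar> * m" by (simp add: h_def abs_sgn mult_ac)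
  also have "h\<^sup>2 = m\<^sup>2" using \<alpha> by (simp add: h_def power_mult_distrib sgn_if)
  finally have "\<bar>\<alpha>\<bar> * m \<le> K * m * m" by (simp add: power2_eq_square)
  then have "\<bar>\<alpha>\<bar> \<le> K * m" using m by simp
  also have "\<dots> \<le> (\<bar>K\<bar> + 1) * m" using m by (intro mult_right_mono) auto
  also have "\<dots> \<le> \<bar>\<alpha>\<bar> / 2" using m by (simp add: field_simps)
  finally show False using \<alpha> by simp
qed

text \<open>The minimum over \<open>w \<ge> 1 + u\<close> of the quartic is \<open>M u\<close>. The certificate is taken at a minimum point
  of \<open>M\<close>, where the candidate remainder has a double zero after subtracting the minimum.\<close>

lemma quartic_certificate:
  fixes A B q0 q1 q2 :: real
  assumes nonneg: "\<And>u w. 0 \<le> u \<Longrightarrow> 1 + u \<le> w \<Longrightarrow> 0 \<le> A * w\<^sup>2 * u + B * w * u + (q2 * u\<^sup>2 + q1 * u + q0)"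
  obtains \<theta> where "0 \<le> A" "0 \<le> B + 2 * A * \<theta>"
    "\<And>u. 0 \<le> u \<Longrightarrow> 0 \<le> q2 * u\<^sup>2 + q1 * u + q0 - A * \<theta>\<^sup>2 * u + (B + 2 * A * \<theta>) * u * (1 + u)"
proof -
  note goal = that
  have "0 \<le> A"
    by (rule quadratic_lower_growth[of 2 A B "q2 + q1 + q0"]) (use nonneg[of 1] in simp)
  show ?thesis
  proof (cases "A = 0")
    case True
    have "0 \<le> B"
      by (rule linear_lower_growth[of 2 B "q2 + q1 + q0"]) (use nonneg[of 1] True in simp)
    moreover have "0 \<le> q2 * u\<^sup>2 + q1 * u + q0 + B * u * (1 + u)" if "0 \<le> u" for u
      using nonneg[OF that, of "1 + u"] True by (simp add: algebra_simps)
    ultimately show ?thesis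
      using True by (intro goal[of 0]) simp_all
  next
    case False
    with \<open>0 \<le> A\<close> have A: "0 < A" by simp
    \<comment> \<open>The quadratic in \<open>w\<close> has its vertex at \<open>1 + u1\<close>. For
      \<open>u \<ge> u1\<close> the constraint \<open>1 + u \<le> w\<close> is active, which
      explains the maximum in \<open>N\<close>.\<close>
    define u1 where "u1 = - B / (2 * A) - 1"
    have B: "B = - 2 * A * (1 + u1)" using A by (simp add: u1_def field_simps)
    define c1 where "c1 = q1 - A * (1 + u1)\<^sup>2"
    define N where "N u = c1 + q2 * u + A * (max (u - u1) 0)\<^sup>2" for u
    define M where "M u = q0 + u * N u" for u
    \<comment> \<open>The remainder in the conclusion for \<open>\<theta> = 1 + t\<close>. For
      \<open>u \<ge> u1\<close> it lies below \<open>M\<close> and touches it at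
      \<open>u = t\<close>, so \<open>t\<close> has to be chosen with care.\<close>
    define r where "r t u = q0 + u * (c1 + q2 * u + A * (t - u1) * (2 * u - u1 - t))" for t u
    have M_nonneg: "0 \<le> M u" if "0 \<le> u" for u
    proof (cases "u1 \<le> u")
      case True
      have "M u = A * (1 + u)\<^sup>2 * u + B * (1 + u) * u + (q2 * u\<^sup>2 + q1 * u + q0)"
        using True by (simp add: M_def N_def c1_def B power2_eq_square algebra_simps)
      then show ?thesis using nonneg[OF that, of "1 + u"] by simp
    next
      case False
      have "M u = A * (1 + u1)\<^sup>2 * u + B * (1 + u1) * u + (q2 * u\<^sup>2 + q1 * u + q0)"
        using False by (simp add: M_def N_def c1_def B power2_eq_square algebra_simps)
      then show ?thesis using nonneg[OF that, of "1 + u1"] False by simp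
    qed
    have r_high: "r t u = M u - A * u * (u - t)\<^sup>2" if "u1 \<le> u" for t u
      using that by (simp add: r_def M_def N_def power2_eq_square algebra_simps)
    have r_low: "r u1 u = M u" if "u \<le> u1" for u
      using that by (simp add: r_def M_def N_def)
    have suffices: thesis if t: "u1 \<le> t" and r: "\<And>u. 0 \<le> u \<Longrightarrow> 0 \<le> r t u" for t
    proof (rule goal[of "1 + t"])
      show "0 \<le> A" by fact
      have *: "B + 2 * A * (1 + t) = 2 * A * (t - u1)" by (simp add: B algebra_simps)
      then show "0 \<le> B + 2 * A * (1 + t)" using A t by simp
      fix u :: real assume "0 \<le> u"
      moreover have "q2 * u\<^sup>2 + q1 * u + q0 - A * (1 + t)\<^sup>2 * u + (B + 2 * A * (1 + t)) * u * (1 + u) = r t u"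
        unfolding * by (simp add: r_def c1_def power2_eq_square algebra_simps)
      ultimately show "0 \<le> q2 * u\<^sup>2 + q1 * u + q0 - A * (1 + t)\<^sup>2 * u + (B + 2 * A * (1 + t)) * u * (1 + u)"
        using r by simp
    qed
    obtain us where us: "0 \<le> us" "\<And>u. 0 \<le> u \<Longrightarrow> M us \<le> M u"
    proof -
      define b where "b = q2 - 2 * A * u1"
      define c where "c = c1 + A * u1\<^sup>2"
      \<comment> \<open>Beyond \<open>L\<close> the factor \<open>N u\<close> is nonnegative, hence
        \<open>M u\<close> is at least \<open>M 0\<close> and the minimum over a compact interval is
        global.\<close>
      define L where "L = max (max 1 u1) ((\<bar>b\<bar> + \<bar>c\<bar>) / A)"
      have "continuous_on {0..L} M"
        unfolding M_def N_def by (intro continuous_intros)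
      moreover have "0 \<le> L" by (simp add: L_def)
      ultimately obtain us where us: "us \<in> {0..L}" "\<forall>u\<in>{0..L}. M us \<le> M u"
        using continuous_attains_inf[of "{0..L}" M] by (auto simp: compact_Icc)
      have "M us \<le> M u" if u: "0 \<le> u" for u
      proof (cases "u \<le> L")
        case False
        then have L: "1 \<le> u" "u1 \<le> u" "(\<bar>b\<bar> + \<bar>c\<bar>) / A \<le> u" by (auto simp: L_def)
        then have "\<bar>b\<bar> + \<bar>c\<bar> \<le> A * u" using A by (simp add: field_simps)
        then have "(\<bar>b\<bar> + \<bar>c\<bar>) * u \<le> A * u * u" using u by (intro mult_right_mono) auto
        moreover have "\<bar>c\<bar> * 1 \<le> \<bar>c\<bar> * u" using L by (intro mult_left_mono) auto
        moreover have "- (b * u) \<le> \<bar>b\<bar> * u"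
          using u by (metis abs_ge_minus_self mult_minus_left mult_right_mono)
        ultimately have "0 \<le> A * u * u + b * u + c"
          using abs_ge_minus_self[of c] unfolding distrib_right by linarith
        also have "\<dots> = N u"
          using L by (simp add: N_def b_def c_def power2_eq_square algebra_simps)
        finally have "M 0 \<le> M u" using u by (simp add: M_def)
        moreover have "M us \<le> M 0" using us \<open>0 \<le> L\<close> by simp
        ultimately show ?thesis by simp
      qed (use us u in auto)
      then show ?thesis using us that by auto
    qed
    show ?thesis
    proof (cases "us = 0")
      case True
      have N: "0 \<le> N u" if "0 < u" for u
        using us(2)[of u] that True by (simp add: M_def zero_le_mult_iff)
      have N0: "0 \<le> N 0"
      proof (rule tendsto_lowerbound)
        have "isCont N 0" unfolding N_def by (intro continuous_intros)
        then show "(N \<longlongrightarrow> N 0) (at_right 0)"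
          by (simp add: isCont_def filterlim_at_split)
        show "\<forall>\<^sub>F u in at_right 0. 0 \<le> N u"
          using eventually_at_right_less[of 0] by eventually_elim (rule N)
      qed simp
      \<comment> \<open>The remainder is \<open>q0\<close> plus \<open>u\<close> times an affine
        function. The least \<open>t\<close> above \<open>max u1 0\<close> with nonnegative slope is
        taken; the constant term of that function is then \<open>N 0\<close> or, if the slope
        vanishes, \<open>N t\<close>.\<close>
      define t where "t = max (max u1 0) (u1 - q2 / (2 * A))"
      have slope: "0 \<le> q2 + 2 * A * (t - u1)"
      proof -
        have "u1 - q2 / (2 * A) \<le> t" by (simp add: t_def)
        then show ?thesis using A by (simp add: field_simps)
      qed
      have const: "0 \<le> c1 - A * (t - u1) * (t + u1)"
      proof (cases "u1 - q2 / (2 * A) \<le> max u1 0")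
        case True
        then have "t = max u1 0" by (simp add: t_def)
        then show ?thesis using N0
          by (cases "0 \<le> u1") (auto simp: N_def power2_eq_square)
      next
        case False
        then have t: "t = u1 - q2 / (2 * A)" "0 < t" "u1 < t" by (auto simp: t_def)
        then have q2: "q2 = - 2 * A * (t - u1)" using A by (simp add: field_simps)
        have "N t = c1 + q2 * t + A * (t - u1)\<^sup>2" using t(3) by (simp add: N_def)
        also have "\<dots> = c1 - A * (t - u1) * (t + u1)"
          by (subst q2) (simp add: power2_eq_square algebra_simps)
        finally show ?thesis using N[OF t(2)] by simp
      qed
      show ?thesis
      proof (rule suffices[of t])
        show "u1 \<le> t" by (simp add: t_def)
        fix u :: real assume u: "0 \<le> u"
        have "r t u = q0 + u * ((c1 - A * (t - u1) * (t + u1)) + (q2 + 2 * A * (t - u1)) * u)"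
          by (simp add: r_def algebra_simps)
        moreover have "0 \<le> q0" using M_nonneg[of 0] by (simp add: M_def)
        ultimately show "0 \<le> r t u" using slope const u by simp
      qed
    next
      case False
      with us have us0: "0 < us" by simp
      \<comment> \<open>Now \<open>r t\<close> equals \<open>M\<close> at \<open>us\<close> and near
        \<open>us\<close> falls below \<open>M\<close> by a second-order term at most, so
        \<open>us\<close> is a critical point of \<open>r t\<close>.\<close>
      define t where "t = max us u1"
      define R2 where "R2 = q2 + 2 * A * (t - u1)"
      define R1 where "R1 = c1 - A * (t - u1) * (t + u1)"
      have r_eq: "r t u = R2 * u\<^sup>2 + R1 * u + q0" for u
        by (simp add: r_def R2_def R1_def power2_eq_square algebra_simps)
      have r_us: "r t us = M us"
        using r_high[of us t] r_low[of us] by (cases "u1 \<le> us") (auto simp: t_def max_def)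
      define \<alpha> where "\<alpha> = R1 + 2 * R2 * us"
      have taylor: "r t (us + h) = M us + \<alpha> * h + R2 * h\<^sup>2" for h
        unfolding r_us[symmetric] r_eq \<alpha>_def by (simp add: power2_eq_square algebra_simps)
      have lower: "M u - A * u * (u - us)\<^sup>2 \<le> r t u" if u: "0 \<le> u" "u1 < us \<Longrightarrow> u1 \<le> u" for u
      proof (cases "u1 < us")
        case True
        then show ?thesis using u r_high[of u t] by (simp add: t_def max_def)
      next
        case False
        then have t: "t = u1" by (simp add: t_def)
        show ?thesis
        proof (cases "u \<le> u1")
          case True
          then show ?thesis using r_low[OF True] A u by (simp add: t)
        next
          case u': False
          have "(u - u1)\<^sup>2 \<le> (u - us)\<^sup>2" using u' False by (intro power_mono) auto
          then have "A * u * (u - u1)\<^sup>2 \<le> A * u * (u - us)\<^sup>2" using A u by (intro mult_left_mono) auto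
          then show ?thesis using r_high[of u t] u' by (simp add: t)
        qed
      qed
      have "\<alpha> = 0"
      proof -
        define \<delta> where "\<delta> = (if u1 < us then min us (us - u1) else us)"
        show ?thesis
        proof (rule linear_term_zero[of \<delta> \<alpha> "R2 + 2 * A * us"])
          show "0 < \<delta>" using us0 by (simp add: \<delta>_def)
          fix h assume h: "\<bar>h\<bar> \<le> \<delta>"
          define u where "u = us + h"
          have u: "0 \<le> u" "u \<le> 2 * us" "u1 < us \<Longrightarrow> u1 \<le> u"
            using h us0 by (auto simp: \<delta>_def u_def split: if_splits)
          have "M us - A * u * h\<^sup>2 \<le> M u - A * u * h\<^sup>2" using us(2)[OF u(1)] by simp
          also have "\<dots> \<le> r t u" using lower[OF u(1,3)] by (simp add: u_def)
          also have "\<dots> = M us + \<alpha> * h + R2 * h\<^sup>2" by (simp add: u_def taylor)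
          finally have "0 \<le> \<alpha> * h + R2 * h\<^sup>2 + A * u * h\<^sup>2" by simp
          also have "A * u * h\<^sup>2 \<le> A * (2 * us) * h\<^sup>2"
            using A u by (intro mult_right_mono mult_left_mono) auto
          finally show "0 \<le> \<alpha> * h + (R2 + 2 * A * us) * h\<^sup>2" by (simp add: algebra_simps)
        qed
      qed
      with taylor have r_R2: "r t u = M us + R2 * (u - us)\<^sup>2" for u
        using taylor[of "u - us"] by simp
      have "M us \<le> M 0" using us by simp
      \<comment> \<open>The value of \<open>r t\<close> at 0 is \<open>M 0\<close>, at least its
        value at the critical point \<open>us\<close>, so the quadratic cannot open
        downward.\<close>
      then have "0 \<le> R2 * us\<^sup>2" using r_R2[of 0] by (simp add: r_def M_def)
      then have "0 \<le> R2" using us0 by (simp add: zero_le_mult_iff)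
      show ?thesis
      proof (rule suffices[of t])
        show "u1 \<le> t" by (simp add: t_def)
        fix u :: real assume "0 \<le> u"
        show "0 \<le> r t u"
          unfolding r_R2 using \<open>0 \<le> R2\<close> M_nonneg[OF us(1)] by simp
      qed
    qed
  qed
qed

section \<open>Explicit sums of squares\<close>

lemma mpoly_const_0 [simp]: "mpoly_const 0 = 0"
  by (simp add: mpoly_const_def)

lemma mpoly_const_1 [simp]: "mpoly_const 1 = 1"
  by (simp add: mpoly_const_def)

lemma mpoly_const_add: "mpoly_const (a + b) = mpoly_const a + mpoly_const b"
  by (simp add: mpoly_const_def single_add)

lemma mpoly_const_mult: "mpoly_const (a * b) = mpoly_const a * mpoly_const b"
  by (simp add: mpoly_const_def mult_single)

lemma mpoly_const_uminus: "mpoly_const (- a) = - mpoly_const a"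
  by (simp add: mpoly_const_def single_uminus)

lemma mpoly_const_diff: "mpoly_const (a - b) = mpoly_const a - mpoly_const b"
  using mpoly_const_add[of a "- b"] by (simp add: mpoly_const_uminus)

lemma mpoly_const_power: "mpoly_const (a ^ k) = mpoly_const a ^ k"
  by (induction k) (simp_all add: mpoly_const_mult)

lemma mpoly_const_numeral: "mpoly_const (numeral k) = numeral k"
  by (induction k) (simp_all only: numeral.simps mpoly_const_1 mpoly_const_add)

lemmas mpoly_const_hom = mpoly_const_add mpoly_const_mult mpoly_const_uminus mpoly_const_diff
  mpoly_const_power mpoly_const_numeral

lemma mpolys_const: "mpoly_const a \<in> mpolys n"
  by (simp add: mpolys_def mpoly_const_def)

lemma mpolys_var: "1 \<le> i \<Longrightarrow> i \<le> n \<Longrightarrow> mpoly_var i \<in> mpolys n"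
  by (simp add: mpolys_def mpoly_var_def)

lemma mpolys_add: "f \<in> mpolys n \<Longrightarrow> g \<in> mpolys n \<Longrightarrow> f + g \<in> mpolys n"
  using keys_add[of f g] by (fastforce simp: mpolys_def)

lemma mpolys_diff: "f \<in> mpolys n \<Longrightarrow> g \<in> mpolys n \<Longrightarrow> f - g \<in> mpolys n"
  using keys_diff[of f g] by (fastforce simp: mpolys_def)

lemma mpolys_mult:
  assumes "f \<in> mpolys n" "g \<in> mpolys n"
  shows "f * g \<in> mpolys n"
  unfolding mpolys_def
proof (intro CollectI ballI)
  fix m assume "m \<in> Poly_Mapping.keys (f * g)"
  then obtain a b where "m = a + b" "a \<in> Poly_Mapping.keys f" "b \<in> Poly_Mapping.keys g"
    using keys_mult[of f g] by blast
  then show "Poly_Mapping.keys m \<subseteq> {1..n}"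
    using assms keys_add[of a b] by (auto simp: mpolys_def dest!: bspec)
qed

lemma mpolys_power: "f \<in> mpolys n \<Longrightarrow> f ^ k \<in> mpolys n"
  by (induction k) (use mpolys_const[of 1] in \<open>simp_all add: mpolys_mult\<close>)

lemma mpolys_sum: "(\<And>i. i \<in> A \<Longrightarrow> f i \<in> mpolys n) \<Longrightarrow> sum f A \<in> mpolys n"
  by (induction A rule: infinite_finite_induct) (use mpolys_const[of 0] in \<open>simp_all add: mpolys_add\<close>)

lemma mpolys_power_mean: "power_mean n r \<in> mpolys n"
  unfolding power_mean_def by (intro mpolys_mult mpolys_const mpolys_sum mpolys_power mpolys_var) auto

lemmas mpolys_intros = mpolys_const mpolys_var mpolys_add mpolys_diff mpolys_mult mpolys_power mpolys_power_mean

lemma sos_square: "g \<in> mpolys n \<Longrightarrow> sum_of_squares n (g\<^sup>2)"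
  unfolding sum_of_squares_def by (intro exI[of _ "[g]"]) simp

lemma sos_add: "sum_of_squares n f \<Longrightarrow> sum_of_squares n g \<Longrightarrow> sum_of_squares n (f + g)"
  unfolding sum_of_squares_def by (elim exE conjE, rule_tac x = "gs @ gsa" in exI) simp

lemma sos_sum: "(\<And>i. i \<in> A \<Longrightarrow> sum_of_squares n (f i)) \<Longrightarrow> sum_of_squares n (sum f A)"
proof (induction A rule: infinite_finite_induct)
  case empty
  show ?case by (simp add: sum_of_squares_def exI[of _ "[]"])
next
  case (infinite A)
  show ?case by (simp add: infinite sum_of_squares_def exI[of _ "[]"])
qed (simp add: sos_add)

lemma sos_mult_square:
  assumes "sum_of_squares n f" "g \<in> mpolys n"
  shows "sum_of_squares n (g\<^sup>2 * f)"
proof -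
  obtain gs where "set gs \<subseteq> mpolys n" "f = (\<Sum>h\<leftarrow>gs. h\<^sup>2)"
    using assms(1) by (auto simp: sum_of_squares_def)
  then have "set (map ((*) g) gs) \<subseteq> mpolys n" "g\<^sup>2 * f = (\<Sum>h\<leftarrow>map ((*) g) gs. h\<^sup>2)"
    using assms(2) by (auto intro: mpolys_mult simp: power_mult_distrib sum_list_const_mult o_def)
  then show ?thesis unfolding sum_of_squares_def by blast
qed

lemma sos_const_mult:
  assumes "0 \<le> a" "sum_of_squares n f"
  shows "sum_of_squares n (mpoly_const a * f)"
proof -
  have "mpoly_const a = (mpoly_const (sqrt a))\<^sup>2"
    using assms(1) by (simp flip: mpoly_const_power)
  then show ?thesis using sos_mult_square[OF assms(2) mpolys_const] by simp
qed

definition mean :: "nat \<Rightarrow> (nat \<Rightarrow> mpoly_real) \<Rightarrow> mpoly_real" where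
  "mean n f = mpoly_const (1 / real n) * (\<Sum>i = 1..n. f i)"

lemma sos_mean: "(\<And>i. 1 \<le> i \<Longrightarrow> i \<le> n \<Longrightarrow> sum_of_squares n (f i)) \<Longrightarrow> sum_of_squares n (mean n f)"
  unfolding mean_def by (intro sos_const_mult sos_sum) auto

lemma mean_add: "mean n (\<lambda>i. f i + g i) = mean n f + mean n g"
  by (simp add: mean_def sum.distrib distrib_left)

lemma mean_diff: "mean n (\<lambda>i. f i - g i) = mean n f - mean n g"
  by (simp add: mean_def sum_subtractf right_diff_distrib)

lemma mean_mult: "mean n (\<lambda>i. f i * c) = mean n f * c"
  by (simp add: mean_def sum_distrib_right mult.assoc)

lemma of_nat_eq_mpoly_const: "of_nat k = mpoly_const (real k)"
  by (induction k) (simp_all add: mpoly_const_add)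

lemma mean_const: "0 < n \<Longrightarrow> mean n (\<lambda>i. c) = c"
  by (simp add: mean_def of_nat_eq_mpoly_const mult.assoc[symmetric] flip: mpoly_const_mult)

lemma mean_var: "mean n (\<lambda>i. mpoly_var i ^ r) = power_mean n r"
  by (simp add: mean_def power_mean_def)

lemma sos_variance:
  assumes "0 < n"
  shows "sum_of_squares n (power_mean n 4 - (power_mean n 2)\<^sup>2)"
proof -
  let ?P = "power_mean n" and ?X = "mpoly_var"
  have "(\<lambda>i. (?X i ^ 2 - ?P 2)\<^sup>2) = (\<lambda>i. ?X i ^ 4 - ?X i ^ 2 * (2 * ?P 2) + (?P 2)\<^sup>2)"
    by (rule ext) (simp add: eval_nat_numeral algebra_simps)
  then have "mean n (\<lambda>i. (?X i ^ 2 - ?P 2)\<^sup>2) = ?P 4 - (?P 2)\<^sup>2"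
    by (simp only: mean_add mean_diff mean_mult mean_var mean_const[OF assms])
       (simp add: power2_eq_square algebra_simps)
  moreover have "sum_of_squares n (mean n (\<lambda>i. (?X i ^ 2 - ?P 2)\<^sup>2))"
    by (intro sos_mean sos_square mpolys_intros) auto
  ultimately show ?thesis by simp
qed

text \<open>The mean of the squares of \<open>x * (x^2 - s * P2)\<close>: the polynomial form of
  m_2^2 \<le> m_3, linearised at m_2 = s.\<close>

lemma sos_sextic:
  "sum_of_squares n (power_mean n 6 - 2 * mpoly_const s * power_mean n 2 * power_mean n 4
      + (mpoly_const s)\<^sup>2 * power_mean n 2 ^ 3)"
proof -
  let ?P = "power_mean n" and ?X = "mpoly_var" and ?s = "mpoly_const s"
  have "(\<lambda>i. (?X i * (?X i ^ 2 - ?s * ?P 2))\<^sup>2)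
      = (\<lambda>i. ?X i ^ 6 - ?X i ^ 4 * (2 * ?s * ?P 2) + ?X i ^ 2 * (?s * ?P 2)\<^sup>2)"
    by (rule ext) (simp add: eval_nat_numeral algebra_simps)
  then have "mean n (\<lambda>i. (?X i * (?X i ^ 2 - ?s * ?P 2))\<^sup>2)
      = ?P 6 - 2 * ?s * ?P 2 * ?P 4 + ?s\<^sup>2 * ?P 2 ^ 3"
    by (simp only: mean_add mean_diff mean_mult mean_var)
       (simp add: eval_nat_numeral algebra_simps)
  moreover have "sum_of_squares n (mean n (\<lambda>i. (?X i * (?X i ^ 2 - ?s * ?P 2))\<^sup>2))"
    by (intro sos_mean sos_square mpolys_intros) auto
  ultimately show ?thesis by simp
qed

text \<open>The homogenised fourth moment inequality with constant slope \<open>t\<close>;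
  \<open>?K\<close> is the mean of \<open>x^4 - t * P2 * x^2\<close>, so a variance is
  computed.\<close>

lemma sos_octic:
  assumes "0 < n"
  shows "sum_of_squares n (power_mean n 8 - 2 * mpoly_const t * power_mean n 2 * power_mean n 6
      + (mpoly_const t * power_mean n 2)\<^sup>2 * power_mean n 4 - (power_mean n 4 - mpoly_const t * (power_mean n 2)\<^sup>2)\<^sup>2)"
proof -
  let ?P = "power_mean n" and ?X = "mpoly_var" and ?t = "mpoly_const t"
  let ?K = "?P 4 - ?t * (?P 2)\<^sup>2"
  have "(x ^ 4 - x ^ 2 * (t * p) - k)\<^sup>2
      = x ^ 8 - x ^ 6 * (2 * t * p) + x ^ 4 * ((t * p)\<^sup>2 - 2 * k) + x ^ 2 * (2 * t * p * k) + k\<^sup>2"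
    for x t p k :: mpoly_real
    by (simp add: eval_nat_numeral algebra_simps)
  then have "mean n (\<lambda>i. (?X i ^ 4 - ?X i ^ 2 * (?t * ?P 2) - ?K)\<^sup>2)
      = ?P 8 - ?P 6 * (2 * ?t * ?P 2) + ?P 4 * ((?t * ?P 2)\<^sup>2 - 2 * ?K) + ?P 2 * (2 * ?t * ?P 2 * ?K) + ?K\<^sup>2"
    by (simp only: mean_add mean_diff mean_mult mean_var mean_const[OF assms])
  also have "\<dots> = ?P 8 - 2 * ?t * ?P 2 * ?P 6 + (?t * ?P 2)\<^sup>2 * ?P 4 - ?K\<^sup>2"
    by (simp add: power2_eq_square algebra_simps)
  finally have "mean n (\<lambda>i. (?X i ^ 4 - ?X i ^ 2 * (?t * ?P 2) - ?K)\<^sup>2)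
      = ?P 8 - 2 * ?t * ?P 2 * ?P 6 + (?t * ?P 2)\<^sup>2 * ?P 4 - ?K\<^sup>2" .
  moreover have "sum_of_squares n (mean n (\<lambda>i. (?X i ^ 4 - ?X i ^ 2 * (?t * ?P 2) - ?K)\<^sup>2))"
    by (intro sos_mean sos_square mpolys_intros) auto
  ultimately show ?thesis by simp
qed

text \<open>Lagrange's identity for m_2^2 \<le> m_1 m_3, as a mean over all pairs of variables. This
  determinant has degree 8; in degree 6 its linearisation \<open>sos_sextic\<close> takes its
  place.\<close>

lemma sos_pairs: "sum_of_squares n (2 * (power_mean n 6 * power_mean n 2 - (power_mean n 4)\<^sup>2))"
proof -
  let ?P = "power_mean n" and ?X = "mpoly_var"
  have "(x * y * (x ^ 2 - y ^ 2))\<^sup>2 = y ^ 2 * x ^ 6 - y ^ 4 * (2 * x ^ 4) + y ^ 6 * x ^ 2" for x y :: mpoly_real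
    by (simp add: eval_nat_numeral algebra_simps)
  then have "mean n (\<lambda>i. mean n (\<lambda>j. (?X i * ?X j * (?X i ^ 2 - ?X j ^ 2))\<^sup>2))
      = mean n (\<lambda>i. ?P 2 * ?X i ^ 6 - ?P 4 * (2 * ?X i ^ 4) + ?P 6 * ?X i ^ 2)"
    by (simp only: mean_add mean_diff mean_mult mean_var)
  also have "\<dots> = mean n (\<lambda>i. ?X i ^ 6 * ?P 2 - ?X i ^ 4 * (2 * ?P 4) + ?X i ^ 2 * ?P 6)"
    by (simp add: mult_ac)
  also have "\<dots> = 2 * (?P 6 * ?P 2 - (?P 4)\<^sup>2)"
    by (simp only: mean_add mean_diff mean_mult mean_var) (simp add: power2_eq_square algebra_simps)
  finally have "mean n (\<lambda>i. mean n (\<lambda>j. (?X i * ?X j * (?X i ^ 2 - ?X j ^ 2))\<^sup>2))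
      = 2 * (?P 6 * ?P 2 - (?P 4)\<^sup>2)" .
  moreover have "sum_of_squares n (mean n (\<lambda>i. mean n (\<lambda>j. (?X i * ?X j * (?X i ^ 2 - ?X j ^ 2))\<^sup>2)))"
    by (intro sos_mean sos_square mpolys_intros) auto
  ultimately show ?thesis by simp
qed

lemma sos_mult:
  assumes "sum_of_squares n f" "sum_of_squares n g"
  shows "sum_of_squares n (f * g)"
proof -
  obtain hs where "set hs \<subseteq> mpolys n" "f = (\<Sum>h\<leftarrow>hs. h\<^sup>2)"
    using assms(1) by (auto simp: sum_of_squares_def)
  then have "f * g = (\<Sum>i<length hs. (hs ! i)\<^sup>2 * g)" "\<And>i. i < length hs \<Longrightarrow> hs ! i \<in> mpolys n"
    by (auto simp: sum_list_sum_nth atLeast0LessThan sum_distrib_right)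
  then show ?thesis
    using sos_mult_square[OF assms(2)] by (auto intro!: sos_sum)
qed

lemma sos_power_mean_even: "sum_of_squares n (power_mean n (2 * r))"
proof -
  have "power_mean n (2 * r) = mean n (\<lambda>i. (mpoly_var i ^ r)\<^sup>2)"
    by (simp add: mean_def power_mean_def power_mult[symmetric] mult.commute)
  also have "sum_of_squares n \<dots>"
    by (intro sos_mean sos_square mpolys_intros) auto
  finally show ?thesis .
qed

lemma sos_power_mean_2: "sum_of_squares n (power_mean n 2)"
  using sos_power_mean_even[of n 1] by simp

text \<open>The moments m_1, ..., m_4 of the measures from \<open>two_atoms_with_moments\<close>,
  indexed by the degree in the original variables; the last case stands for
  \<open>r = 8\<close>.\<close>

definition atom_moment :: "real \<Rightarrow> real \<Rightarrow> nat \<Rightarrow> real" where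
  "atom_moment u w r = (if r = 2 then 1 else if r = 4 then 1 + u else if r = 6 then 1 + u + w * u
    else (1 + u)\<^sup>2 + w\<^sup>2 * u)"

lemma PSD_atom_moment:
  assumes c: "c \<in> even_PSD_cone k" and k: "k \<le> 8" and u: "0 \<le> u" and w: "1 + u \<le> w"
  shows "0 \<le> (\<Sum>\<mu>\<in>even_partitions k. c \<mu> * (\<Prod>r\<in>#\<mu>. atom_moment u w r))"
proof -
  have "\<exists>p a b. 0 \<le> p \<and> p \<le> 1 \<and> 0 \<le> a \<and> 0 \<le> b \<and>
      (\<forall>r\<in>{2, 4, 6, 8}. p * a ^ (r div 2) + (1 - p) * b ^ (r div 2) = atom_moment u w r)"
  proof (cases "u = 0")
    case True
    then show ?thesis by (intro exI[of _ 1]) (simp add: atom_moment_def)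
  next
    case False
    with u have "0 < u" by simp
    from two_atoms_with_moments[OF this w] obtain p a b where
      "0 \<le> p" "p \<le> 1" "0 \<le> a" "0 \<le> b" "p * a + (1 - p) * b = 1"
      "p * a ^ 2 + (1 - p) * b ^ 2 = 1 + u" "p * a ^ 3 + (1 - p) * b ^ 3 = 1 + u + w * u"
      "p * a ^ 4 + (1 - p) * b ^ 4 = (1 + u)\<^sup>2 + w\<^sup>2 * u" .
    then show ?thesis by (intro exI[of _ p] exI[of _ a] exI[of _ b]) (simp add: atom_moment_def)
  qed
  then obtain p a b where p: "0 \<le> p" "p \<le> 1" and ab: "0 \<le> a" "0 \<le> b"
    and eq: "\<And>r. r \<in> {2, 4, 6, 8} \<Longrightarrow> p * a ^ (r div 2) + (1 - p) * b ^ (r div 2) = atom_moment u w r"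
    by blast
  have "(\<Prod>r\<in>#\<mu>. p * a ^ (r div 2) + (1 - p) * b ^ (r div 2)) = (\<Prod>r\<in>#\<mu>. atom_moment u w r)"
    if \<mu>: "\<mu> \<in> even_partitions k" for \<mu>
  proof (intro arg_cong[where f = prod_mset] image_mset_cong eq)
    fix r assume r: "r \<in># \<mu>"
    then have "r \<le> k" "even r" "0 < r"
      using \<mu> by (auto simp: even_partitions_eq_bounded bounded_partitions_def)
    then have "r \<le> 8" "even r" "0 < r" using k by auto
    then show "r \<in> {2, 4, 6, 8}" by (auto; presburger)
  qed
  then show ?thesis
    using PSD_two_atoms[OF c p ab] by simp
qed

lemma PSD_subset_SOS_2: "even_PSD_cone 2 \<subseteq> even_SOS_cone 2"
proof
  fix c assume c: "c \<in> even_PSD_cone 2"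
  have "0 \<le> c {#2#}"
    using PSD_atom_moment[OF c, of 0 1] by (simp add: sum_even_partitions_2 atom_moment_def)
  then have "sum_of_squares n (power_mean_form 2 n c)" for n
    by (simp add: power_mean_form_def power_mean_partition_def sum_even_partitions_2 sos_const_mult sos_power_mean_2)
  then show "c \<in> even_SOS_cone 2"
    using c by (simp add: even_SOS_cone_def even_PSD_cone_def)
qed

lemma PSD_subset_SOS_4: "even_PSD_cone 4 \<subseteq> even_SOS_cone 4"
proof
  fix c assume c: "c \<in> even_PSD_cone 4"
  define A where "A = c {#4#}"
  define B where "B = c {#2, 2#}"
  have nonneg: "0 \<le> A * u + (A + B)" if "0 \<le> u" for u
    using PSD_atom_moment[OF c, of u "1 + u"] that
    by (simp add: sum_even_partitions_4 atom_moment_def A_def B_def algebra_simps)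
  then have A: "0 \<le> A" by (rule linear_lower_growth)
  have AB: "0 \<le> A + B" using nonneg[of 0] by simp
  have "sum_of_squares n (power_mean_form 4 n c)" if "4 \<le> n" for n
  proof -
    let ?P = "power_mean n"
    have "power_mean_form 4 n c = mpoly_const A * (?P 4 - (?P 2)\<^sup>2) + mpoly_const (A + B) * (?P 2)\<^sup>2"
      by (simp add: power_mean_form_def power_mean_partition_def sum_even_partitions_4 A_def B_def
          mpoly_const_add power2_eq_square algebra_simps)
    also have "sum_of_squares n \<dots>"
      using that by (intro sos_add sos_const_mult A AB sos_variance sos_square mpolys_intros) simp
    finally show ?thesis .
  qed
  then show "c \<in> even_SOS_cone 4"
    using c by (simp add: even_SOS_cone_def even_PSD_cone_def)
qed

text \<open>At \<open>w = 1 + u\<close>, where m_3 = m_2^2, the form is a quadratic in u and splits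
  as \<epsilon> + \<alpha> u + A (u - t)^2. The last term is the value there of
  \<open>sos_sextic\<close> with \<open>s = 1 + t\<close>, the middle one a variance.\<close>

lemma PSD_subset_SOS_6: "even_PSD_cone 6 \<subseteq> even_SOS_cone 6"
proof
  fix c assume c: "c \<in> even_PSD_cone 6"
  define A where "A = c {#6#}"
  define B where "B = c {#4, 2#}"
  define C where "C = c {#2, 2, 2#}"
  have nonneg: "0 \<le> A * (1 + u + w * u) + B * (1 + u) + C" if "0 \<le> u" "1 + u \<le> w" for u w
    using PSD_atom_moment[OF c _ that]
    by (simp add: sum_even_partitions_6 atom_moment_def A_def B_def C_def)
  have A: "0 \<le> A"
    by (rule linear_lower_growth[of 2 A "2 * A + 2 * B + C"]) (use nonneg[of 1] in \<open>simp add: algebra_simps\<close>)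
  have "0 \<le> A * u\<^sup>2 + (2 * A + B) * u + (A + B + C)" if "0 \<le> u" for u
    using nonneg[OF that, of "1 + u"] by (simp add: power2_eq_square algebra_simps)
  from quadratic_nonneg_on_half_line[OF this] obtain \<epsilon> \<alpha> t where
    *: "0 \<le> \<epsilon>" "0 \<le> \<alpha>" and eq: "2 * A + B = \<alpha> - 2 * A * t" "A + B + C = \<epsilon> + A * t\<^sup>2"
    by metis
  have B: "B = \<alpha> - 2 * A * (1 + t)" using eq(1) by (simp add: algebra_simps)
  have C: "C = \<epsilon> + A * (1 + t)\<^sup>2 - \<alpha>" using eq by (simp add: power2_eq_square algebra_simps)
  have "sum_of_squares n (power_mean_form 6 n c)" if "6 \<le> n" for n
  proof -
    let ?P = "power_mean n"
    have "power_mean_form 6 n c = mpoly_const A * ?P 6 + mpoly_const B * (?P 4 * ?P 2) + mpoly_const C * (?P 2 * (?P 2 * ?P 2))"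
      by (simp add: power_mean_form_def power_mean_partition_def sum_even_partitions_6 A_def B_def C_def)
    also have "\<dots> = mpoly_const A * (?P 6 - 2 * mpoly_const (1 + t) * ?P 2 * ?P 4 + (mpoly_const (1 + t))\<^sup>2 * ?P 2 ^ 3)
        + mpoly_const \<alpha> * (?P 2 * (?P 4 - (?P 2)\<^sup>2)) + mpoly_const \<epsilon> * ((?P 2)\<^sup>2 * ?P 2)"
      unfolding B C mpoly_const_hom by (simp add: eval_nat_numeral algebra_simps)
    also have "sum_of_squares n \<dots>"
      using that * A
      by (intro sos_add sos_const_mult sos_sextic sos_mult sos_variance sos_power_mean_2 sos_square mpolys_intros) auto
    finally show ?thesis .
  qed
  then show "c \<in> even_SOS_cone 6"
    using c by (simp add: even_SOS_cone_def even_PSD_cone_def)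
qed

text \<open>Subtracting \<open>A\<close> times \<open>sos_octic\<close> at \<theta> leaves m_3 with
  coefficient \<open>B + 2 * A * \<theta>\<close>, which is nonnegative and is absorbed by
  \<open>sos_pairs\<close>. What remains is a quadratic in u, nonnegative on the half line by
  \<open>quartic_certificate\<close>.\<close>

lemma PSD_subset_SOS_8: "even_PSD_cone 8 \<subseteq> even_SOS_cone 8"
proof
  fix c assume c: "c \<in> even_PSD_cone 8"
  define A where "A = c {#8#}"
  define B where "B = c {#6, 2#}"
  define C where "C = c {#4, 4#}"
  define E where "E = c {#4, 2, 2#}"
  define G where "G = c {#2, 2, 2, 2#}"
  have "0 \<le> A * w\<^sup>2 * u + B * w * u + ((A + C) * u\<^sup>2 + (2 * A + 2 * C + B + E) * u + (A + B + C + E + G))"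
    if "0 \<le> u" "1 + u \<le> w" for u w
    using PSD_atom_moment[OF c _ that]
    by (simp add: sum_even_partitions_8 atom_moment_def A_def B_def C_def E_def G_def power2_eq_square algebra_simps)
  from quartic_certificate[OF this] obtain \<theta> where A: "0 \<le> A" and \<kappa>: "0 \<le> B + 2 * A * \<theta>"
    and rest: "\<And>u. 0 \<le> u \<Longrightarrow> 0 \<le> (A + C) * u\<^sup>2 + (2 * A + 2 * C + B + E) * u + (A + B + C + E + G)
        - A * \<theta>\<^sup>2 * u + (B + 2 * A * \<theta>) * u * (1 + u)"
    by blast
  define \<kappa> where "\<kappa> = (B + 2 * A * \<theta>) / 2"
  have "0 \<le> (A + C + 2 * \<kappa>) * u\<^sup>2 + (2 * A + 2 * C + B + E - A * \<theta>\<^sup>2 + 2 * \<kappa>) * u + (A + B + C + E + G)"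
    if "0 \<le> u" for u
  proof -
    have "B + 2 * A * \<theta> = 2 * \<kappa>" by (simp add: \<kappa>_def)
    then show ?thesis
      using rest[OF that] by (simp add: power2_eq_square algebra_simps)
  qed
  from quadratic_nonneg_on_half_line[OF this] obtain \<epsilon> \<alpha> g t where
    *: "0 \<le> \<epsilon>" "0 \<le> \<alpha>" "0 \<le> g" and eq: "A + C + 2 * \<kappa> = g"
      "2 * A + 2 * C + B + E - A * \<theta>\<^sup>2 + 2 * \<kappa> = \<alpha> - 2 * g * t" "A + B + C + E + G = \<epsilon> + g * t\<^sup>2"
    by metis
  have B: "B = 2 * \<kappa> - 2 * A * \<theta>" by (simp add: \<kappa>_def field_simps)
  have C: "C = g - A - 2 * \<kappa>" using eq(1) by simp
  have E: "E = \<alpha> - 2 * g * t - 2 * g + 2 * A * \<theta> + A * \<theta>\<^sup>2"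
    using eq(2) unfolding B C by (simp add: algebra_simps)
  have G: "G = \<epsilon> + g * t\<^sup>2 + 2 * g * t + g - \<alpha> - A * \<theta>\<^sup>2"
    using eq(3) unfolding B C E by (simp add: algebra_simps)
  have "0 \<le> \<kappa>" using \<kappa> by (simp add: \<kappa>_def)
  have "sum_of_squares n (power_mean_form 8 n c)" if "8 \<le> n" for n
  proof -
    let ?P = "power_mean n" and ?c = mpoly_const
    have "power_mean_form 8 n c = ?c A * ?P 8 + ?c B * (?P 6 * ?P 2) + ?c C * (?P 4 * ?P 4)
        + ?c E * (?P 4 * (?P 2 * ?P 2)) + ?c G * (?P 2 * (?P 2 * (?P 2 * ?P 2)))"
      by (simp add: power_mean_form_def power_mean_partition_def sum_even_partitions_8 A_def B_def C_def E_def G_def)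
    also have "\<dots> = ?c A * (?P 8 - 2 * ?c \<theta> * ?P 2 * ?P 6 + (?c \<theta> * ?P 2)\<^sup>2 * ?P 4 - (?P 4 - ?c \<theta> * (?P 2)\<^sup>2)\<^sup>2)
        + ?c \<kappa> * (2 * (?P 6 * ?P 2 - (?P 4)\<^sup>2)) + ?c g * (?P 4 - (?P 2)\<^sup>2 - ?c t * (?P 2)\<^sup>2)\<^sup>2
        + ?c \<alpha> * ((?P 2)\<^sup>2 * (?P 4 - (?P 2)\<^sup>2)) + ?c \<epsilon> * ((?P 2)\<^sup>2 * (?P 2)\<^sup>2)"
      unfolding B C E G mpoly_const_hom by (simp add: eval_nat_numeral algebra_simps)
    also have "sum_of_squares n \<dots>"
      using that * A \<open>0 \<le> \<kappa>\<close>
      by (intro sos_add sos_const_mult sos_octic sos_pairs sos_mult sos_variance sos_square mpolys_intros) auto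
    finally show ?thesis .
  qed
  then show "c \<in> even_SOS_cone 8"
    using c by (simp add: even_SOS_cone_def even_PSD_cone_def)
qed

section \<open>The comparison of the cones\<close>

lemma SOS_strict_subset_PSD:
  assumes "5 \<le> d"
  shows "\<exists>c. c \<in> even_PSD_cone (2 * d) \<and> c \<notin> even_SOS_cone (2 * d)"
proof -
  consider "d = 5" | "d = 6" | e where "4 \<le> e" "d = e + 3"
  proof -
    have "d = 5 \<or> d = 6 \<or> (4 \<le> d - 3 \<and> d = (d - 3) + 3)" using assms by auto
    then show ?thesis using that by blast
  qed
  then show ?thesis
  proof cases
    case 1
    then show ?thesis using decic_in_PSD decic_not_SOS by blast
  next
    case 2
    then show ?thesis using dodecic_in_PSD dodecic_not_SOS by blast
  next
    case 3
    obtain \<sigma> where "0 < \<sigma>" "coeff_vector (e + 3) (robinson_ps e \<sigma>) \<notin> even_SOS_cone (2 * (e + 3))"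
      using robinson_ps_not_SOS[OF 3(1)] by blast
    moreover have "coeff_vector (e + 3) (robinson_ps e \<sigma>) \<in> even_PSD_cone (2 * (e + 3))"
      using 3(1) \<open>0 < \<sigma>\<close> by (intro robinson_ps_in_PSD) auto
    ultimately show ?thesis using 3(2) by blast
  qed
qed

lemma PSD_subset_SOS:
  assumes "1 \<le> d" "d < 5"
  shows "even_PSD_cone (2 * d) \<subseteq> even_SOS_cone (2 * d)"
proof -
  have "d = 1 \<or> d = 2 \<or> d = 3 \<or> d = 4" using assms by auto
  then show ?thesis
    using PSD_subset_SOS_2 PSD_subset_SOS_4 PSD_subset_SOS_6 PSD_subset_SOS_8 by (elim disjE) simp_all
qed

theorem theorem1p6:
  fixes d :: nat
  assumes "d \<ge> 1"
  shows "even_SOS_cone (2 * d) \<subseteq> even_PSD_cone (2 * d) \<and>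
         (even_SOS_cone (2 * d) \<subset> even_PSD_cone (2 * d) \<longleftrightarrow> 2 * d \<ge> 10)"
proof (cases "5 \<le> d")
  case True
  then show ?thesis
    using even_SOS_cone_subset[of "2 * d"] SOS_strict_subset_PSD[OF True] by auto
next
  case False
  then show ?thesis
    using even_SOS_cone_subset[of "2 * d"] PSD_subset_SOS[OF assms] by auto
qed

end
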